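(* For each $a\in\{2,3,\dots\}$, the noncolliding random walk started at $\delta_{2a\mathbb{Z}}=\sum_{k\in\mathbb{Z}}\delta_{2ak}$, denoted $(\Xi(t),t\in\mathbb{N}_0,\mathbb{P}_{\delta_{2a\mathbb{Z}}})$, is well-defined as a determinantal process with the correlation kernel $$\mathbb{K}_{\delta_{2a\mathbb{Z}}}(s,x;t,y)=\sum_{j\in\mathbb{Z}}p(s,x|2aj)\,\mathcal{M}^{2aj}_{\delta_{2a\mathbb{Z}}}(t,y)-\mathbf{1}(s>t)\,p(s-t,x|y)$$ if $(s,x),(t,y)\in\mathbb{N}_0\times\mathbb{Z}$ with $s+x$ and $t+y$ even, and $\mathbb{K}_{\delta_{2a\mathbb{Z}}}(s,x;t,y)=0$ otherwise. That is, the functions $\mathcal{M}^{2aj}_{\delta_{2a\mathbb{Z}}}$ and the kernel are well-defined, and the law $\mathbb{P}_{\delta_{2a\mathbb{Z}}}$ (with expectation $\mathbb{E}_{\delta_{2a\mathbb{Z}}}$) is determined, in the sense of finite dimensional distributions, by the following: for every $M\in\mathbb{N}$, every sequence of times $t_1<\cdots<t_M\le T$ in $\mathbb{N}$ (with $T\in\mathbb{N}$), and every sequence of bounded functions $f_{t_1},\dots,f_{t_M}$ on $\mathbb{Z}$, with $\chi_{t_m}=e^{f_{t_m}}-1$, the moment generating function of the multitime distribution is given by the Fredholm determinant $$\mathbb{E}_{\delta_{2a\mathbb{Z}}}\Big[\exp\Big\{\sum_{m=1}^M\int_{\mathbb{Z}}f_{t_m}(x)\,\Xi(t_m,dx)\Big\}\Big]=\mathop{\mathrm{Det}}_{(s,t)\in\{t_1,\dots,t_M\}^2,\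 (x,y)\in\mathbb{Z}^2}\Big[\delta_{st}\delta_x(\{y\})+\mathbb{K}_{\delta_{2a\mathbb{Z}}}(s,x;t,y)\chi_t(y)\Big].$$
   Context: $\mathbb{N}=\{1,2,\dots\}$, $\mathbb{N}_0=\{0\}\cup\mathbb{N}$. $\Xi(t)$ takes values in the nonnegative integer-valued Radon measures on $\mathbb{Z}$ with at most one point at each site. $\mathbf{1}(\cdot)$ is the indicator. $p(t,y|x)=2^{-t}\binom{t}{[t+(y-x)]/2}$ if $t\in\mathbb{N}_0$, $|y-x|\le t$ and $t+(y-x)$ is even, and $0$ otherwise (transition probability of the simple symmetric random walk on $\mathbb{Z}$). Let $\widetilde S(0)=0$, $\widetilde S(t)=\widetilde\zeta(1)+\cdots+\widetilde\zeta(t)$ with $\widetilde\zeta(1),\widetilde\zeta(2),\dots$ i.i.d. with the hyperbolic secant density $\frac{1}{2\cosh(\pi x/2)}$ on $\mathbb{R}$, and let $\widetilde{\mathrm{E}}$ be the corresponding expectation. For $k\in\mathbb{Z}$, $$\Phi^{2ak}_{\delta_{2a\mathbb{Z}}}(z)=\lim_{L\to\infty}\prod_{j\in\mathbb{Z}:\,j\ne k,\,|2aj|\le L}\frac{z-2aj}{2ak-2aj}=\frac{\sin(\pi(z/2a-k))}{\pi(z/2a-k)},\quad z\in\mathbb{C},$$ $$\mathcal{M}^{2ak}_{\delta_{2a\mathbb{Z}}}(t,y)=\widetilde{\mathrm{E}}\big[\Phi^{2ak}_{\delta_{2a\mathbb{Z}}}(y+i\widetilde S(t))\big]=\frac{1}{2\pi}\int_{-\pi}^{\pi}d\lambda\,\frac{e^{i\lambda(y/2a-k)}}{[\cos(\lambda/2a)]^t}.$$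 The Fredholm determinant is defined by $$\mathrm{Det}\big[\delta_{st}\delta_x(\{y\})+\mathbf{K}(s,x;t,y)\chi_t(y)\big]=\sum_{N_1,\dots,N_M\ge0}\ \sum_{\substack{x^{(m)}_1<\cdots<x^{(m)}_{N_m}\text{ in }\mathbb{Z},\\1\le m\le M}}\ \prod_{m=1}^M\prod_{j=1}^{N_m}\chi_{t_m}(x^{(m)}_j)\det_{\substack{1\le j\le N_m,\,1\le k\le N_n\\1\le m,n\le M}}\big[\mathbf{K}(t_m,x^{(m)}_j;t_n,x^{(n)}_k)\big].$$
   Formalization: The generating function identity is required only for those bounded functions f for which the Fredholm expansion converges absolutely (shown to include all absolutely summable f); for general bounded f, e.g. f = -1, the expansion diverges and the identity has no meaning. *)

theory Defs
  imports "HOL-Probability.Probability" "Jordan_Normal_Form.Determinant"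
begin

text \<open>Transition probability \<open>p(t, y | x)\<close> of the simple symmetric random walk on the integers.\<close>

definition rw_prob :: "nat \<Rightarrow> int \<Rightarrow> int \<Rightarrow> real" where
  "rw_prob t y x =
     (if \<bar>y - x\<bar> \<le> int t \<and> even (int t + (y - x))
      then real (t choose nat ((int t + (y - x)) div 2)) / 2 ^ t else 0)"


text \<open>The i.i.d. steps with hyperbolic secant density are the coordinates of the infinite product
  space; coordinate \<open>0\<close> is not used.\<close>

definition sech_distribution :: "real measure" where
  "sech_distribution = density lborel (\<lambda>x. ennreal (1 / (2 * cosh (pi * x / 2))))"

definition sech_space :: "(nat \<Rightarrow> real) measure" where
  "sech_space = PiM UNIV (\<lambda>_. sech_distribution)"

definition sech_walk :: "nat \<Rightarrow> (nat \<Rightarrow> real) \<Rightarrow> real" where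
  "sech_walk t \<zeta> = (\<Sum>n = 1..t. \<zeta> n)"


definition Phi_partial :: "int \<Rightarrow> int \<Rightarrow> real \<Rightarrow> complex \<Rightarrow> complex" where
  "Phi_partial a k L z =
     (\<Prod>j\<in>{j. j \<noteq> k \<and> real_of_int \<bar>2 * a * j\<bar> \<le> L}.
        (z - of_int (2 * a * j)) / (of_int (2 * a * k) - of_int (2 * a * j)))"

definition Phi :: "int \<Rightarrow> int \<Rightarrow> complex \<Rightarrow> complex" where
  "Phi a k z = Lim at_top (\<lambda>L::real. Phi_partial a k L z)"

definition mart_fun :: "int \<Rightarrow> int \<Rightarrow> nat \<Rightarrow> int \<Rightarrow> complex" where
  "mart_fun a k t y =
     (\<integral>\<zeta>. Phi a k (of_int y + \<i> * of_real (sech_walk t \<zeta>)) \<partial>sech_space)"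

definition corr_kernel :: "int \<Rightarrow> nat \<Rightarrow> int \<Rightarrow> nat \<Rightarrow> int \<Rightarrow> complex" where
  "corr_kernel a s x t y =
     (if even (int s + x) \<and> even (int t + y)
      then (\<Sum>\<^sub>\<infinity>j. of_real (rw_prob s x (2 * a * j)) * mart_fun a j t y)
           - (if s > t then of_real (rw_prob (s - t) x y) else 0)
      else 0)"


text \<open>Configurations: nonnegative integer-valued Radon measures on the integers with at most one
  point at each site. As the integers are discrete and countable, it suffices to constrain the mass
  of each singleton. The \<open>\<sigma>\<close>-algebra is generated by the occupation events.\<close>

definition configs :: "int measure set" where
  "configs = {\<mu>. sets \<mu> = UNIV \<and> (\<forall>x. emeasure \<mu> {x} \<in> {0, 1})}"

definition config_space :: "int measure measure" where
  "config_space = sigma configs (range (\<lambda>x. {\<mu> \<in> configs. emeasure \<mu> {x} = 1}))"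

definition path_space :: "(nat \<Rightarrow> int measure) measure" where
  "path_space = PiM UNIV (\<lambda>_. config_space)"

text \<open>The image of counting measure under \<open>k \<mapsto> 2ak\<close> is the sum of the unit masses at \<open>2ak\<close>.\<close>

definition equidistant_config :: "int \<Rightarrow> int measure" where
  "equidistant_config a = distr (count_space UNIV) (count_space UNIV) (\<lambda>k. 2 * a * k)"


text \<open>In the Fredholm expansion over times \<open>ts = [t\<^sub>1, \<dots>, t\<^sub>M]\<close>, the strictly increasing tuples
  \<open>x\<^sup>(\<^sup>m\<^sup>)\<close> form a list \<open>xss\<close> of \<open>M\<close> lists. The rows and columns of the block matrix are numbered
  by the space-time points \<open>(t\<^sub>m, x\<^sup>(\<^sup>m\<^sup>)\<^sub>j)\<close>, ordered by \<open>m\<close> and then by \<open>j\<close>.\<close>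

definition st_points :: "nat list \<Rightarrow> int list list \<Rightarrow> (nat \<times> int) list" where
  "st_points ts xss = concat (map2 (\<lambda>t xs. map (Pair t) xs) ts xss)"

definition kernel_det ::
  "(nat \<Rightarrow> int \<Rightarrow> nat \<Rightarrow> int \<Rightarrow> complex) \<Rightarrow> (nat \<times> int) list \<Rightarrow> complex" where
  "kernel_det K ps =
     Determinant.det (Matrix.mat (length ps) (length ps)
       (\<lambda>(i, j). K (fst (ps ! i)) (snd (ps ! i)) (fst (ps ! j)) (snd (ps ! j))))"

definition fredholm_term ::
  "nat list \<Rightarrow> (nat \<Rightarrow> int \<Rightarrow> nat \<Rightarrow> int \<Rightarrow> complex) \<Rightarrow> (nat \<Rightarrow> int \<Rightarrow> real) \<Rightarrow> int list list \<Rightarrow> complex"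
  where
  "fredholm_term ts K h xss =
     of_real (\<Prod>m<length ts. \<Prod>x\<leftarrow>xss ! m. h (ts ! m) x) * kernel_det K (st_points ts xss)"

definition increasing_tuples :: "nat list \<Rightarrow> int list list set" where
  "increasing_tuples ns = {xss. map length xss = ns \<and> (\<forall>xs\<in>set xss. sorted_wrt (<) xs)}"

definition fredholm_det ::
  "nat list \<Rightarrow> (nat \<Rightarrow> int \<Rightarrow> nat \<Rightarrow> int \<Rightarrow> complex) \<Rightarrow> (nat \<Rightarrow> int \<Rightarrow> real) \<Rightarrow> complex" where
  "fredholm_det ts K h =
     (\<Sum>\<^sub>\<infinity>ns\<in>{ns. length ns = length ts}. \<Sum>\<^sub>\<infinity>xss\<in>increasing_tuples ns. fredholm_term ts K h xss)"

text \<open>For complex-valued families, \<open>summable_on\<close> is absolute convergence.\<close>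

definition fredholm_convergent ::
  "nat list \<Rightarrow> (nat \<Rightarrow> int \<Rightarrow> nat \<Rightarrow> int \<Rightarrow> complex) \<Rightarrow> (nat \<Rightarrow> int \<Rightarrow> real) \<Rightarrow> bool" where
  "fredholm_convergent ts K h \<longleftrightarrow>
     fredholm_term ts K h summable_on (\<Union>ns\<in>{ns. length ns = length ts}. increasing_tuples ns)"


text \<open>\<open>observation_times T ts\<close>: \<open>ts\<close> is a nonempty sequence \<open>t\<^sub>1 < \<dots> < t\<^sub>M \<le> T\<close> of positive times.\<close>

definition observation_times :: "nat \<Rightarrow> nat list \<Rightarrow> bool" where
  "observation_times T ts \<longleftrightarrow> ts \<noteq> [] \<and> sorted_wrt (<) ts \<and> set ts \<subseteq> {1..T}"

text \<open>For an infinite configuration and a bounded \<open>f\<close> that does not decay (for instance a nonzero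
  constant) neither the integral of \<open>f\<close> nor the Fredholm expansion need converge. The moment
  generating function is therefore prescribed for those bounded \<open>f\<close> whose Fredholm expansion
  converges absolutely.\<close>

definition determinantal_law ::
  "(nat \<Rightarrow> int \<Rightarrow> nat \<Rightarrow> int \<Rightarrow> complex) \<Rightarrow> (nat \<Rightarrow> int measure) measure \<Rightarrow> bool" where
  "determinantal_law K P \<longleftrightarrow>
     (\<forall>T ts f. observation_times T ts \<and> (\<forall>t\<in>set ts. bounded (range (f t))) \<and>
        fredholm_convergent ts K (\<lambda>t x. exp (f t x) - 1) \<longrightarrow>
        (AE \<Xi> in P. \<forall>t\<in>set ts. integrable (\<Xi> t) (f t)) \<and>
        integrable P (\<lambda>\<Xi>. exp (\<Sum>t\<leftarrow>ts. \<integral>x. f t x \<partial>\<Xi> t)) \<and>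
        complex_of_real (\<integral>\<Xi>. exp (\<Sum>t\<leftarrow>ts. \<integral>x. f t x \<partial>\<Xi> t) \<partial>P) =
          fredholm_det ts K (\<lambda>t x. exp (f t x) - 1))"

text \<open>Equality of measures on \<open>path_space\<close> is equality of all finite dimensional distributions, so
  a law is identified with its finite dimensional distributions.\<close>

definition is_law_from ::
  "int measure \<Rightarrow> (nat \<Rightarrow> int measure) measure \<Rightarrow> bool" where
  "is_law_from \<xi> P \<longleftrightarrow>
     prob_space P \<and> sets P = sets path_space \<and> (AE \<Xi> in P. \<Xi> 0 = \<xi>)"

end

(*
A finite number of noncolliding walkers is an h-transform of independent walkers. Its generating
function is det(v(i, u j)), where v(i, .) is a polynomial martingale function transported backwards
in time with the weights exp f. This determinant is nonnegative: one step is multilinear, walkers of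
equal parity can only meet, and the determinant vanishes when they do. Duhamel's formula and
Sylvester's identity turn it into a Fredholm determinant of the kernel K over space-time points.

For walkers started at 2aj, |j| <= N, the martingale functions are averages of finite products over
a hyperbolic secant walk, whose moment generating function 1 / cos inverts the averaging step of the
simple walk. As a >= 2, these products grow slower than the tails of the secant density decay, so by
dominated convergence the kernels converge as N tends to infinity, and the nonnegativity of the
generating functions passes to the limit. The leading coefficients of these multilinear polynomials
are the probabilities of cylinder events, and Kolmogorov's extension theorem gives the law.

The law determines and is determined by its correlations: absolute convergence of the Fredholm
expansion dominates the expansions over finite boxes of sites.
*)

theory Submission
  imports Defs
begin

section \<open>Determinants over finite index sets\<close>

text \<open>Only one inequality passes to the limit: for weights \<open>y p \<ge> 0\<close> on a
  finite set of space-time points, the sum over its subsets \<open>S\<close> of the product of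
  \<open>y p - 1\<close> over \<open>S\<close> times the kernel determinant on \<open>S\<close> is
  real and nonnegative. It involves finitely many kernel entries, so entrywise convergence suffices
  and no law of a finite system is constructed. The kernel is complex valued and no symmetry makes
  its minors visibly real; their reality is extracted from the same inequality. The assumption
  \<open>a \<ge> 2\<close> enters through growth. At height s above the real axis the products grow
  at most like exp (pi |s| / (2 a)) times a power of |s|, while the secant walk has exponential
  moments only of rate below pi / 2, so a = 1 is the critical case. Absorbing the power into one
  more exponential gives the rate (pi + 1) / (2 a), at most (pi + 1) / 4, which is below pi / 2.
  Determinants are indexed by finite sets because the points of a configuration carry no order and
  minors over subsets are what is summed.\<close>

definition set_det :: "'i set \<Rightarrow> ('i \<Rightarrow> 'i \<Rightarrow> 'a::comm_ring_1) \<Rightarrow> 'a" where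
  "set_det S A = (\<Sum>\<sigma> | \<sigma> permutes S. of_int (sign \<sigma>) * (\<Prod>i\<in>S. A i (\<sigma> i)))"

lemma set_det_cong:
  assumes "\<And>i j. i \<in> S \<Longrightarrow> j \<in> S \<Longrightarrow> A i j = B i j"
  shows "set_det S A = set_det S B"
  unfolding set_det_def
  by (intro sum.cong refl arg_cong2[where f = "(*)"] prod.cong assms) (auto simp: permutes_in_image)

lemma set_det_eq_det:
  "set_det {..<n} A = Determinant.det (Matrix.mat n n (\<lambda>(i, j). A i j))"
proof -
  have "Determinant.det (Matrix.mat n n (\<lambda>(i, j). A i j)) =
      (\<Sum>\<sigma> | \<sigma> permutes {0..<n}. of_int (sign \<sigma>) *
        (\<Prod>i = 0..<n. Matrix.mat n n (\<lambda>(i, j). A i j) $$ (i, \<sigma> i)))"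
    by (subst det_def'[of _ n]) auto
  also have "\<dots> = set_det {..<n} A"
    unfolding set_det_def lessThan_atLeast0
    by (intro sum.cong refl arg_cong2[where f = "(*)"] prod.cong) (auto simp: permutes_in_image)
  finally show ?thesis by simp
qed

lemma set_det_transpose:
  fixes A :: "'i \<Rightarrow> 'i \<Rightarrow> 'a::comm_ring_1"
  assumes S: "finite S"
  shows "set_det S (\<lambda>i j. A j i) = set_det S A"
proof -
  have "set_det S (\<lambda>i j. A j i) =
      (\<Sum>\<sigma> | \<sigma> permutes S. of_int (sign (inv_into UNIV \<sigma>)) * (\<Prod>i\<in>S. A (inv_into UNIV \<sigma> i) i))"
    unfolding set_det_def
    by (rule sum.reindex_bij_witness[of _ "inv_into UNIV" "inv_into UNIV"])
      (auto simp: permutes_inv permutes_inv_inv)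
  also have "\<dots> = set_det S A"
    unfolding set_det_def
  proof (intro sum.cong refl arg_cong2[where f = "(*)"])
    fix \<sigma> assume "\<sigma> \<in> {\<sigma>. \<sigma> permutes S}"
    then have p: "\<sigma> permutes S" by simp
    show "of_int (sign (inv_into UNIV \<sigma>)) = (of_int (sign \<sigma>) :: 'a)"
      by (metis S p permutation_permutes sign_inverse)
    have "(\<Prod>i\<in>S. A (inv_into UNIV \<sigma> i) i) = (\<Prod>i\<in>S. A (inv_into UNIV \<sigma> (\<sigma> i)) (\<sigma> i))"
      by (rule prod.reindex_bij_betw[OF permutes_imp_bij[OF p], symmetric])
    then show "(\<Prod>i\<in>S. A (inv_into UNIV \<sigma> i) i) = (\<Prod>i\<in>S. A i (\<sigma> i))"
      by (simp add: permutes_inverses[OF p])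
  qed
  finally show ?thesis .
qed

text \<open>Conjugating permutations with \<open>f\<close> preserves their signs. Hence an
  enumeration of the points may be chosen freely; \<open>det_backward_eq\<close> lists them by
  time.\<close>

lemma set_det_reindex:
  assumes f: "bij_betw f S T" and S: "finite S"
  shows "set_det T A = set_det S (\<lambda>i j. A (f i) (f j))"
proof -
  have gf: "inv_into S f (f x) = x" if "x \<in> S" for x
    using f that by (simp add: bij_betw_inv_into_left)
  have inj: "inj_on f S" and img: "f ` S = T" using f by (auto simp: bij_betw_def)
  let ?F = "map_permutation S f"
  have F: "?F \<sigma> (f i) = f (\<sigma> i)" if "i \<in> S" for \<sigma> i
    using that gf by (simp add: map_permutation_def restrict_id_def)
  show ?thesis
    unfolding set_det_def
  proof (rule sum.reindex_cong[where l = ?F])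
    show "inj_on ?F {\<sigma>. \<sigma> permutes S}"
    proof (rule inj_onI, rule ext)
      fix \<sigma> \<tau> i assume p: "\<sigma> \<in> {\<sigma>. \<sigma> permutes S}" "\<tau> \<in> {\<sigma>. \<sigma> permutes S}" and e: "?F \<sigma> = ?F \<tau>"
      show "\<sigma> i = \<tau> i"
      proof (cases "i \<in> S")
        case True
        then have "f (\<sigma> i) = f (\<tau> i)" using F e by metis
        then show ?thesis using True p inj by (auto simp: permutes_in_image dest: inj_onD)
      qed (use p in \<open>auto simp: permutes_not_in\<close>)
    qed
    show "{\<sigma>. \<sigma> permutes T} = ?F ` {\<sigma>. \<sigma> permutes S}"
    proof (intro equalityI subsetI)
      fix \<tau> assume "\<tau> \<in> {\<sigma>. \<sigma> permutes T}"
      then have t: "\<tau> permutes T" by simp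
      have "map_permutation S f (map_permutation T (inv_into S f) \<tau>) = \<tau>"
        using t f by (subst map_permutation_compose[OF bij_betw_inv_into[OF f] inj])
          (subst map_permutation_cong[of _ _ _ T id \<tau>],
           auto simp: bij_betw_def inv_into_injective f_inv_into_f inj_on_def permutes_in_image)
      moreover have "map_permutation T (inv_into S f) \<tau> permutes S"
        by (rule map_permutation_permutes[OF bij_betw_inv_into[OF f] t])
      ultimately show "\<tau> \<in> ?F ` {\<sigma>. \<sigma> permutes S}" by (metis imageI mem_Collect_eq)
    qed (use map_permutation_permutes[OF f] in auto)
    fix \<sigma> assume "\<sigma> \<in> {\<sigma>. \<sigma> permutes S}"
    then have p: "\<sigma> permutes S" by simp
    have s: "sign (?F \<sigma>) = sign \<sigma>"
      by (rule sign_map_permutation) (use p inj S in auto)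
    have "(\<Prod>i\<in>T. A i (?F \<sigma> i)) = (\<Prod>i\<in>S. A (f i) (?F \<sigma> (f i)))"
      by (rule prod.reindex_bij_betw[OF f, symmetric])
    also have "\<dots> = (\<Prod>i\<in>S. A (f i) (f (\<sigma> i)))"
      by (intro prod.cong refl) (auto simp: F)
    finally show "of_int (sign (?F \<sigma>)) * (\<Prod>i\<in>T. A i (?F \<sigma> i)) =
        of_int (sign \<sigma>) * (\<Prod>i\<in>S. A (f i) (f (\<sigma> i)))"
      using s by simp
  qed
qed

text \<open>Each row is either taken from the identity or from \<open>A\<close>. Taking the identity
  on \<open>F - S\<close> forces the permutation to fix these points and leaves the minor on
  \<open>S\<close>: this is the Fredholm expansion of a finite matrix.\<close>

lemma set_det_one_plus:
  fixes A :: "'i \<Rightarrow> 'i \<Rightarrow> 'a::comm_ring_1"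
  assumes F: "finite F"
  shows "set_det F (\<lambda>p q. of_bool (p = q) + c p * A p q) =
    (\<Sum>S\<in>Pow F. (\<Prod>p\<in>S. c p) * set_det S A)"
proof -
  have "set_det F (\<lambda>p q. of_bool (p = q) + c p * A p q) =
      (\<Sum>\<sigma> | \<sigma> permutes F. of_int (sign \<sigma>) *
        (\<Sum>S\<in>Pow F. (\<Prod>p\<in>S. c p * A p (\<sigma> p)) * (\<Prod>p\<in>F - S. of_bool (p = \<sigma> p))))"
    unfolding set_det_def by (subst prod_add[OF F, symmetric]) (simp add: add.commute)
  also have "\<dots> = (\<Sum>S\<in>Pow F. \<Sum>\<sigma> | \<sigma> permutes F. of_int (sign \<sigma>) *
        (\<Prod>p\<in>S. c p * A p (\<sigma> p)) * (\<Prod>p\<in>F - S. of_bool (p = \<sigma> p)))"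
    by (subst sum.swap) (simp add: sum_distrib_left mult.assoc)
  also have "\<dots> = (\<Sum>S\<in>Pow F. (\<Prod>p\<in>S. c p) * set_det S A)"
  proof (intro sum.cong refl)
    fix S assume S: "S \<in> Pow F"
    then have fS: "finite S" "finite (F - S)" using F finite_subset by auto
    have "(\<Sum>\<sigma> | \<sigma> permutes F. of_int (sign \<sigma>) *
        (\<Prod>p\<in>S. c p * A p (\<sigma> p)) * (\<Prod>p\<in>F - S. of_bool (p = \<sigma> p))) =
      (\<Sum>\<sigma> | \<sigma> permutes S. of_int (sign \<sigma>) *
        (\<Prod>p\<in>S. c p * A p (\<sigma> p)) * (\<Prod>p\<in>F - S. of_bool (p = \<sigma> p)))"
    proof (rule sum.mono_neutral_right)
      show "finite {\<sigma>. \<sigma> permutes F}" by (rule finite_permutations[OF F])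
      show "{\<sigma>. \<sigma> permutes S} \<subseteq> {\<sigma>. \<sigma> permutes F}"
        using S permutes_subset by auto
      show "\<forall>\<sigma>\<in>{\<sigma>. \<sigma> permutes F} - {\<sigma>. \<sigma> permutes S}. of_int (sign \<sigma>) *
        (\<Prod>p\<in>S. c p * A p (\<sigma> p)) * (\<Prod>p\<in>F - S. of_bool (p = \<sigma> p)) = 0"
      proof
        fix \<sigma> assume "\<sigma> \<in> {\<sigma>. \<sigma> permutes F} - {\<sigma>. \<sigma> permutes S}"
        then obtain x where "x \<in> F - S" "\<sigma> x \<noteq> x"
          by (auto dest: permutes_superset[of _ F S])
        then have "(\<Prod>p\<in>F - S. of_bool (p = \<sigma> p)) = (0::'a)"
          using fS by (metis (full_types) of_bool_eq(1) prod_zero)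
        then show "of_int (sign \<sigma>) *
          (\<Prod>p\<in>S. c p * A p (\<sigma> p)) * (\<Prod>p\<in>F - S. of_bool (p = \<sigma> p)) = 0" by simp
      qed
    qed
    also have "\<dots> = (\<Sum>\<sigma> | \<sigma> permutes S. (\<Prod>p\<in>S. c p) * (of_int (sign \<sigma>) * (\<Prod>p\<in>S. A p (\<sigma> p))))"
    proof (intro sum.cong refl)
      fix \<sigma> assume "\<sigma> \<in> {\<sigma>. \<sigma> permutes S}"
      then have "(\<Prod>p\<in>F - S. of_bool (p = \<sigma> p)) = (1::'a)"
        by (intro prod.neutral) (auto simp: permutes_not_in)
      then show "of_int (sign \<sigma>) * (\<Prod>p\<in>S. c p * A p (\<sigma> p)) * (\<Prod>p\<in>F - S. of_bool (p = \<sigma> p)) =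
        (\<Prod>p\<in>S. c p) * (of_int (sign \<sigma>) * (\<Prod>p\<in>S. A p (\<sigma> p)))"
        by (simp add: prod.distrib mult_ac)
    qed
    finally show "(\<Sum>\<sigma> | \<sigma> permutes F. of_int (sign \<sigma>) *
        (\<Prod>p\<in>S. c p * A p (\<sigma> p)) * (\<Prod>p\<in>F - S. of_bool (p = \<sigma> p))) = (\<Prod>p\<in>S. c p) * set_det S A"
      by (simp add: set_det_def sum_distrib_left)
  qed
  finally show ?thesis .
qed

text \<open>Multilinearity in the rows. For walkers, \<open>E\<close> consists of the two possible
  steps, and the functions in \<open>PiE\<close> are the joint steps of all walkers.\<close>

lemma set_det_sum_rows:
  fixes g :: "'e \<Rightarrow> 'i \<Rightarrow> 'i \<Rightarrow> 'a::comm_ring_1"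
  assumes S: "finite S" and E: "finite E"
  shows "set_det S (\<lambda>j i. \<Sum>e\<in>E. g e j i) = (\<Sum>\<epsilon>\<in>PiE S (\<lambda>_. E). set_det S (\<lambda>j i. g (\<epsilon> j) j i))"
  unfolding set_det_def
  by (subst prod_sum_PiE) (simp_all add: S E sum_distrib_left sum.swap[of _ "PiE S (\<lambda>_. E)"])

lemma set_det_scale_rows:
  fixes A :: "'i \<Rightarrow> 'i \<Rightarrow> 'a::comm_ring_1"
  shows "set_det S (\<lambda>j i. c j * A j i) = (\<Prod>j\<in>S. c j) * set_det S A"
  unfolding set_det_def by (simp add: prod.distrib sum_distrib_left mult_ac)

lemma set_det_equal_rows:
  fixes A :: "nat \<Rightarrow> nat \<Rightarrow> 'a::comm_ring_1"
  assumes "i < n" "j < n" "i \<noteq> j" "\<And>k. k < n \<Longrightarrow> A i k = A j k"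
  shows "set_det {..<n} A = 0"
  unfolding set_det_eq_det
  by (rule det_identical_rows[of _ n i j]) (use assms in \<open>auto simp: Matrix.row_def\<close>)

lemma kernel_det_distinct:
  assumes "distinct ps"
  shows "kernel_det K ps = set_det (set ps) (\<lambda>p q. K (fst p) (snd p) (fst q) (snd q))"
proof -
  have b: "bij_betw (nth ps) {..<length ps} (set ps)"
    using assms by (rule bij_betw_nth) auto
  show ?thesis
    unfolding kernel_det_def
    by (subst set_det_reindex[OF b]) (simp_all add: set_det_eq_det)
qed

lemma set_det_mult:
  fixes A B :: "nat \<Rightarrow> nat \<Rightarrow> 'a::comm_ring_1"
  shows "set_det {..<n} (\<lambda>j i. \<Sum>k<n. A j k * B k i) = set_det {..<n} A * set_det {..<n} B"
proof -
  have "Matrix.mat n n (\<lambda>(j, i). \<Sum>k<n. A j k * B k i) =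
      Matrix.mat n n (\<lambda>(j, k). A j k) * Matrix.mat n n (\<lambda>(k, i). B k i)"
    by (rule eq_matI) (auto simp: scalar_prod_def lessThan_atLeast0)
  then show ?thesis
    unfolding set_det_eq_det by (simp add: det_mult[of _ n])
qed

lemma set_det_lower_triangular:
  fixes A :: "nat \<Rightarrow> nat \<Rightarrow> 'a::idom"
  assumes "\<And>i j. i < j \<Longrightarrow> j < n \<Longrightarrow> A i j = 0"
  shows "set_det {..<n} A = (\<Prod>i<n. A i i)"
  unfolding set_det_eq_det
  by (subst det_lower_triangular[of n])
    (use assms in \<open>auto simp: diag_mat_def prod.list_conv_set_nth lessThan_atLeast0\<close>)

lemma set_det_upper_triangular:
  fixes A :: "nat \<Rightarrow> nat \<Rightarrow> 'a::idom"
  assumes "\<And>i j. j < i \<Longrightarrow> i < n \<Longrightarrow> A i j = 0"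
  shows "set_det {..<n} A = (\<Prod>i<n. A i i)"
  by (subst set_det_transpose[symmetric]) (simp_all add: set_det_lower_triangular assms)

lemma poly_eq_sum_lessThan:
  assumes "degree (q :: 'a::comm_semiring_1 poly) < n"
  shows "poly q x = (\<Sum>k<n. coeff q k * x ^ k)"
proof -
  have "(\<Sum>k\<le>degree q. coeff q k * x ^ k) = (\<Sum>k<n. coeff q k * x ^ k)"
    by (rule sum.mono_neutral_left) (use assms in \<open>auto simp: coeff_eq_0\<close>)
  then show ?thesis by (simp add: poly_altdef)
qed

text \<open>Passing to the Newton basis makes the Vandermonde matrix triangular.\<close>

lemma set_det_vandermonde:
  fixes x :: "nat \<Rightarrow> 'a::idom"
  shows "set_det {..<n} (\<lambda>j i. x j ^ i) = (\<Prod>j<n. \<Prod>k<j. x j - x k)"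
proof -
  define N where "N i = (\<Prod>k<i. [:- x k, 1:])" for i
  have deg: "degree (N i) = i" and lead: "coeff (N i) i = 1" for i
  proof -
    show d: "degree (N i) = i"
      unfolding N_def by (subst degree_prod_eq_sum_degree) auto
    have "lead_coeff (N i) = 1" unfolding N_def by (simp add: lead_coeff_prod)
    then show "coeff (N i) i = 1" by (simp add: d)
  qed
  have "set_det {..<n} (\<lambda>j i. poly (N i) (x j)) =
      set_det {..<n} (\<lambda>j i. \<Sum>k<n. x j ^ k * coeff (N i) k)"
    by (rule set_det_cong) (simp add: poly_eq_sum_lessThan[of _ n] deg mult.commute)
  also have "\<dots> = set_det {..<n} (\<lambda>j i. x j ^ i) * set_det {..<n} (\<lambda>k i. coeff (N i) k)"
    by (rule set_det_mult)
  also have "set_det {..<n} (\<lambda>k i. coeff (N i) k) = 1"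
    by (subst set_det_upper_triangular) (auto simp: lead deg coeff_eq_0)
  also have "set_det {..<n} (\<lambda>j i. poly (N i) (x j)) = (\<Prod>j<n. poly (N j) (x j))"
    by (rule set_det_lower_triangular) (auto simp: N_def poly_prod)
  finally show ?thesis by (simp add: N_def poly_prod)
qed

text \<open>Expansion in monomials factors the matrix into a Vandermonde matrix and a coefficient
  matrix. This is why the finite system works with polynomials of degree below the number of
  walkers.\<close>

lemma set_det_poly:
  fixes x :: "nat \<Rightarrow> 'a::idom"
  assumes "\<And>i. i < n \<Longrightarrow> degree (q i) < n"
  shows "set_det {..<n} (\<lambda>j i. poly (q i) (x j)) =
    (\<Prod>j<n. \<Prod>k<j. x j - x k) * set_det {..<n} (\<lambda>k i. coeff (q i) k)"
proof -
  have "set_det {..<n} (\<lambda>j i. poly (q i) (x j)) =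
      set_det {..<n} (\<lambda>j i. \<Sum>k<n. x j ^ k * coeff (q i) k)"
    by (rule set_det_cong) (simp add: poly_eq_sum_lessThan[of _ n] assms mult.commute)
  then show ?thesis by (simp only: set_det_mult set_det_vandermonde)
qed

text \<open>A form of Sylvester's identity: both sides evaluate the determinant of the block matrix with
  rows \<open>(1, B)\<close> and \<open>(-C, 1 - U)\<close>.\<close>

lemma det_one_plus_resolvent:
  fixes B C U W :: "'a::idom mat"
  assumes B: "B \<in> carrier_mat n m" and C: "C \<in> carrier_mat m n"
    and W: "W \<in> carrier_mat m n" and U: "U \<in> carrier_mat m m"
    and WC: "W = C + U * W" and det1: "Determinant.det (1\<^sub>m m - U) = 1"
  shows "Determinant.det (1\<^sub>m n + B * W) = Determinant.det (1\<^sub>m m - U + C * B)"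
proof -
  define Z where "Z = four_block_mat (1\<^sub>m n) B (- C) (1\<^sub>m m - U)"
  have Zc: "Z \<in> carrier_mat (n + m) (n + m)"
    unfolding Z_def using U by (intro four_block_carrier_mat) auto
  \<comment> \<open>\<open>WC\<close> says exactly that the column operation with \<open>W\<close>
    clears the lower left block; the result is block upper triangular, and \<open>det1\<close>
    leaves only the block \<open>1 + B W\<close>.\<close>
  have "- C + (1\<^sub>m m - U) * W = 0\<^sub>m m n"
  proof -
    have "(1\<^sub>m m - U) * W = W - U * W"
      using U W by (simp add: minus_mult_distrib_mat[of _ m m])
    also have "\<dots> = C"
    proof (rule eq_matI)
      fix i j assume ij: "i < dim_row C" "j < dim_col C"
      have "W $$ (i, j) = (C + U * W) $$ (i, j)" using WC by simp
      then show "(W - U * W) $$ (i, j) = C $$ (i, j)"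
        using ij C U W by (simp add: algebra_simps)
    qed (use C U W in auto)
    finally show ?thesis using C by (simp add: uminus_l_inv_mat[of _ m n])
  qed
  then have "Z * four_block_mat (1\<^sub>m n) (0\<^sub>m n m) W (1\<^sub>m m) =
      four_block_mat (1\<^sub>m n + B * W) B (0\<^sub>m m n) (1\<^sub>m m - U)"
    unfolding Z_def
    by (subst mult_four_block_mat[of _ n n _ m _ m _ _ n _ m])
      (use B C W U in \<open>auto simp: right_mult_one_mat[of _ m]\<close>)
  then have "Determinant.det Z * Determinant.det (four_block_mat (1\<^sub>m n) (0\<^sub>m n m) W (1\<^sub>m m)) =
      Determinant.det (four_block_mat (1\<^sub>m n + B * W) B (0\<^sub>m m n) (1\<^sub>m m - U))"
    using W by (subst det_mult[symmetric, OF Zc]) (auto intro: four_block_carrier_mat)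
  also have "Determinant.det (four_block_mat (1\<^sub>m n) (0\<^sub>m n m) W (1\<^sub>m m)) = 1"
    using W by (subst det_four_block_mat_upper_right_zero[of _ n _ m]) auto
  also have "Determinant.det (four_block_mat (1\<^sub>m n + B * W) B (0\<^sub>m m n) (1\<^sub>m m - U)) =
      Determinant.det (1\<^sub>m n + B * W)"
    using B W U det1 by (subst det_four_block_mat_lower_left_zero[of _ n _ m]) auto
  finally have 1: "Determinant.det Z = Determinant.det (1\<^sub>m n + B * W)" by simp
  \<comment> \<open>The other evaluation clears the same block by row operations with
    \<open>C\<close> and leaves the Schur complement \<open>?Q\<close>.\<close>
  let ?Q = "1\<^sub>m m - U + C * B"
  have "- (C * B) + ?Q = 1\<^sub>m m - U"
    by (rule eq_matI) (use B C U in auto)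
  then have "Z = four_block_mat (1\<^sub>m n) (0\<^sub>m n m) (- C) (1\<^sub>m m) * four_block_mat (1\<^sub>m n) B (0\<^sub>m m n) ?Q"
    unfolding Z_def
    by (subst mult_four_block_mat[of _ n n _ m _ m _ _ n _ m])
      (use B C U in \<open>auto simp: left_add_zero_mat[of _ n m]\<close>)
  then have "Determinant.det Z = Determinant.det (four_block_mat (1\<^sub>m n) (0\<^sub>m n m) (- C) (1\<^sub>m m)) *
      Determinant.det (four_block_mat (1\<^sub>m n) B (0\<^sub>m m n) ?Q)"
    using B C U by (simp add: det_mult[of _ "n + m"] four_block_carrier_mat)
  also have "Determinant.det (four_block_mat (1\<^sub>m n) (0\<^sub>m n m) (- C) (1\<^sub>m m)) = 1"
    using C by (subst det_four_block_mat_upper_right_zero[of _ n _ m]) auto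
  also have "Determinant.det (four_block_mat (1\<^sub>m n) B (0\<^sub>m m n) ?Q) = Determinant.det ?Q"
    using B C U by (subst det_four_block_mat_lower_left_zero[of _ n _ m]) auto
  finally show ?thesis using 1 by simp
qed

section \<open>Transition probabilities of the simple random walk\<close>

lemma rw_prob_alt:
  "rw_prob t y x = (if 0 \<le> int t + (y - x) \<and> even (int t + (y - x))
    then real (t choose nat ((int t + (y - x)) div 2)) / 2 ^ t else 0)"
proof (cases "even (int t + (y - x)) \<and> y - x > int t")
  case True
  then obtain m where "int t + (y - x) = 2 * m" by (blast elim: evenE)
  with True have "nat ((int t + (y - x)) div 2) > t" by simp
  with True show ?thesis by (simp add: rw_prob_def)
qed (auto simp: rw_prob_def)

lemma rw_prob_0: "rw_prob 0 y x = of_bool (y = x)"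
  by (auto simp: rw_prob_def)

lemma rw_prob_Suc: "rw_prob (Suc t) y x = (rw_prob t y (x + 1) + rw_prob t y (x - 1)) / 2"
proof (cases "0 \<le> int (Suc t) + (y - x) \<and> even (int (Suc t) + (y - x))")
  case True
  \<comment> \<open>\<open>m\<close> counts the up-steps. After a first step to \<open>x + 1\<close>
    there remain \<open>m - 1\<close> of them, after one to \<open>x - 1\<close> still
    \<open>m\<close>, so the claim is Pascal's rule.\<close>
  then obtain m where m: "int (Suc t) + (y - x) = 2 * int m"
    by (metis evenE nat_0_le zero_le_mult_iff zero_less_numeral linorder_not_less)
  then have e: "int t + (y - (x + 1)) = 2 * (int m - 1)" "int t + (y - (x - 1)) = 2 * int m" by auto
  show ?thesis
    unfolding rw_prob_alt m e
    by (cases m) (auto simp: add_divide_distrib nat_add_distrib)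
next
  case False
  then show ?thesis unfolding rw_prob_alt by auto
qed

section \<open>Finitely many noncolliding walkers\<close>

lemma sum_in_nonneg_Reals:
  "(\<And>i. i \<in> A \<Longrightarrow> f i \<in> \<real>\<^sub>\<ge>\<^sub>0) \<Longrightarrow> sum f A \<in> (\<real>\<^sub>\<ge>\<^sub>0 :: complex set)"
  by (simp add: complex_nonneg_Reals_iff sum_nonneg)

text \<open>\<open>n\<close> walkers start at \<open>u\<close>; \<open>M i t x\<close> are the polynomial martingale functions dual to \<open>u\<close>.\<close>

locale finite_walk =
  fixes n :: nat and u :: "nat \<Rightarrow> int" and M :: "nat \<Rightarrow> nat \<Rightarrow> int \<Rightarrow> complex"
  assumes u_mono: "i < j \<Longrightarrow> j < n \<Longrightarrow> u i < u j"
    and u_even: "i < n \<Longrightarrow> even (u i)"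
    and M_poly: "i < n \<Longrightarrow> \<exists>q. degree q < n \<and> (\<forall>x. M i t x = poly q (of_int x))"
    and M_martingale: "i < n \<Longrightarrow> M i t x = (M i (Suc t) (x + 1) + M i (Suc t) (x - 1)) / 2"
    and M_init: "i < n \<Longrightarrow> j < n \<Longrightarrow> M i 0 (u j) = of_bool (i = j)"
begin

definition vdm :: "(nat \<Rightarrow> int) \<Rightarrow> int" where
  "vdm x = (\<Prod>j<n. \<Prod>k<j. x j - x k)"

definition chamber :: "(nat \<Rightarrow> int) set" where
  "chamber = {x. (\<forall>i j. i < j \<longrightarrow> j < n \<longrightarrow> x i < x j) \<and> (\<forall>i<n. \<forall>j<n. even (x i - x j))}"

lemma chamberD:
  assumes "x \<in> chamber"
  shows "i < j \<Longrightarrow> j < n \<Longrightarrow> x i < x j" and "i < n \<Longrightarrow> j < n \<Longrightarrow> even (x i - x j)"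
  using assms unfolding chamber_def by blast+

abbreviation steps :: "(nat \<Rightarrow> int) set" where
  "steps \<equiv> PiE {..<n} (\<lambda>_. {-1, 1})"

lemma finite_steps: "finite steps"
  by (intro finite_PiE) auto

lemma u_chamber: "u \<in> chamber"
  by (simp add: chamber_def u_mono u_even)

lemma vdm_pos: "x \<in> chamber \<Longrightarrow> vdm x > 0"
  unfolding vdm_def chamber_def by (intro prod_pos) auto

text \<open>Walkers of equal parity cannot jump over each other.\<close>

lemma chamber_step:
  assumes x: "x \<in> chamber" and e: "\<epsilon> \<in> steps"
  shows "(\<lambda>j. x j + \<epsilon> j) \<in> chamber \<or> (\<exists>i j. i < j \<and> j < n \<and> x i + \<epsilon> i = x j + \<epsilon> j)"
proof -
  have ev: "\<epsilon> i = -1 \<or> \<epsilon> i = 1" if "i < n" for i using e that by (auto simp: PiE_iff)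
  have le: "x i + \<epsilon> i \<le> x j + \<epsilon> j" if ij: "i < j" "j < n" for i j
  proof -
    have "x i < x j" by (rule chamberD(1)[OF x ij])
    moreover obtain m where "x j - x i = 2 * m"
      using chamberD(2)[OF x ij(2) order.strict_trans[OF ij]] by (rule evenE)
    ultimately have "1 \<le> m" and "x j = x i + 2 * m" by linarith+
    then have "x i + 2 \<le> x j" by linarith
    then show ?thesis using ev[of i] ev[of j] ij by auto
  qed
  have par: "even ((x i + \<epsilon> i) - (x j + \<epsilon> j))" if "i < n" "j < n" for i j
  proof -
    have "even (x i - x j)" by (rule chamberD(2)[OF x that])
    then show ?thesis using ev[OF that(1)] ev[OF that(2)] by auto
  qed
  show ?thesis
  proof (rule disjCI)
    assume "\<not> (\<exists>i j. i < j \<and> j < n \<and> x i + \<epsilon> i = x j + \<epsilon> j)"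
    then have "x i + \<epsilon> i < x j + \<epsilon> j" if "i < j" "j < n" for i j
      using le[OF that] that by (auto simp: order.strict_iff_order)
    then show "(\<lambda>j. x j + \<epsilon> j) \<in> chamber"
      unfolding chamber_def using par by blast
  qed
qed

lemma vdm_step_nonneg:
  assumes "x \<in> chamber" "\<epsilon> \<in> steps"
  shows "vdm (\<lambda>j. x j + \<epsilon> j) \<ge> 0"
  using chamber_step[OF assms]
proof
  assume "\<exists>i j. i < j \<and> j < n \<and> x i + \<epsilon> i = x j + \<epsilon> j"
  then obtain i j where "i < j" "j < n" "x i + \<epsilon> i = x j + \<epsilon> j" by blast
  then have "vdm (\<lambda>j. x j + \<epsilon> j) = 0"
    unfolding vdm_def by (intro prod_zero bexI[of _ j] bexI[of _ i]) auto
  then show ?thesis by simp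
qed (use vdm_pos in \<open>auto intro: less_imp_le\<close>)

lemma M_martingale_sum: "i < n \<Longrightarrow> M i t x = (\<Sum>e\<in>{-1, 1}. (1 / 2) * M i (Suc t) (x + e))"
  by (subst M_martingale) (simp_all add: add_divide_distrib)

lemma det_M_step:
  "set_det {..<n} (\<lambda>j i. M i t (x j)) =
    (\<Sum>\<epsilon>\<in>steps. (1 / 2) ^ n * set_det {..<n} (\<lambda>j i. M i (Suc t) (x j + \<epsilon> j)))"
proof -
  have "set_det {..<n} (\<lambda>j i. M i t (x j)) =
      set_det {..<n} (\<lambda>j i. \<Sum>e\<in>{-1, 1}. (1 / 2) * M i (Suc t) (x j + e))"
    by (rule set_det_cong) (intro M_martingale_sum, simp)
  also have "\<dots> = (\<Sum>\<epsilon>\<in>steps. (1 / 2) ^ n * set_det {..<n} (\<lambda>j i. M i (Suc t) (x j + \<epsilon> j)))"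
    by (subst set_det_sum_rows) (simp_all only: set_det_scale_rows finite.intros finite_lessThan prod_constant card_lessThan)
  finally show ?thesis .
qed

text \<open>At each time the functions are polynomials of degree below \<open>n\<close>, so
  \<open>set_det_poly\<close> yields a multiple of \<open>vdm\<close> and only the sign of the
  factor is at issue. Duality at \<open>u\<close> fixes it at time 0, and one averaging step started
  at \<open>u\<close> carries positivity from \<open>t\<close> to \<open>Suc t\<close>.\<close>

lemma det_M_vdm: "\<exists>c>0. \<forall>x. set_det {..<n} (\<lambda>j i. M i t (x j)) = of_real (c * of_int (vdm x))"
proof -
  have vdm: "\<exists>c. \<forall>x. set_det {..<n} (\<lambda>j i. M i t (x j)) = c * of_int (vdm x)" for t
  proof -
    obtain q where q: "\<And>i. i < n \<Longrightarrow> degree (q i) < n \<and> (\<forall>x. M i t x = poly (q i) (of_int x))"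
      using M_poly[of _ t] by metis
    have "set_det {..<n} (\<lambda>j i. M i t (x j)) =
        set_det {..<n} (\<lambda>k i. coeff (q i) k) * of_int (vdm x)" for x
    proof -
      have "set_det {..<n} (\<lambda>j i. M i t (x j)) = set_det {..<n} (\<lambda>j i. poly (q i) (of_int (x j)))"
        by (rule set_det_cong) (use q in auto)
      also have "\<dots> = of_int (vdm x) * set_det {..<n} (\<lambda>k i. coeff (q i) k)"
        by (subst set_det_poly) (use q in \<open>auto simp: vdm_def\<close>)
      finally show ?thesis by (simp add: mult.commute)
    qed
    then show ?thesis by blast
  qed
  have up: "vdm u > 0" using u_chamber by (rule vdm_pos)
  show ?thesis
  proof (induction t)
    case 0
    obtain c where c: "\<And>x. set_det {..<n} (\<lambda>j i. M i 0 (x j)) = c * of_int (vdm x)"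
      using vdm by blast
    have "set_det {..<n} (\<lambda>j i. M i 0 (u j)) = set_det {..<n} (\<lambda>j i. of_bool (i = j))"
      by (rule set_det_cong) (simp add: M_init)
    also have "\<dots> = 1" by (subst set_det_lower_triangular) auto
    finally have "c * of_int (vdm u) = 1" by (simp add: c)
    then have "c = of_real (1 / of_int (vdm u))" using up by (simp add: field_simps)
    with c up show ?case by (intro exI[of _ "1 / of_int (vdm u)"]) auto
  next
    case (Suc t)
    obtain c where c: "c > 0" "\<And>x. set_det {..<n} (\<lambda>j i. M i t (x j)) = of_real (c * of_int (vdm x))"
      using Suc by blast
    obtain d where d: "\<And>x. set_det {..<n} (\<lambda>j i. M i (Suc t) (x j)) = d * of_int (vdm x)"
      using vdm by blast
    \<comment> \<open>The equation \<open>c * vdm u = d * r\<close> determines \<open>d\<close>. All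
      terms of \<open>r\<close> are nonnegative, and the joint step of every walker to the right
      translates \<open>u\<close>, so its term is positive.\<close>
    define r :: real where "r = (\<Sum>\<epsilon>\<in>steps. (1 / 2) ^ n * of_int (vdm (\<lambda>j. u j + \<epsilon> j)))"
    have "r > 0"
      unfolding r_def
    proof (rule sum_pos2[OF finite_steps, of "\<lambda>j\<in>{..<n}. 1"])
      have "(\<lambda>j. u j + (\<lambda>j\<in>{..<n}. 1) j) \<in> chamber"
        unfolding chamber_def mem_Collect_eq
      proof (intro conjI allI impI)
        fix i j assume "i < j" "j < n"
        then show "u i + (\<lambda>j\<in>{..<n}. 1) i < u j + (\<lambda>j\<in>{..<n}. 1) j"
          using u_mono[of i j] by simp
      qed (simp add: u_even)
      from vdm_pos[OF this]
      show "0 < (1 / 2) ^ n * real_of_int (vdm (\<lambda>j. u j + (\<lambda>j\<in>{..<n}. 1) j))" by simp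
    qed (use vdm_step_nonneg[OF u_chamber] in auto)
    have "of_real (c * of_int (vdm u)) = d * of_real r"
      using det_M_step[of t u]
      unfolding c d[of "\<lambda>j. u j + _ j"] r_def
      by (simp add: sum_distrib_left mult.left_commute)
    then have "d = of_real (c * of_int (vdm u) / r)"
      using \<open>r > 0\<close> by (simp add: field_simps)
    moreover have "c * of_int (vdm u) / r > 0" using c up \<open>r > 0\<close> by simp
    ultimately show ?case using d by (intro exI[of _ "c * of_int (vdm u) / r"]) auto
  qed
qed

text \<open>\<open>backward y T k i x\<close> is the value at time \<open>T - k\<close> of the function \<open>M i T\<close> transported backwards
  by the walk with weights \<open>y\<close>.\<close>

primrec backward :: "(nat \<Rightarrow> int \<Rightarrow> real) \<Rightarrow> nat \<Rightarrow> nat \<Rightarrow> nat \<Rightarrow> int \<Rightarrow> complex" where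
  "backward y T 0 i x = M i T x"
| "backward y T (Suc k) i x =
    (\<Sum>e\<in>{-1, 1}. of_real (y (T - k) (x + e) / 2) * backward y T k i (x + e))"

lemma det_backward_nonneg:
  assumes y: "\<And>t x. y t x \<ge> 0" and x: "x \<in> chamber"
  shows "set_det {..<n} (\<lambda>j i. backward y T k i (x j)) \<in> \<real>\<^sub>\<ge>\<^sub>0"
  using x
proof (induction k arbitrary: x)
  case 0
  obtain c where c: "c > 0" "\<And>x. set_det {..<n} (\<lambda>j i. M i T (x j)) = of_real (c * of_int (vdm x))"
    using det_M_vdm by blast
  have "c * of_int (vdm x) \<ge> 0" using vdm_pos[OF 0] c by simp
  then show ?case
    unfolding backward.simps c nonneg_Reals_of_real_iff .
next
  case (Suc k)
  have "set_det {..<n} (\<lambda>j i. backward y T (Suc k) i (x j)) =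
      (\<Sum>\<epsilon>\<in>steps. (\<Prod>j<n. of_real (y (T - k) (x j + \<epsilon> j) / 2)) *
        set_det {..<n} (\<lambda>j i. backward y T k i (x j + \<epsilon> j)))"
    unfolding backward.simps
    by (subst set_det_sum_rows) (simp_all only: set_det_scale_rows finite.intros finite_lessThan)
  also have "\<dots> \<in> \<real>\<^sub>\<ge>\<^sub>0"
  proof (rule sum_in_nonneg_Reals)
    fix \<epsilon> assume e: "\<epsilon> \<in> steps"
    have "set_det {..<n} (\<lambda>j i. backward y T k i (x j + \<epsilon> j)) \<in> \<real>\<^sub>\<ge>\<^sub>0"
      using chamber_step[OF Suc.prems e]
    proof
      assume "(\<lambda>j. x j + \<epsilon> j) \<in> chamber"
      from Suc.IH[OF this] show ?thesis .
    next
      assume "\<exists>i j. i < j \<and> j < n \<and> x i + \<epsilon> i = x j + \<epsilon> j"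
      then obtain i j where "i < j" "j < n" "x i + \<epsilon> i = x j + \<epsilon> j" by blast
      then have "set_det {..<n} (\<lambda>j i. backward y T k i (x j + \<epsilon> j)) = 0"
        by (intro set_det_equal_rows[of i n j]) auto
      then show ?thesis by simp
    qed
    moreover have "(\<Prod>j<n. complex_of_real (y (T - k) (x j + \<epsilon> j) / 2)) \<in> \<real>\<^sub>\<ge>\<^sub>0"
      unfolding of_real_prod[symmetric] nonneg_Reals_of_real_iff using y by (intro prod_nonneg) simp
    ultimately show "(\<Prod>j<n. of_real (y (T - k) (x j + \<epsilon> j) / 2)) *
        set_det {..<n} (\<lambda>j i. backward y T k i (x j + \<epsilon> j)) \<in> \<real>\<^sub>\<ge>\<^sub>0"
      by (rule nonneg_Reals_mult_I[rotated])
  qed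
  finally show ?case .
qed

text \<open>Expand the product of the weights \<open>1 + h\<close> at the first point
  \<open>p\<close> of \<open>F\<close> where \<open>h\<close> is chosen: until then the walk is
  free, which gives \<open>rw_prob\<close>, and from \<open>p\<close> on the fully weighted function
  takes over. If \<open>h\<close> is never chosen, the martingale property returns
  \<open>M i\<close>.\<close>

lemma backward_duhamel:
  assumes F: "finite F" "fst ` F \<subseteq> {1..T}" and k: "k \<le> T" and i: "i < n"
  shows "backward (\<lambda>t x. 1 + (if (t, x) \<in> F then h (t, x) else 0)) T k i x =
    M i (T - k) x + (\<Sum>p\<in>{p \<in> F. T - k < fst p}. of_real (rw_prob (fst p - (T - k)) (snd p) x * h p) *
      backward (\<lambda>t x. 1 + (if (t, x) \<in> F then h (t, x) else 0)) T (T - fst p) i (snd p))"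
    (is "?b k i x = _")
  using k
proof (induction k arbitrary: x)
  case 0
  have e: "{p \<in> F. T < fst p} = {}" using F(2) by force
  show ?case unfolding diff_zero e by simp
next
  case (Suc k)
  let ?s = "T - k"
  have Ts: "T - Suc k = ?s - 1" "?s \<ge> 1" "T - ?s = k" using Suc.prems by auto
  let ?g = "\<lambda>r p x. of_real (rw_prob (fst p - r) (snd p) x * h p) * ?b (T - fst p) i (snd p)"
  let ?A = "{p \<in> F. ?s < fst p}" and ?B = "{p \<in> F. ?s - 1 < fst p}"
  have B: "?B = ?A \<union> {p \<in> F. fst p = ?s}" using Ts by auto
  \<comment> \<open>Multiplication by the weight at the arrival site adds precisely the terms of
    time \<open>?s\<close>, since \<open>rw_prob 0\<close> is a Kronecker delta there; this enlarges
    \<open>?A\<close> to \<open>?B\<close>.\<close>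
  have step: "of_real (1 + (if (?s, z) \<in> F then h (?s, z) else 0)) * ?b k i z =
      M i ?s z + (\<Sum>p\<in>?B. ?g ?s p z)" for z
  proof -
    have "(\<Sum>p\<in>{p \<in> F. fst p = ?s}. ?g ?s p z) =
        (\<Sum>p\<in>{p \<in> F. fst p = ?s}. if p = (?s, z) then of_real (h (?s, z)) * ?b k i z else 0)"
      by (intro sum.cong refl) (auto simp: rw_prob_0 Ts(3))
    also have "\<dots> = (if (?s, z) \<in> F then of_real (h (?s, z)) * ?b k i z else 0)"
      using F(1) by (subst sum.delta) auto
    finally have 1: "(\<Sum>p\<in>{p \<in> F. fst p = ?s}. ?g ?s p z) =
        (if (?s, z) \<in> F then of_real (h (?s, z)) * ?b k i z else 0)" .
    have 2: "(\<Sum>p\<in>?B. ?g ?s p z) = (\<Sum>p\<in>?A. ?g ?s p z) + (\<Sum>p\<in>{p \<in> F. fst p = ?s}. ?g ?s p z)"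
      unfolding B by (rule sum.union_disjoint) (use F(1) in auto)
    have 3: "?b k i z = M i ?s z + (\<Sum>p\<in>?A. ?g ?s p z)"
      using Suc by simp
    show ?thesis unfolding 2 1 using 3 by (simp add: distrib_right add.assoc)
  qed
  have "?b (Suc k) i x = (\<Sum>e\<in>{-1, 1}. (1 / 2) *
      (of_real (1 + (if (?s, x + e) \<in> F then h (?s, x + e) else 0)) * ?b k i (x + e)))"
    by (simp add: field_simps)
  also have "\<dots> = (\<Sum>e\<in>{-1, 1}. (1 / 2) * M i ?s (x + e)) + (\<Sum>e\<in>{-1, 1}. (1 / 2) * (\<Sum>p\<in>?B. ?g ?s p (x + e)))"
    unfolding step by (simp only: distrib_left sum.distrib)
  also have "(\<Sum>e\<in>{-1, 1}. (1 / 2) * M i ?s (x + e)) = M i (?s - 1) x"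
  proof -
    have "Suc (?s - 1) = ?s" using Ts(2) by simp
    then show ?thesis using M_martingale_sum[OF i, of "?s - 1" x] by (simp only:)
  qed
  also have "(\<Sum>e\<in>{-1, 1}. (1 / 2) * (\<Sum>p\<in>?B. ?g ?s p (x + e))) =
      (\<Sum>p\<in>?B. \<Sum>e\<in>{-1, 1}. (1 / 2) * ?g ?s p (x + e))"
    by (simp only: sum_distrib_left) (rule sum.swap)
  also have "\<dots> = (\<Sum>p\<in>?B. ?g (?s - 1) p x)"
  proof (intro sum.cong refl)
    fix p assume "p \<in> ?B"
    then have "fst p - (?s - 1) = Suc (fst p - ?s)" using Ts(2) by (simp, linarith)
    then show "(\<Sum>e\<in>{-1, 1}. (1 / 2) * ?g ?s p (x + e)) = ?g (?s - 1) p x"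
      by (simp add: rw_prob_Suc distrib_right add_divide_distrib)
  qed
  finally show ?case by (simp only: Ts(1))
qed

text \<open>The extended kernel of Eynard-Mehta type: a biorthogonal sum over the starting points
  minus the free propagator between strictly ordered times.\<close>

definition walk_kernel :: "nat \<times> int \<Rightarrow> nat \<times> int \<Rightarrow> complex" where
  "walk_kernel p q = (\<Sum>j<n. of_real (rw_prob (fst p) (snd p) (u j)) * M j (fst q) (snd q)) -
    (if fst p > fst q then of_real (rw_prob (fst p - fst q) (snd p) (snd q)) else 0)"

lemma det_backward_eq:
  assumes F: "finite F" "fst ` F \<subseteq> {1..T}"
  shows "set_det {..<n} (\<lambda>j i. backward (\<lambda>t x. 1 + (if (t, x) \<in> F then h (t, x) else 0)) T T i (u j)) =
    set_det F (\<lambda>p q. of_bool (p = q) + of_real (h p) * walk_kernel p q)"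
proof -
  let ?b = "backward (\<lambda>t x. 1 + (if (t, x) \<in> F then h (t, x) else 0)) T"
  obtain xs where xs: "set xs = F" "distinct xs" using finite_distinct_list[OF F(1)] by blast
  \<comment> \<open>Listing the points by time makes \<open>U\<close>, which only connects strictly
    earlier to strictly later points, strictly upper triangular. Hence \<open>1 - U\<close> has
    determinant 1.\<close>
  define ps where "ps = sort_key fst xs"
  define m where "m = length ps"
  have ps: "set ps = F" "distinct ps" "sorted (map fst ps)" using xs by (auto simp: ps_def)
  have psF: "ps ! a \<in> F" if "a < m" for a using that ps by (auto simp: m_def)
  have bij: "bij_betw (nth ps) {..<m} F"
    using bij_betw_nth[OF ps(2), of "{..<m}" F] ps(1) by (simp add: m_def)
  have reidx: "(\<Sum>q\<in>F. g q) = (\<Sum>a<m. g (ps ! a))" for g :: "_ \<Rightarrow> complex"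
    by (rule sum.reindex_bij_betw[OF bij, symmetric])
  define w where "w p i = ?b (T - fst p) i (snd p)" for p i
  \<comment> \<open>\<open>B\<close> propagates from the starting points into \<open>F\<close>,
    \<open>C\<close> evaluates the free functions on \<open>F\<close>, and \<open>U\<close>
    propagates forward within \<open>F\<close>. Duhamel's formula then reads
    \<open>W = C + U * W\<close> on \<open>F\<close> and \<open>1 + B * W\<close> at the starting
    points.\<close>
  define B where "B = Matrix.mat n m (\<lambda>(j, a). of_real (rw_prob (fst (ps ! a)) (snd (ps ! a)) (u j) * h (ps ! a)) :: complex)"
  define C where "C = Matrix.mat m n (\<lambda>(a, i). M i (fst (ps ! a)) (snd (ps ! a)))"
  define W where "W = Matrix.mat m n (\<lambda>(a, i). w (ps ! a) i)"
  define U where "U = Matrix.mat m m (\<lambda>(a, b). if fst (ps ! a) < fst (ps ! b)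
    then of_real (rw_prob (fst (ps ! b) - fst (ps ! a)) (snd (ps ! b)) (snd (ps ! a)) * h (ps ! b)) else 0 :: complex)"
  have w: "w p i = M i (fst p) (snd p) + (\<Sum>q\<in>F. (if fst p < fst q then
      of_real (rw_prob (fst q - fst p) (snd q) (snd p) * h q) else 0) * w q i)" if "p \<in> F" "i < n" for p i
  proof -
    have Tp: "T - (T - fst p) = fst p" using that F(2) by force
    have "(\<Sum>q\<in>F. (if fst p < fst q then
        of_real (rw_prob (fst q - fst p) (snd q) (snd p) * h q) else 0) * w q i) =
      (\<Sum>q\<in>{q \<in> F. fst p < fst q}. of_real (rw_prob (fst q - fst p) (snd q) (snd p) * h q) * w q i)"
      by (rule sum.mono_neutral_cong_right) (use F in auto)
    then show ?thesis
      unfolding w_def using backward_duhamel[OF F, of "T - fst p" i h "snd p"] that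
      by (simp add: Tp)
  qed
  have WC: "W = C + U * W"
  proof (rule eq_matI)
    fix a i assume "a < dim_row (C + U * W)" "i < dim_col (C + U * W)"
    then have ai: "a < m" "i < n" by (auto simp: C_def U_def W_def)
    show "W $$ (a, i) = (C + U * W) $$ (a, i)"
      using ai w[OF psF[OF ai(1)] ai(2)]
      by (simp add: W_def C_def U_def scalar_prod_def reidx lessThan_atLeast0)
  qed (auto simp: W_def C_def U_def)
  have "1\<^sub>m m - U = Matrix.mat m m (\<lambda>(a, b). of_bool (a = b) - U $$ (a, b))"
    by (rule eq_matI) (auto simp: U_def)
  then have "Determinant.det (1\<^sub>m m - U) = set_det {..<m} (\<lambda>a b. of_bool (a = b) - U $$ (a, b))"
    by (simp add: set_det_eq_det)
  also have "\<dots> = 1"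
  proof (subst set_det_upper_triangular)
    fix a b assume ba: "b < a" "a < m"
    then have "fst (ps ! b) \<le> fst (ps ! a)"
      using ps(3) by (auto simp: sorted_iff_nth_mono_less m_def)
    then show "of_bool (a = b) - U $$ (a, b) = 0" using ba by (auto simp: U_def)
  qed (auto simp: U_def)
  finally have det1: "Determinant.det (1\<^sub>m m - U) = 1" .
  have "set_det {..<n} (\<lambda>j i. ?b T i (u j)) = Determinant.det (1\<^sub>m n + B * W)"
  proof -
    have "1\<^sub>m n + B * W = Matrix.mat n n (\<lambda>(j, i). ?b T i (u j))"
    proof (rule eq_matI)
      fix j i assume "j < dim_row (Matrix.mat n n (\<lambda>(j, i). ?b T i (u j)))"
        "i < dim_col (Matrix.mat n n (\<lambda>(j, i). ?b T i (u j)))"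
      then have ji: "j < n" "i < n" by auto
      have F0: "{q \<in> F. 0 < fst q} = F" using F(2) by force
      have "?b T i (u j) = of_bool (i = j) + (\<Sum>q\<in>F. of_real (rw_prob (fst q) (snd q) (u j) * h q) * w q i)"
        using backward_duhamel[OF F, of T i h "u j"] ji by (simp add: F0 w_def M_init)
      then show "(1\<^sub>m n + B * W) $$ (j, i) = Matrix.mat n n (\<lambda>(j, i). ?b T i (u j)) $$ (j, i)"
        using ji by (simp add: B_def W_def scalar_prod_def reidx lessThan_atLeast0)
    qed (auto simp: B_def W_def)
    then show ?thesis by (simp add: set_det_eq_det)
  qed
  also have "\<dots> = Determinant.det (1\<^sub>m m - U + C * B)"
    by (rule det_one_plus_resolvent[OF _ _ _ _ WC det1]) (auto simp: B_def C_def W_def U_def)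
  \<comment> \<open>\<open>?G\<close> is a transpose: the row index of \<open>C * B\<close> is the
    point at which \<open>M\<close> is evaluated, which is the second argument of
    \<open>walk_kernel\<close>.\<close>
  also let ?G = "Matrix.mat m m (\<lambda>(a, b).
      of_bool (ps ! b = ps ! a) + of_real (h (ps ! b)) * walk_kernel (ps ! b) (ps ! a))"
  have "1\<^sub>m m - U + C * B = ?G"
  proof (rule eq_matI)
    fix a b assume "a < dim_row (?G)"
      "b < dim_col (?G)"
    then have ab: "a < m" "b < m" by auto
    then have "ps ! b = ps ! a \<longleftrightarrow> a = b" using ps(2) by (auto simp: nth_eq_iff_index_eq m_def)
    then show "(1\<^sub>m m - U + C * B) $$ (a, b) = ?G $$ (a, b)"
      using ab by (auto simp: U_def B_def C_def walk_kernel_def scalar_prod_def lessThan_atLeast0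
        sum_distrib_left algebra_simps)
  qed (auto simp: U_def B_def C_def)
  also have "Determinant.det \<dots> = set_det {..<m} (\<lambda>a b.
      of_bool (ps ! a = ps ! b) + of_real (h (ps ! a)) * walk_kernel (ps ! a) (ps ! b))"
    by (subst set_det_transpose[symmetric]) (simp_all add: set_det_eq_det)
  also have "\<dots> = set_det F (\<lambda>p q. of_bool (p = q) + of_real (h p) * walk_kernel p q)"
    by (rule set_det_reindex[OF bij, symmetric]) simp
  finally show ?thesis .
qed

text \<open>With \<open>h p = y p - 1\<close> the total weight \<open>1 + h p\<close> of a point is
  \<open>y p\<close>, so the transported determinant is nonnegative, and
  \<open>set_det_one_plus\<close> unfolds it into the expansion.\<close>

lemma walk_kernel_expansion_nonneg:
  assumes F: "finite F" "\<And>p. p \<in> F \<Longrightarrow> fst p \<ge> 1" and y: "\<And>p. y p \<ge> 0"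
  shows "(\<Sum>S\<in>Pow F. of_real (\<Prod>p\<in>S. y p - 1) * set_det S walk_kernel) \<in> \<real>\<^sub>\<ge>\<^sub>0"
proof -
  \<comment> \<open>The inserted 1 keeps the maximum meaningful when \<open>F\<close> is
    empty.\<close>
  define T where "T = Max (insert 1 (fst ` F))"
  have "fst p \<le> T" if "p \<in> F" for p
    unfolding T_def using F(1) that by (intro Max_ge) auto
  then have T: "fst ` F \<subseteq> {1..T}" using F(2) by auto
  have "(\<Sum>S\<in>Pow F. of_real (\<Prod>p\<in>S. y p - 1) * set_det S walk_kernel) =
      set_det F (\<lambda>p q. of_bool (p = q) + of_real (y p - 1) * walk_kernel p q)"
    by (subst set_det_one_plus[OF F(1)]) simp
  also have "\<dots> = set_det {..<n} (\<lambda>j i. backward (\<lambda>t x. 1 + (if (t, x) \<in> F then y (t, x) - 1 else 0)) T T i (u j))"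
    by (rule det_backward_eq[OF F(1) T, symmetric])
  also have "\<dots> \<in> \<real>\<^sub>\<ge>\<^sub>0"
    by (rule det_backward_nonneg[OF _ u_chamber]) (use y in auto)
  finally show ?thesis .
qed

end

section \<open>The hyperbolic secant walk\<close>

definition sech_density :: "real \<Rightarrow> real" where
  "sech_density x = 1 / (2 * cosh (pi * x / 2))"

lemma sech_density_pos: "sech_density x > 0"
  by (simp add: sech_density_def)

lemma sech_density_measurable [measurable]: "sech_density \<in> borel_measurable borel"
  unfolding sech_density_def[abs_def] cosh_def by measurable

lemma sech_distribution_density:
  "sech_distribution = density lborel (\<lambda>x. ennreal (sech_density x))"
  by (simp add: sech_distribution_def sech_density_def)

text \<open>The logistic substitution \<open>x = ln (t / (1 - t)) / pi\<close> turns the moment generating function into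
  a Beta integral, which the reflection formula evaluates.\<close>

lemma sech_mgf_lborel:
  fixes l :: real
  assumes l: "\<bar>l\<bar> < pi / 2"
  shows "has_bochner_integral lborel (\<lambda>x. exp (l * x) * sech_density x) (1 / cos l)"
proof -
  \<comment> \<open>The substitution turns the integrand into
    \<open>t powr (a - 1) * (1 - t) powr (b - 1) / pi\<close>, which dictates these exponents. As
    \<open>a + b = 1\<close>, the Beta value is \<open>Gamma a * Gamma (1 - a)\<close>.\<close>
  define a where "a = 1 / 2 + l / pi"
  define b where "b = 1 / 2 - l / pi"
  have ab: "a > 0" "b > 0" "a + b = 1"
    using l by (auto simp: a_def b_def field_simps abs_less_iff)
  let ?f = "\<lambda>x. exp (l * x) * sech_density x"
  let ?g = "\<lambda>t::real. ln (t / (1 - t)) / pi"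
  let ?g' = "\<lambda>t::real. 1 / (pi * t * (1 - t))"
  let ?B = "\<lambda>t. t powr (a - 1) * (1 - t) powr (b - 1)"
  have fg: "?f (?g t) * ?g' t = ?B t / pi" if t: "0 < t" "t < 1" for t
  proof -
    define p q where "p = ln t" and "q = ln (1 - t)"
    have ep: "exp p = t" "exp q = 1 - t" using t by (auto simp: p_def q_def)
    have g: "?g t = (p - q) / pi" using t by (simp add: p_def q_def ln_div)
    have "2 * cosh (pi * ?g t / 2) = exp (- (p + q) / 2) * (exp p + exp q)"
    proof -
      have "pi * ?g t / 2 = (p - q) / 2" by (simp add: g)
      moreover have "- (p + q) / 2 + p = (p - q) / 2" "- (p + q) / 2 + q = - ((p - q) / 2)"
        by (simp_all add: field_simps)
      ultimately show ?thesis
        by (simp only: cosh_def distrib_left exp_add[symmetric]) (simp add: scaleR_conv_of_real)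
    qed
    also have "\<dots> = exp (- (p + q) / 2)" by (simp add: ep)
    also have "exp (- (p + q) / 2) = inverse (exp ((p + q) / 2))"
      by (simp only: exp_minus[symmetric] minus_divide_left)
    finally have "sech_density (?g t) = exp ((p + q) / 2)"
      unfolding sech_density_def by (simp add: inverse_eq_divide)
    moreover have "?g' t = exp (- p - q) / pi"
      using t by (simp add: exp_diff exp_minus ep field_simps)
    ultimately have "?f (?g t) * ?g' t = exp (l * ((p - q) / pi) + (p + q) / 2 + (- p - q)) / pi"
      unfolding g by (simp add: exp_add)
    also have "l * ((p - q) / pi) + (p + q) / 2 + (- p - q) = (a - 1) * p + (b - 1) * q"
      by (simp add: a_def b_def field_simps)
    also have "exp ((a - 1) * p + (b - 1) * q) = ?B t"
      using t by (simp add: powr_def p_def q_def exp_add)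
    finally show ?thesis .
  qed
  have intB: "set_integrable lborel {0<..<1} ?B"
    by (rule set_integrable_subset[OF integrable_Beta[OF ab(1,2)]]) auto
  have int: "set_integrable lborel (einterval 0 1) (\<lambda>t. ?f (?g t) * ?g' t)"
  proof -
    have "set_integrable lborel {0<..<1} (\<lambda>t. ?B t / pi)" using intB by simp
    then have "set_integrable lborel {0<..<1} (\<lambda>t. ?f (?g t) * ?g' t)"
      by (subst set_integrable_cong[OF refl refl]) (simp_all only: fg greaterThanLessThan_iff)
    then show ?thesis by (simp add: zero_ereal_def one_ereal_def)
  qed
  have at0: "filterlim ?g at_bot (at_right 0)" by (real_asymp)
  have at1: "filterlim ?g at_top (at_left 1)" by (real_asymp)
  have lim0: "((ereal \<circ> ?g \<circ> real_of_ereal) \<longlongrightarrow> - \<infinity>) (at_right 0)"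
    using at0 unfolding zero_ereal_def ereal_tendsto_simps .
  have lim1: "((ereal \<circ> ?g \<circ> real_of_ereal) \<longlongrightarrow> \<infinity>) (at_left 1)"
    using at1 unfolding one_ereal_def ereal_tendsto_simps .
  have sub: "set_integrable lborel (einterval (- \<infinity>) \<infinity>) ?f"
    "(LBINT x=-\<infinity>..\<infinity>. ?f x) = (LBINT x=0..1. ?f (?g x) * ?g' x)"
  proof -
    have deriv: "DERIV ?g t :> ?g' t" if "0 < ereal t" "ereal t < 1" for t
    proof -
      have t: "0 < t" "t < 1" using that by auto
      show ?thesis
        using t by (auto intro!: derivative_eq_intros simp: divide_simps)
    qed
    have contf: "isCont ?f (?g t)" for t
      unfolding sech_density_def cosh_def by (intro continuous_intros) (auto simp: add_pos_pos less_imp_neq[symmetric])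
    have contg: "isCont ?g' t" if "0 < ereal t" "ereal t < 1" for t
      using that by (intro continuous_intros) auto
    have nn: "0 \<le> ?f (?g t)" for t by (simp add: less_imp_le[OF sech_density_pos])
    have nn': "0 \<le> ?g' t" if "0 \<le> ereal t" "ereal t \<le> 1" for t using that by simp
    note sub = interval_integral_substitution_nonneg[OF _ deriv contf contg nn nn' lim0 lim1 int]
    show "set_integrable lborel (einterval (- \<infinity>) \<infinity>) ?f"
      by (rule sub(1)) simp_all
    show "(LBINT x=-\<infinity>..\<infinity>. ?f x) = (LBINT x=0..1. ?f (?g x) * ?g' x)"
      by (rule sub(2)) simp_all
  qed
  have "(LBINT x=0..1. ?f (?g x) * ?g' x) = (LBINT x:{0<..<1}. ?f (?g x) * ?g' x)"
    by (simp add: interval_lebesgue_integral_def zero_ereal_def one_ereal_def)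
  also have "\<dots> = (LBINT x:{0<..<1}. ?B x / pi)"
    by (rule set_lebesgue_integral_cong) (simp, intro allI impI, rule fg, auto)
  also have "\<dots> = (LBINT x:{0<..<1}. ?B x) / pi" by simp
  also have "(LBINT x:{0<..<1}. ?B x) = integral {0<..<1} ?B"
    by (rule set_borel_integral_eq_integral[OF intB])
  also have "\<dots> = Beta a b"
    using has_integral_Beta_real[OF ab(1,2)] by (simp add: has_integral_Icc_iff_Ioo integral_unique)
  also have "Beta a b / pi = 1 / cos l"
  proof -
    have "complex_of_real (Gamma a * Gamma b) = Gamma (of_real a) * Gamma (1 - of_real a)"
    proof -
      have "b = 1 - a" using ab(3) by simp
      then have "1 - complex_of_real a = of_real b" by (simp only: of_real_diff of_real_1)
      then show ?thesis by (simp add: Gamma_complex_of_real)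
    qed
    also have "\<dots> = of_real (pi / sin (pi * a))"
      by (simp add: Gamma_reflection_complex sin_of_real flip: of_real_mult of_real_divide)
    finally have "Gamma a * Gamma b = pi / sin (pi * a)" by (simp only: of_real_eq_iff)
    moreover have "sin (pi * a) = cos l"
      by (simp add: a_def distrib_left sin_add)
    ultimately show ?thesis
      using ab(3) by (simp add: Beta_def)
  qed
  finally have "(LBINT x=-\<infinity>..\<infinity>. ?f x) = 1 / cos l" using sub(2) by simp
  then show ?thesis
    using sub(1) by (simp add: has_bochner_integral_iff interval_lebesgue_integral_def set_integrable_def
      set_lebesgue_integral_def)
qed

lemma sets_sech [simp, measurable_cong]: "sets sech_distribution = sets borel"
  by (simp add: sech_distribution_def)

lemma space_sech [simp]: "space sech_distribution = UNIV"
  by (simp add: sech_distribution_def)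

lemma sech_mgf:
  assumes "\<bar>l\<bar> < pi / 2"
  shows "has_bochner_integral sech_distribution (\<lambda>x. exp (l * x)) (1 / cos l)"
  unfolding sech_distribution_density
  by (rule has_bochner_integral_density)
    (use sech_mgf_lborel[OF assms] sech_density_pos in \<open>auto simp: mult.commute intro: less_imp_le\<close>)

lemma prob_space_sech: "prob_space sech_distribution"
proof
  have "has_bochner_integral lborel sech_density 1"
    using sech_mgf_lborel[of 0] by simp
  then have "(\<integral>\<^sup>+x. ennreal (sech_density x) \<partial>lborel) = 1"
    using nn_integral_eq_integral[of lborel sech_density] less_imp_le[OF sech_density_pos]
    by (simp add: has_bochner_integral_iff)
  then show "emeasure sech_distribution (space sech_distribution) = 1"
    by (simp add: sech_distribution_density emeasure_density)
qed

interpretation sech: product_prob_space "\<lambda>_::nat. sech_distribution" UNIV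
  by (rule product_prob_spaceI) (rule prob_space_sech)


lemma sech_space_measurable: "(\<lambda>\<zeta>. \<zeta> n) \<in> borel_measurable sech_space"
  unfolding sech_space_def
  using measurable_component_singleton[of n UNIV "\<lambda>_. sech_distribution"]
  by (simp cong: measurable_cong_sets)

lemma sech_walk_measurable [measurable]: "sech_walk t \<in> borel_measurable sech_space"
  unfolding sech_walk_def[abs_def] by (intro borel_measurable_sum sech_space_measurable)

interpretation sech_space: prob_space sech_space
  unfolding sech_space_def by (rule sech.prob_space_axioms)

lemma sech_walk_mgf:
  assumes l: "\<bar>l\<bar> < pi / 2"
  shows "has_bochner_integral sech_space (\<lambda>\<zeta>. exp (l * sech_walk t \<zeta>)) (1 / cos l ^ t)"
proof -
  let ?J = "{1..t}" and ?F = "\<lambda>x. \<Prod>n\<in>{1..t}. exp (l * x n)"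
  let ?P = "PiM ?J (\<lambda>_. sech_distribution)"
  have 1: "integrable sech_distribution (\<lambda>x. exp (l * x))"
    "(\<integral>x. exp (l * x) \<partial>sech_distribution) = 1 / cos l"
    using sech_mgf[OF l] by (auto simp: has_bochner_integral_iff)
  have int: "integrable ?P ?F"
    by (rule sech.product_integrable_prod) (simp_all add: 1)
  have eq: "(\<integral>x. ?F x \<partial>?P) = 1 / cos l ^ t"
    by (subst sech.product_integral_prod) (simp_all add: 1 power_one_over)
  have distr: "?P = distr sech_space ?P (\<lambda>x. restrict x ?J)"
    unfolding sech_space_def by (rule sech.distr_PiM_restrict_finite[symmetric]) auto
  have r: "(\<lambda>x. restrict x ?J) \<in> measurable sech_space ?P"
    unfolding sech_space_def by (rule measurable_restrict_subset) simp
  have "(\<lambda>x. x n) \<in> borel_measurable ?P" if "n \<in> ?J" for n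
    using measurable_component_singleton[OF that, of "\<lambda>_. sech_distribution"]
    by (simp cong: measurable_cong_sets)
  then have F: "?F \<in> borel_measurable ?P"
    by (intro borel_measurable_prod borel_measurable_exp borel_measurable_times) auto
  have Fr: "?F (restrict \<zeta> ?J) = exp (l * sech_walk t \<zeta>)" for \<zeta>
    by (simp add: sech_walk_def sum_distrib_left exp_sum)
  have "integrable (distr sech_space ?P (\<lambda>x. restrict x ?J)) ?F"
    using int distr by simp
  then have "integrable sech_space (\<lambda>\<zeta>. exp (l * sech_walk t \<zeta>))"
    unfolding integrable_distr_eq[OF r F] Fr .
  moreover have "(\<integral>x. ?F x \<partial>distr sech_space ?P (\<lambda>x. restrict x ?J)) = 1 / cos l ^ t"
    using eq distr by simp
  then have "(\<integral>\<zeta>. exp (l * sech_walk t \<zeta>) \<partial>sech_space) = 1 / cos l ^ t"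
    unfolding integral_distr[OF r F] Fr .
  ultimately show ?thesis by (simp add: has_bochner_integral_iff)
qed

text \<open>For the plane wave of frequency \<open>l\<close>, the imaginary shift produces the real
  exponential with rate \<open>- l\<close>, whose mean is the moment generating function. The
  martingale property of all powers and the integral formula both rest on this identity.\<close>

lemma sech_walk_exp_martingale:
  assumes l: "\<bar>l\<bar> < pi / 2"
  shows "has_bochner_integral sech_space (\<lambda>\<zeta>. exp (\<i> * of_real l * (z + \<i> * of_real (sech_walk t \<zeta>))))
    (exp (\<i> * of_real l * z) / of_real (cos l ^ t))"
proof -
  have "has_bochner_integral sech_space (\<lambda>\<zeta>. of_real (exp (- l * sech_walk t \<zeta>)) :: complex)
      (of_real (1 / cos l ^ t))"
    using sech_walk_mgf[of "- l" t] l by (intro has_bochner_integral_of_real) simp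
  then have "has_bochner_integral sech_space (\<lambda>\<zeta>. exp (\<i> * of_real l * z) * of_real (exp (- l * sech_walk t \<zeta>)) :: complex)
      (exp (\<i> * of_real l * z) * of_real (1 / cos l ^ t))"
    by (rule has_bochner_integral_mult_right)
  moreover have "exp (\<i> * of_real l * z) * of_real (exp (- l * s)) =
      exp (\<i> * of_real l * (z + \<i> * of_real s))" for s
    by (simp add: exp_of_real[symmetric] exp_add[symmetric] algebra_simps)
  ultimately show ?thesis by simp
qed

lemma integrable_exp_abs_sech_walk:
  assumes c: "0 \<le> c" "c < pi / 2"
  shows "integrable sech_space (\<lambda>\<zeta>. exp (c * \<bar>sech_walk t \<zeta>\<bar>))"
proof (rule Bochner_Integration.integrable_bound)
  show "integrable sech_space (\<lambda>\<zeta>. exp (c * sech_walk t \<zeta>) + exp (- c * sech_walk t \<zeta>))"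
    using sech_walk_mgf[of c t] sech_walk_mgf[of "- c" t] c
    by (intro Bochner_Integration.integrable_add) (auto simp: has_bochner_integral_iff)
  show "AE \<zeta> in sech_space. norm (exp (c * \<bar>sech_walk t \<zeta>\<bar>)) \<le>
      norm (exp (c * sech_walk t \<zeta>) + exp (- c * sech_walk t \<zeta>))"
  proof (intro AE_I2)
    fix \<zeta>
    have "exp (c * \<bar>s\<bar>) \<le> exp (c * s) + exp (- c * s)" for s :: real by (cases "s < 0") auto
    from this[of "sech_walk t \<zeta>"]
    show "norm (exp (c * \<bar>sech_walk t \<zeta>\<bar>)) \<le> norm (exp (c * sech_walk t \<zeta>) + exp (- c * sech_walk t \<zeta>))"
      by simp
  qed
qed measurable

section \<open>Moments and polynomial martingales of the secant walk\<close>

lemma power_le_fact_exp: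
  fixes r c :: real
  assumes "0 \<le> r" "0 < c"
  shows "r ^ k \<le> fact k / c ^ k * exp (c * r)"
proof -
  have "(c * r) ^ k / fact k \<le> exp (c * r)"
    using sum_le_suminf[OF summable_exp_generic[of "c * r"], of "{k}"] assms
    by (simp add: exp_def scaleR_conv_of_real field_simps)
  then show ?thesis using assms by (simp add: power_mult_distrib field_simps)
qed

definition sech_moment :: "nat \<Rightarrow> nat \<Rightarrow> complex \<Rightarrow> complex" where
  "sech_moment k t z = (\<integral>\<zeta>. (z + \<i> * of_real (sech_walk t \<zeta>)) ^ k \<partial>sech_space)"

lemma integrable_sech_power:
  "integrable sech_space (\<lambda>\<zeta>. (z + \<i> * of_real (sech_walk t \<zeta>)) ^ k)"
proof (rule Bochner_Integration.integrable_bound)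
  show "integrable sech_space (\<lambda>\<zeta>. fact k * exp (norm z) * exp (1 * \<bar>sech_walk t \<zeta>\<bar>))"
    using pi_gt3 by (intro integrable_mult_right integrable_exp_abs_sech_walk) auto
  show "AE \<zeta> in sech_space. norm ((z + \<i> * of_real (sech_walk t \<zeta>)) ^ k) \<le>
      norm (fact k * exp (norm z) * exp (1 * \<bar>sech_walk t \<zeta>\<bar>))"
  proof (intro AE_I2)
    fix \<zeta>
    let ?r = "norm (z + \<i> * of_real (sech_walk t \<zeta>))"
    have "?r ^ k \<le> fact k * exp ?r" using power_le_fact_exp[of ?r 1 k] by simp
    also have "?r \<le> norm z + \<bar>sech_walk t \<zeta>\<bar>"
      using norm_triangle_ineq[of z "\<i> * of_real (sech_walk t \<zeta>)"] by (simp add: norm_mult)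
    finally show "norm ((z + \<i> * of_real (sech_walk t \<zeta>)) ^ k) \<le>
      norm (fact k * exp (norm z) * exp (1 * \<bar>sech_walk t \<zeta>\<bar>))"
      by (simp add: norm_power exp_add abs_mult mult.assoc)
  qed
qed measurable

lemma exp_mult_sums:
  fixes a w :: "'a :: {banach, real_normed_field}"
  shows "(\<lambda>k. a ^ k / fact k * w ^ k) sums exp (a * w)"
  using exp_converges[of "a * w"]
  by (simp add: power_mult_distrib scaleR_conv_of_real divide_inverse mult_ac)

text \<open>Termwise integration of the exponential series. For \<open>\<bar>l\<bar> < 1\<close> it
  is dominated by a multiple of exp |S| with S the walk, which is integrable since 1 < pi / 2, and a
  neighbourhood of 0 is enough to identify coefficients.\<close>

lemma sech_moment_sums:
  assumes l: "\<bar>l\<bar> < 1"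
  shows "(\<lambda>k. \<i> ^ k / fact k * sech_moment k t z * of_real l ^ k) sums
    (exp (\<i> * of_real l * z) / of_real (cos l ^ t))"
proof -
  let ?w = "\<lambda>\<zeta>. z + \<i> * of_real (sech_walk t \<zeta>)"
  let ?f = "\<lambda>k \<zeta>. (\<i> * of_real l) ^ k / fact k * ?w \<zeta> ^ k"
  have fexp: "(\<lambda>k. ?f k \<zeta>) sums exp (\<i> * of_real l * ?w \<zeta>)" for \<zeta>
    by (rule exp_mult_sums)
  have nfexp: "(\<lambda>k. norm (?f k \<zeta>)) sums exp (\<bar>l\<bar> * norm (?w \<zeta>))" for \<zeta>
    using exp_mult_sums[of "\<bar>l\<bar>" "norm (?w \<zeta>)"]
    by (simp add: norm_mult norm_divide norm_power)
  have int: "integrable sech_space (?f k)" for k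
    by (intro integrable_mult_right integrable_sech_power)
  have intexp: "integrable sech_space (\<lambda>\<zeta>. exp (\<bar>l\<bar> * norm (?w \<zeta>)))"
  proof (rule Bochner_Integration.integrable_bound)
    show "integrable sech_space (\<lambda>\<zeta>. exp (norm z) * exp (1 * \<bar>sech_walk t \<zeta>\<bar>))"
      using pi_gt3 by (intro integrable_mult_right integrable_exp_abs_sech_walk) auto
    show "AE \<zeta> in sech_space. norm (exp (\<bar>l\<bar> * norm (?w \<zeta>))) \<le> norm (exp (norm z) * exp (1 * \<bar>sech_walk t \<zeta>\<bar>))"
    proof (intro AE_I2)
      fix \<zeta>
      have "\<bar>l\<bar> * norm (?w \<zeta>) \<le> 1 * norm (?w \<zeta>)"
        using l by (intro mult_right_mono) auto
      also have "\<dots> \<le> norm z + \<bar>sech_walk t \<zeta>\<bar>"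
        using norm_triangle_ineq[of z "\<i> * of_real (sech_walk t \<zeta>)"] by (simp add: norm_mult)
      finally show "norm (exp (\<bar>l\<bar> * norm (?w \<zeta>))) \<le> norm (exp (norm z) * exp (1 * \<bar>sech_walk t \<zeta>\<bar>))"
        by (simp flip: exp_add)
    qed
  qed measurable
  have "(\<lambda>k. integral\<^sup>L sech_space (?f k)) sums (\<integral>\<zeta>. (\<Sum>k. ?f k \<zeta>) \<partial>sech_space)"
  proof (rule sums_integral[OF int])
    show "AE \<zeta> in sech_space. summable (\<lambda>k. norm (?f k \<zeta>))"
      using nfexp by (auto simp: sums_iff)
    show "summable (\<lambda>k. \<integral>\<zeta>. norm (?f k \<zeta>) \<partial>sech_space)"
    proof (rule summableI_nonneg_bounded)
      fix n
      have "(\<Sum>k<n. \<integral>\<zeta>. norm (?f k \<zeta>) \<partial>sech_space) = (\<integral>\<zeta>. (\<Sum>k<n. norm (?f k \<zeta>)) \<partial>sech_space)"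
        by (rule Bochner_Integration.integral_sum[symmetric]) (intro integrable_norm int)
      also have "\<dots> \<le> (\<integral>\<zeta>. exp (\<bar>l\<bar> * norm (?w \<zeta>)) \<partial>sech_space)"
      proof (rule integral_mono)
        show "(\<Sum>k<n. norm (?f k \<zeta>)) \<le> exp (\<bar>l\<bar> * norm (?w \<zeta>))" for \<zeta>
          using nfexp[of \<zeta>] by (subst sums_unique) (auto intro: sum_le_suminf simp: sums_iff)
      qed (intro intexp Bochner_Integration.integrable_sum integrable_norm int)+
      finally show "(\<Sum>k<n. \<integral>\<zeta>. norm (?f k \<zeta>) \<partial>sech_space) \<le> (\<integral>\<zeta>. exp (\<bar>l\<bar> * norm (?w \<zeta>)) \<partial>sech_space)" .
    qed simp
  qed
  also have "(\<lambda>k. integral\<^sup>L sech_space (?f k)) = (\<lambda>k. \<i> ^ k / fact k * sech_moment k t z * of_real l ^ k)"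
    by (simp add: sech_moment_def power_mult_distrib mult_ac)
  also have "(\<integral>\<zeta>. (\<Sum>k. ?f k \<zeta>) \<partial>sech_space) = exp (\<i> * of_real l * z) / of_real (cos l ^ t)"
    using sech_walk_exp_martingale[of l z t] l pi_gt3 sums_unique[OF fexp]
    by (simp add: has_bochner_integral_iff)
  finally show ?thesis .
qed

text \<open>Strip off the coefficients already known to vanish, divide by \<open>x ^ n\<close>, and
  let \<open>x\<close> tend to 0.\<close>

lemma power_series_eq_0:
  fixes d :: "nat \<Rightarrow> real"
  assumes "\<And>x. \<bar>x\<bar> < 1 \<Longrightarrow> (\<lambda>n. d n * x ^ n) sums 0"
  shows "d n = 0"
proof (induction n rule: less_induct)
  case (less n)
  have "((\<lambda>_. 0) \<longlongrightarrow> (\<lambda>k. d (k + n)) 0) (at (0 :: real))"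
  proof (rule powser_limit_0_strong[of 1 "\<lambda>k. d (k + n)" "\<lambda>_. 0"])
    fix x :: real assume x: "x \<noteq> 0" "norm x < 1"
    have "(\<lambda>k. d (k + n) * x ^ (k + n)) sums (0 - (\<Sum>k<n. d k * x ^ k))"
      using assms[of x] x by (intro sums_split_initial_segment) auto
    then have "(\<lambda>k. d (k + n) * x ^ (k + n) / x ^ n) sums (0 / x ^ n)"
      using less by (intro sums_divide) simp
    then show "(\<lambda>k. d (k + n) * x ^ k) sums 0" using x by (simp add: power_add)
  qed simp
  then show ?case using LIM_unique[OF tendsto_const[of "0::real"]] by simp
qed

text \<open>The generating functions of both sides agree because \<open>e\<^sup>i\<^sup>l\<^sup>z cos l\<close> averages
  \<open>e\<^sup>i\<^sup>l\<^sup>z\<close> over the two neighbours of \<open>z\<close>.\<close>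

lemma sech_moment_martingale:
  "sech_moment k t z = (sech_moment k (Suc t) (z + 1) + sech_moment k (Suc t) (z - 1)) / 2"
proof -
  define d where "d k = \<i> ^ k / fact k *
    ((sech_moment k (Suc t) (z + 1) + sech_moment k (Suc t) (z - 1)) / 2 - sech_moment k t z)" for k
  have d: "(\<lambda>k. d k * of_real l ^ k) sums 0" if l: "\<bar>l\<bar> < 1" for l
  proof -
    let ?E = "exp (\<i> * of_real l * z) :: complex" and ?C = "of_real (cos l ^ Suc t) :: complex"
    let ?c = "\<lambda>k. \<i> ^ k / fact k" and ?m = "\<lambda>k. sech_moment k (Suc t)"
    have c: "cos l > 0" using l pi_gt3 by (intro cos_gt_zero_pi) auto
    have "(\<lambda>k. (?c k * ?m k (z + 1) * of_real l ^ k +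
        ?c k * ?m k (z - 1) * of_real l ^ k) / 2 -
        ?c k * sech_moment k t z * of_real l ^ k) sums
      ((exp (\<i> * of_real l * (z + 1)) / ?C + exp (\<i> * of_real l * (z - 1)) / ?C) / 2
        - ?E / of_real (cos l ^ t))"
      by (intro sums_diff sums_divide sums_add sech_moment_sums l)
    also have "exp (\<i> * of_real l * (z + 1)) / ?C + exp (\<i> * of_real l * (z - 1)) / ?C =
        ?E * (exp (\<i> * of_real l) + exp (- (\<i> * of_real l))) / ?C"
    proof -
      have "exp (\<i> * of_real l * (z + 1)) = ?E * exp (\<i> * of_real l)"
        "exp (\<i> * of_real l * (z - 1)) = ?E * exp (- (\<i> * of_real l))"
        by (simp_all add: exp_add[symmetric] algebra_simps)
      then show ?thesis by (simp only: distrib_left add_divide_distrib)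
    qed
    also have "exp (\<i> * of_real l) + exp (- (\<i> * of_real l)) = 2 * complex_of_real (cos l)"
      by (simp add: cos_of_real[symmetric] cos_exp_eq)
    also have "?E * (2 * of_real (cos l)) / ?C / 2 -
        ?E / of_real (cos l ^ t) = (0 :: complex)"
      using c by simp
    also have "(\<lambda>k. (?c k * ?m k (z + 1) * of_real l ^ k +
        ?c k * ?m k (z - 1) * of_real l ^ k) / 2 -
        ?c k * sech_moment k t z * of_real l ^ k) = (\<lambda>k. d k * of_real l ^ k)"
    proof
      fix k
      have "(c * p * L + c * q * L) / 2 - c * r * L = c * ((p + q) / 2 - r) * L" for c p q r L :: complex
        by (simp add: algebra_simps add_divide_distrib)
      then show "(?c k * ?m k (z + 1) * of_real l ^ k +
        ?c k * ?m k (z - 1) * of_real l ^ k) / 2 -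
        ?c k * sech_moment k t z * of_real l ^ k = d k * of_real l ^ k"
        unfolding d_def .
    qed
    finally show ?thesis .
  qed
  \<comment> \<open>\<open>power_series_eq_0\<close> concerns real coefficients, so the real and the
    imaginary part of \<open>d\<close> are treated separately.\<close>
  have "Re (d k) = 0"
    by (rule power_series_eq_0[of "\<lambda>k. Re (d k)"]) (use sums_Re[OF d] in \<open>simp flip: of_real_power\<close>)
  moreover have "Im (d k) = 0"
    by (rule power_series_eq_0[of "\<lambda>k. Im (d k)"]) (use sums_Im[OF d] in \<open>simp flip: of_real_power\<close>)
  ultimately have "d k = 0" by (simp add: complex_eq_iff)
  then show ?thesis by (simp add: d_def)
qed

definition sech_mean :: "complex poly \<Rightarrow> nat \<Rightarrow> complex \<Rightarrow> complex" where
  "sech_mean q t z = (\<integral>\<zeta>. poly q (z + \<i> * of_real (sech_walk t \<zeta>)) \<partial>sech_space)"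

lemma sech_mean_eq: "sech_mean q t z = (\<Sum>k\<le>degree q. coeff q k * sech_moment k t z)"
  unfolding sech_mean_def poly_altdef
  by (subst Bochner_Integration.integral_sum)
    (auto intro: integrable_sech_power simp: sech_moment_def)

lemma sech_mean_martingale:
  "sech_mean q t z = (sech_mean q (Suc t) (z + 1) + sech_mean q (Suc t) (z - 1)) / 2"
  unfolding sech_mean_eq
  by (subst sech_moment_martingale)
    (simp only: sum.distrib[symmetric] sum_divide_distrib distrib_left times_divide_eq_right)

lemma sech_mean_0: "sech_mean q 0 z = poly q z"
  by (simp add: sech_mean_def sech_walk_def sech_space.prob_space)

lemma sech_moment_poly: "\<exists>q. degree q \<le> k \<and> (\<forall>z. sech_moment k t z = poly q z)"
proof -
  let ?q = "\<Sum>j\<le>k. monom (of_nat (k choose j) * sech_moment (k - j) t 0) j"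
  have "degree ?q \<le> k"
    by (intro degree_sum_le) (auto intro: order.trans[OF degree_monom_le])
  moreover have "sech_moment k t z = poly ?q z" for z
  proof -
    have "sech_moment k t z =
      (\<integral>\<zeta>. (\<Sum>j\<le>k. of_nat (k choose j) * z ^ j * (0 + \<i> * of_real (sech_walk t \<zeta>)) ^ (k - j)) \<partial>sech_space)"
      by (simp add: sech_moment_def binomial_ring)
    also have "\<dots> = (\<Sum>j\<le>k. of_nat (k choose j) * z ^ j * sech_moment (k - j) t 0)"
      unfolding sech_moment_def
      by (subst Bochner_Integration.integral_sum) (intro integrable_mult_right integrable_sech_power, simp)
    finally show ?thesis by (simp add: poly_sum poly_monom mult_ac)
  qed
  ultimately show ?thesis by blast
qed

text \<open>Averaging does not raise the degree, by the binomial expansion of each moment. This is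
  what provides the degree bound required of the functions in \<open>finite_walk\<close>.\<close>

lemma sech_mean_poly: "\<exists>q'. degree q' \<le> degree q \<and> (\<forall>z. sech_mean q t z = poly q' z)"
proof -
  obtain p where p: "\<And>k. degree (p k) \<le> k \<and> (\<forall>z. sech_moment k t z = poly (p k) z)"
    using sech_moment_poly[of _ t] by metis
  have "degree (\<Sum>k\<le>degree q. Polynomial.smult (coeff q k) (p k)) \<le> degree q"
    by (intro degree_sum_le) (auto intro: order.trans[OF degree_smult_le] order.trans[OF conjunct1[OF p]])
  then show ?thesis
    using p by (intro exI[of _ "\<Sum>k\<le>degree q. Polynomial.smult (coeff q k) (p k)"]) (simp add: sech_mean_eq poly_sum)
qed

section \<open>Finite windows and the cardinal sine\<close>

text \<open>If \<open>k\<close> lies in the window, this is the Lagrange basis polynomial of the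
  node \<open>2 * a * k\<close> among the nodes \<open>2 * a * j\<close> with
  \<open>\<bar>j\<bar> \<le> n\<close>.\<close>

definition window_poly :: "int \<Rightarrow> int \<Rightarrow> nat \<Rightarrow> complex poly" where
  "window_poly a k n = (\<Prod>j\<in>{- int n..int n} - {k}.
     Polynomial.smult (1 / (of_int (2 * a * k) - of_int (2 * a * j))) [:- of_int (2 * a * j), 1:])"

lemma poly_window:
  "poly (window_poly a k n) z = (\<Prod>j\<in>{- int n..int n} - {k}.
     (z - of_int (2 * a * j)) / (of_int (2 * a * k) - of_int (2 * a * j)))"
  by (simp add: window_poly_def poly_prod diff_divide_distrib)

lemma Phi_partial_eq_window:
  assumes a: "a > 0" and L: "L \<ge> 0"
  shows "Phi_partial a k L z = poly (window_poly a k (nat \<lfloor>L / of_int (2 * a)\<rfloor>)) z"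
proof -
  have "real_of_int \<bar>2 * a * j\<bar> \<le> L \<longleftrightarrow> \<bar>j\<bar> \<le> \<lfloor>L / of_int (2 * a)\<rfloor>" for j
  proof -
    have "real_of_int \<bar>2 * a * j\<bar> \<le> L \<longleftrightarrow> real_of_int \<bar>j\<bar> * of_int (2 * a) \<le> L"
      using a by (simp add: abs_mult mult.commute)
    also have "\<dots> \<longleftrightarrow> real_of_int \<bar>j\<bar> \<le> L / of_int (2 * a)"
      using a by (subst pos_le_divide_eq) auto
    finally show ?thesis by (simp only: le_floor_iff)
  qed
  moreover define N where "N = nat \<lfloor>L / of_int (2 * a)\<rfloor>"
  have "\<lfloor>L / of_int (2 * a)\<rfloor> = int N" using a L by (simp add: N_def)
  ultimately have "{j. j \<noteq> k \<and> real_of_int \<bar>2 * a * j\<bar> \<le> L} = {j. j \<noteq> k \<and> \<bar>j\<bar> \<le> int N}"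
    by simp
  also have "\<dots> = {- int N..int N} - {k}" by auto
  finally have "{j. j \<noteq> k \<and> real_of_int \<bar>2 * a * j\<bar> \<le> L} =
      {- int (nat \<lfloor>L / of_int (2 * a)\<rfloor>)..int (nat \<lfloor>L / of_int (2 * a)\<rfloor>)} - {k}"
    by (simp only: N_def)
  then show ?thesis by (simp only: Phi_partial_def poly_window)
qed

text \<open>Apart from \<open>2|k|\<close> boundary factors, the factors of a window pair up symmetrically about \<open>k\<close>.\<close>

lemma poly_window_pairs:
  assumes a: "a > 0" and k: "nat \<bar>k\<bar> \<le> n"
  defines "m \<equiv> nat \<bar>k\<bar>" and "\<sigma> \<equiv> (if k < 0 then - 1 else 1 :: int)"
  shows "poly (window_poly a k n) z =
    (\<Prod>l=1..n - m. 1 - (z / of_int (2 * a) - of_int k) ^ 2 / of_nat l ^ 2) *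
    (\<Prod>l=n - m + 1..n + m. 1 + of_int \<sigma> * (z / of_int (2 * a) - of_int k) / of_nat l)"
proof -
  define w where "w = z / of_int (2 * a) - of_int k"
  define f where "f l = 1 + of_int \<sigma> * w / of_int l" for l
  have ks: "k = \<sigma> * int m" "\<sigma> * \<sigma> = 1" by (auto simp: m_def \<sigma>_def)
  have s: "\<sigma> = 1 \<or> \<sigma> = -1" by (auto simp: \<sigma>_def)
  have mn: "m \<le> n" using k by (simp add: m_def)
  \<comment> \<open>The index \<open>l = \<sigma> * (k - j)\<close> runs from \<open>m - n\<close>
    to \<open>m + n\<close> without 0. The reflection by \<open>\<sigma>\<close> places the surplus
    over the symmetric range on the positive side for either sign of \<open>k\<close>.\<close>
  have "poly (window_poly a k n) z = (\<Prod>l\<in>{- int (n - m)..int (n + m)} - {0}. f l)"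
    unfolding poly_window
  proof (rule prod.reindex_bij_witness[of _ "\<lambda>l. k - \<sigma> * l" "\<lambda>j. \<sigma> * (k - j)"])
    fix j assume j: "j \<in> {- int n..int n} - {k}"
    show "k - \<sigma> * (\<sigma> * (k - j)) = j" using ks(2) by (simp flip: mult.assoc)
    show "\<sigma> * (k - j) \<in> {- int (n - m)..int (n + m)} - {0}"
      using j s ks(1) mn by (auto simp: of_nat_diff)
    have "(z - of_int (2 * a * j)) / (of_int (2 * a * k) - of_int (2 * a * j)) =
        (w + of_int (k - j)) / of_int (k - j)"
      using a j by (simp add: w_def field_simps)
    also have "\<dots> = 1 + w / of_int (k - j)" using j by (simp add: add_divide_distrib)
    also have "\<dots> = f (\<sigma> * (k - j))" using s by (auto simp: f_def)
    finally show "f (\<sigma> * (k - j)) = (z - of_int (2 * a * j)) / (of_int (2 * a * k) - of_int (2 * a * j))" ..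
  next
    fix l assume l: "l \<in> {- int (n - m)..int (n + m)} - {0}"
    show "\<sigma> * (k - (k - \<sigma> * l)) = l" using ks(2) by (simp flip: mult.assoc)
    show "k - \<sigma> * l \<in> {- int n..int n} - {k}"
      using l s ks(1) mn by (auto simp: of_nat_diff)
  qed
  also have "{- int (n - m)..int (n + m)} - {0} =
      uminus ` int ` {1..n - m} \<union> (int ` {1..n - m} \<union> int ` {n - m + 1..n + m})"
    by (auto simp: image_iff image_int_atLeastAtMost)
  also have "prod f \<dots> = (\<Prod>l=1..n - m. f (- int l)) * ((\<Prod>l=1..n - m. f (int l)) * (\<Prod>l=n - m + 1..n + m. f (int l)))"
    by (subst prod.union_disjoint, simp, simp, force, subst prod.union_disjoint)
      (auto simp: prod.reindex inj_on_def)
  also have "\<dots> = (\<Prod>l=1..n - m. 1 - w ^ 2 / of_nat l ^ 2) * (\<Prod>l=n - m + 1..n + m. f (int l))"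
  proof -
    have "f (- int l) * f (int l) = 1 - w ^ 2 / of_nat l ^ 2" if "l \<in> {1..n - m}" for l
      using that s by (auto simp: f_def field_simps power2_eq_square)
    then show ?thesis
      by (simp add: prod.distrib[symmetric] mult.assoc[symmetric])
  qed
  finally show ?thesis by (simp add: f_def w_def)
qed

definition csinc :: "complex \<Rightarrow> complex" where
  "csinc w = (if w = 0 then 1 else sin (of_real pi * w) / (of_real pi * w))"

lemma sinc_product: "(\<lambda>n. \<Prod>l=1..n. 1 - w ^ 2 / of_nat l ^ 2) \<longlonglongrightarrow> csinc w"
proof (cases "w = 0")
  case False
  have "(\<lambda>n. of_real pi * w * (\<Prod>l=1..n. 1 - w ^ 2 / of_nat l ^ 2) / (of_real pi * w)) \<longlonglongrightarrow>
      sin (of_real pi * w) / (of_real pi * w)"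
    using False by (intro tendsto_divide sin_product_formula_complex tendsto_const) auto
  then show ?thesis using False by (simp add: csinc_def)
qed (simp add: csinc_def)

text \<open>At \<open>n + m\<close> with \<open>m = nat \<bar>k\<bar>\<close> the window consists of
  \<open>n\<close> symmetric pairs, which form Euler's product for the sine, and of
  \<open>2 * m\<close> boundary factors whose denominators exceed \<open>n\<close>, so that each
  tends to 1.\<close>

lemma poly_window_tendsto:
  assumes a: "a > 0"
  shows "(\<lambda>n. poly (window_poly a k n) z) \<longlonglongrightarrow> csinc (z / of_int (2 * a) - of_int k)"
proof -
  define m where "m = nat \<bar>k\<bar>"
  let ?w = "z / of_int (2 * a) - of_int k"
  let ?\<sigma> = "if k < 0 then - 1 else 1 :: int"
  have "(\<lambda>n. (\<Prod>l=1..n. 1 - ?w ^ 2 / of_nat l ^ 2) *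
      (\<Prod>r\<in>{..<2 * m}. 1 + of_int ?\<sigma> * ?w / of_nat (n + 1 + r))) \<longlonglongrightarrow>
      csinc ?w * (\<Prod>r\<in>{..<2 * m}. 1 + 0)"
  proof (intro tendsto_mult sinc_product tendsto_prod tendsto_add tendsto_const)
    fix r
    have "(\<lambda>n. of_int ?\<sigma> * ?w / of_nat (n + (1 + r))) \<longlonglongrightarrow> 0"
      by (rule LIMSEQ_ignore_initial_segment) (rule lim_const_over_n)
    then show "(\<lambda>n. of_int ?\<sigma> * ?w / of_nat (n + 1 + r)) \<longlonglongrightarrow> 0" by (simp add: add.assoc)
  qed
  also have "(\<lambda>n. (\<Prod>l=1..n. 1 - ?w ^ 2 / of_nat l ^ 2) *
      (\<Prod>r\<in>{..<2 * m}. 1 + of_int ?\<sigma> * ?w / of_nat (n + 1 + r))) = (\<lambda>n. poly (window_poly a k (n + m)) z)"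
  proof
    fix n
    have e: "n + m - nat \<bar>k\<bar> = n" "n + m + nat \<bar>k\<bar> = n + 2 * m" "nat \<bar>k\<bar> \<le> n + m"
      by (auto simp: m_def)
    have "(\<Prod>l=n + 1..n + 2 * m. 1 + of_int ?\<sigma> * ?w / of_nat l) =
        (\<Prod>r\<in>{..<2 * m}. 1 + of_int ?\<sigma> * ?w / of_nat (n + 1 + r))"
      by (rule prod.reindex_bij_witness[of _ "\<lambda>r. n + 1 + r" "\<lambda>l. l - (n + 1)"]) auto
    then show "(\<Prod>l=1..n. 1 - ?w ^ 2 / of_nat l ^ 2) *
      (\<Prod>r\<in>{..<2 * m}. 1 + of_int ?\<sigma> * ?w / of_nat (n + 1 + r)) = poly (window_poly a k (n + m)) z"
      using poly_window_pairs[OF a e(3), of z] unfolding e by (simp only:)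
  qed
  finally have "(\<lambda>n. poly (window_poly a k (n + m)) z) \<longlonglongrightarrow> csinc ?w" by simp
  then show ?thesis by (rule LIMSEQ_offset)
qed

lemma Phi_partial_tendsto:
  assumes a: "a > 0"
  shows "((\<lambda>L. Phi_partial a k L z) \<longlongrightarrow> csinc (z / of_int (2 * a) - of_int k)) at_top"
proof -
  have "filterlim (\<lambda>L::real. nat \<lfloor>L / of_int (2 * a)\<rfloor>) sequentially at_top"
  proof (rule filterlim_compose[OF filterlim_nat_sequentially])
    show "filterlim (\<lambda>L::real. \<lfloor>L / of_int (2 * a)\<rfloor>) at_top at_top"
    proof (rule filterlim_compose[OF filterlim_floor_sequentially])
      show "filterlim (\<lambda>L::real. L / of_int (2 * a)) at_top at_top"
        using filterlim_at_top_mult_tendsto_pos[OF tendsto_const[of "1 / of_int (2 * a)"] _ filterlim_ident] a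
        by simp
    qed
  qed
  then have "((\<lambda>L::real. poly (window_poly a k (nat \<lfloor>L / of_int (2 * a)\<rfloor>)) z) \<longlongrightarrow>
      csinc (z / of_int (2 * a) - of_int k)) at_top"
    by (rule filterlim_compose[OF poly_window_tendsto[OF a]])
  moreover have "eventually (\<lambda>L. poly (window_poly a k (nat \<lfloor>L / of_int (2 * a)\<rfloor>)) z = Phi_partial a k L z) at_top"
    using eventually_ge_at_top[of 0] by eventually_elim (simp add: Phi_partial_eq_window a)
  ultimately show ?thesis by (rule Lim_transform_eventually)
qed

lemma Phi_eq_sinc:
  assumes a: "a > 0"
  shows "Phi a k z = csinc (z / of_int (2 * a) - of_int k)"
  unfolding Phi_def by (rule tendsto_Lim[OF _ Phi_partial_tendsto[OF a]]) simp

text \<open>Replacing \<open>w\<close> by \<open>\<i>\<close> times its modulus R makes all factors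
  positive and at least as large. Their partial products increase to sinh (pi R) / (pi R), and sinh
  x is at most x exp x.\<close>

lemma norm_sinc_product_le:
  "norm (\<Prod>l=1..n. 1 - w ^ 2 / of_nat l ^ 2 :: complex) \<le> exp (pi * norm w)"
proof (cases "w = 0")
  case False
  define R where "R = norm w"
  have R: "R > 0" using False by (simp add: R_def)
  let ?P = "\<lambda>n. \<Prod>l=1..n. 1 + R ^ 2 / real l ^ 2"
  have "norm (\<Prod>l=1..n. 1 - w ^ 2 / of_nat l ^ 2) \<le> ?P n"
    unfolding prod_norm[symmetric]
  proof (intro prod_mono conjI norm_ge_zero)
    fix l
    show "norm (1 - w ^ 2 / of_nat l ^ 2) \<le> 1 + R ^ 2 / real l ^ 2"
      by (rule order.trans[OF norm_triangle_ineq4]) (simp add: R_def norm_divide norm_power)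
  qed
  also have "?P n \<le> norm (csinc (\<i> * of_real R))"
  proof (rule incseq_le)
    show "incseq ?P" by (rule incseq_SucI) (simp add: prod_nonneg algebra_simps)
    have "(\<lambda>n. norm (\<Prod>l=1..n. 1 - (\<i> * of_real R) ^ 2 / of_nat l ^ 2)) \<longlonglongrightarrow> norm (csinc (\<i> * of_real R))"
      by (intro tendsto_norm sinc_product)
    moreover have "(\<Prod>l=1..n. 1 - (\<i> * of_real R) ^ 2 / of_nat l ^ 2) = of_real (?P n)" for n
      by (simp add: power_mult_distrib)
    ultimately show "?P \<longlonglongrightarrow> norm (csinc (\<i> * of_real R))"
      by (simp add: prod_nonneg del: of_real_prod)
  qed
  also have "norm (csinc (\<i> * of_real R)) = norm (sin (\<i> * of_real (pi * R))) / (pi * R)"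
    using R by (simp add: csinc_def norm_divide norm_mult mult_ac)
  also have "\<dots> \<le> exp (pi * R)"
  proof -
    define x where "x = pi * R"
    have x: "x > 0" using R by (simp add: x_def)
    have "sin (\<i> * of_real x) = \<i> * of_real ((exp x - exp (- x)) / 2)"
      by (simp add: sin_i_times exp_minus exp_of_real)
    then have "norm (sin (\<i> * of_real x)) = \<bar>(exp x - exp (- x)) / 2\<bar>"
      by (simp only: norm_mult norm_ii norm_of_real mult_1)
    also have "\<dots> = (exp x - exp (- x)) / 2" using x by simp
    also have "exp x - exp (- x) = exp x * (1 - exp (- (2 * x)))"
      by (simp add: algebra_simps flip: exp_add)
    also have "\<dots> / 2 \<le> exp x * (2 * x) / 2"
      using exp_ge_add_one_self[of "- (2 * x)"] by (intro divide_right_mono mult_left_mono) auto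
    finally have "norm (sin (\<i> * of_real x)) \<le> exp x * x" by simp
    then show ?thesis unfolding x_def[symmetric] using x by (simp add: pos_divide_le_eq)
  qed
  finally show ?thesis by (simp add: R_def)
qed simp

text \<open>The paired factors contribute exp (pi |w|), and \<open>\<bar>s\<bar>\<close> enters |w|
  divided by \<open>2 * a\<close>, at least 4. The \<open>2 * m\<close> boundary factors contribute
  a power of 1 + |w|, which \<open>power_le_fact_exp\<close> trades for one more exponential and the
  factorial in \<open>C\<close>. The bound is uniform in \<open>n\<close>, as dominated convergence
  requires.\<close>

lemma window_growth:
  assumes a: "a \<ge> 2"
  obtains C where "\<And>n s. nat \<bar>k\<bar> \<le> n \<Longrightarrow>
    norm (poly (window_poly a k n) (of_int y + \<i> * of_real s)) \<le> C * exp ((pi + 1) / 4 * \<bar>s\<bar>)"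
proof -
  define m where "m = nat \<bar>k\<bar>"
  define b where "b = norm (of_int y / of_int (2 * a) - of_int k :: complex)"
  define C where "C = fact (2 * m) * exp ((pi + 1) * b + 1)"
  have "norm (poly (window_poly a k n) (of_int y + \<i> * of_real s)) \<le> C * exp ((pi + 1) / 4 * \<bar>s\<bar>)"
    if n: "nat \<bar>k\<bar> \<le> n" for n s
  proof -
    let ?p = "poly (window_poly a k n) (of_int y + \<i> * of_real s)"
    define w where "w = (of_int y + \<i> * of_real s) / of_int (2 * a) - of_int k"
    let ?\<sigma> = "if k < 0 then - 1 else 1 :: int"
    have "w = (of_int y / of_int (2 * a) - of_int k) + \<i> * of_real (s / of_int (2 * a))"
      by (simp add: w_def add_divide_distrib)
    then have "norm w \<le> b + norm (\<i> * complex_of_real (s / of_int (2 * a)))"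
      unfolding b_def by (metis norm_triangle_ineq)
    also have "norm (\<i> * complex_of_real (s / of_int (2 * a))) = \<bar>s\<bar> / of_int (2 * a)"
      using a by (simp add: norm_mult norm_divide)
    also have "\<dots> \<le> \<bar>s\<bar> / 4"
      using a by (intro divide_left_mono) auto
    finally have w: "norm w \<le> b + \<bar>s\<bar> / 4" by simp
    have "?p =
      (\<Prod>l=1..n - m. 1 - w ^ 2 / of_nat l ^ 2) * (\<Prod>l=n - m + 1..n + m. 1 + of_int ?\<sigma> * w / of_nat l)"
      using a by (subst poly_window_pairs[OF _ n]) (simp_all add: w_def m_def)
    then have "norm ?p =
      norm (\<Prod>l=1..n - m. 1 - w ^ 2 / of_nat l ^ 2) * (\<Prod>l=n - m + 1..n + m. norm (1 + of_int ?\<sigma> * w / of_nat l))"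
      by (simp add: norm_mult prod_norm)
    also have "\<dots> \<le> exp (pi * norm w) * (\<Prod>l=n - m + 1..n + m. 1 + norm w)"
    proof (intro mult_mono norm_sinc_product_le prod_mono conjI norm_ge_zero prod_nonneg)
      fix l assume l: "l \<in> {n - m + 1..n + m}"
      have "norm (1 + of_int ?\<sigma> * w / of_nat l) \<le> 1 + norm w / real l"
        by (rule order.trans[OF norm_triangle_ineq]) (simp add: norm_mult norm_divide)
      also have "norm w / real l \<le> norm w / 1" using l by (intro divide_left_mono) auto
      finally show "norm (1 + of_int ?\<sigma> * w / of_nat l) \<le> 1 + norm w" by simp
    qed auto
    also have "(\<Prod>l=n - m + 1..n + m. 1 + norm w) = (1 + norm w) ^ (2 * m)"
      using n by (simp add: m_def mult_2)
    also have "exp (pi * norm w) * (1 + norm w) ^ (2 * m) \<le>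
        exp (pi * norm w) * (fact (2 * m) / 1 ^ (2 * m) * exp (1 * (1 + norm w)))"
      by (intro mult_left_mono power_le_fact_exp) auto
    also have "\<dots> = fact (2 * m) * exp ((pi + 1) * norm w + 1)"
      by (simp add: exp_add[symmetric] algebra_simps)
    also have "\<dots> \<le> fact (2 * m) * exp ((pi + 1) * (b + \<bar>s\<bar> / 4) + 1)"
      using w by (intro mult_left_mono) (simp_all add: add_nonneg_pos)
    also have "\<dots> = C * exp ((pi + 1) / 4 * \<bar>s\<bar>)"
      by (simp add: C_def exp_add[symmetric] algebra_simps)
    finally show ?thesis .
  qed
  then show ?thesis by (rule that)
qed

lemma window_exponent: "0 \<le> (pi + 1) / 4" "(pi + 1) / 4 < pi / 2"
  using pi_gt3 by auto

lemma Phi_dominated: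
  assumes a: "a \<ge> 2"
  shows "integrable sech_space (\<lambda>\<zeta>. Phi a k (of_int y + \<i> * of_real (sech_walk t \<zeta>)))"
    and "(\<lambda>n. sech_mean (window_poly a k n) t (of_int y)) \<longlonglongrightarrow> mart_fun a k t y"
proof -
  obtain C where C: "\<And>n s. nat \<bar>k\<bar> \<le> n \<Longrightarrow>
      norm (poly (window_poly a k n) (of_int y + \<i> * of_real s)) \<le> C * exp ((pi + 1) / 4 * \<bar>s\<bar>)"
    using window_growth[OF a] by metis
  let ?z = "\<lambda>\<zeta>. of_int y + \<i> * of_real (sech_walk t \<zeta>) :: complex"
  \<comment> \<open>The shift by \<open>nat \<bar>k\<bar>\<close> puts \<open>k\<close> inside every
    window, where the bound with \<open>C\<close> is available.\<close>
  let ?p = "\<lambda>n \<zeta>. poly (window_poly a k (n + nat \<bar>k\<bar>)) (?z \<zeta>)"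
  let ?W = "\<lambda>\<zeta>. C * exp ((pi + 1) / 4 * \<bar>sech_walk t \<zeta>\<bar>)"
  have a0: "a > 0" using a by simp
  have lim: "(\<lambda>n. ?p n \<zeta>) \<longlonglongrightarrow> Phi a k (?z \<zeta>)" for \<zeta>
    unfolding Phi_eq_sinc[OF a0] by (rule LIMSEQ_ignore_initial_segment[OF poly_window_tendsto[OF a0]])
  have meas: "?p n \<in> borel_measurable sech_space" for n
    unfolding poly_altdef by measurable
  have W: "integrable sech_space ?W"
    by (intro integrable_mult_right integrable_exp_abs_sech_walk window_exponent)
  have Phi_meas: "(\<lambda>\<zeta>. Phi a k (?z \<zeta>)) \<in> borel_measurable sech_space"
    by (rule borel_measurable_LIMSEQ_metric[OF meas lim])
  have bound: "AE \<zeta> in sech_space. norm (?p n \<zeta>) \<le> ?W \<zeta>" for n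
    by (intro AE_I2 C) simp
  have lim: "AE \<zeta> in sech_space. (\<lambda>n. ?p n \<zeta>) \<longlonglongrightarrow> Phi a k (?z \<zeta>)"
    by (intro AE_I2 lim)
  show "integrable sech_space (\<lambda>\<zeta>. Phi a k (?z \<zeta>))"
    by (rule integrable_dominated_convergence[OF Phi_meas meas W lim bound])
  have "(\<lambda>n. \<integral>\<zeta>. ?p n \<zeta> \<partial>sech_space) \<longlonglongrightarrow> (\<integral>\<zeta>. Phi a k (?z \<zeta>) \<partial>sech_space)"
    by (rule integral_dominated_convergence[OF Phi_meas meas W lim bound])
  then have "(\<lambda>n. sech_mean (window_poly a k (n + nat \<bar>k\<bar>)) t (of_int y)) \<longlonglongrightarrow> mart_fun a k t y"
    by (simp add: sech_mean_def mart_fun_def)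
  then show "(\<lambda>n. sech_mean (window_poly a k n) t (of_int y)) \<longlonglongrightarrow> mart_fun a k t y"
    by (rule LIMSEQ_offset)
qed

section \<open>Passage to infinitely many walkers\<close>

lemma degree_window_poly:
  assumes "nat \<bar>k\<bar> \<le> n"
  shows "degree (window_poly a k n) < 2 * n + 1"
proof -
  have "degree (window_poly a k n) \<le> (\<Sum>j\<in>{- int n..int n} - {k}. 1)"
    unfolding window_poly_def
  proof (rule order.trans[OF degree_prod_sum_le sum_mono])
    fix j
    show "(degree \<circ> (\<lambda>j. Polynomial.smult (1 / (of_int (2 * a * k) - of_int (2 * a * j)))
        [:- of_int (2 * a * j), 1 :: complex:])) j \<le> 1"
      by (simp add: order.trans[OF degree_smult_le])
  qed simp
  also have "\<dots> = 2 * n"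
  proof -
    have "k \<in> {- int n..int n}" using assms by auto
    then show ?thesis by (simp add: card_Diff_singleton nat_add_distrib)
  qed
  finally show ?thesis by simp
qed

lemma window_dual:
  assumes a: "a > 0" and j: "j \<in> {- int n..int n}"
  shows "poly (window_poly a k n) (of_int (2 * a * j)) = of_bool (j = k)"
proof (cases "j = k")
  case True
  then show ?thesis unfolding poly_window using a by (auto intro!: prod.neutral)
next
  case False
  then have "\<exists>i\<in>{- int n..int n} - {k}. (of_int (2 * a * j) - of_int (2 * a * i)) /
      (of_int (2 * a * k) - of_int (2 * a * i) :: complex) = 0"
    using j by (intro bexI[of _ j]) auto
  then have "poly (window_poly a k n) (of_int (2 * a * j)) = 0"
    unfolding poly_window by (intro prod_zero) auto
  then show ?thesis using False by simp
qed

text \<open>The walkers are numbered from 0 to \<open>2 * n\<close>; subtracting \<open>n\<close>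
  turns this into the numbering of the nodes from \<open>- n\<close> to \<open>n\<close>.\<close>

definition window_walk :: "int \<Rightarrow> nat \<Rightarrow> nat \<Rightarrow> nat \<Rightarrow> int \<Rightarrow> complex" where
  "window_walk a n i t x = sech_mean (window_poly a (int i - int n) n) t (of_int x)"

lemma finite_walk_window:
  assumes a: "a > 0"
  shows "finite_walk (2 * n + 1) (\<lambda>i. 2 * a * (int i - int n)) (window_walk a n)"
proof
  fix i j :: nat and t :: nat and x :: int
  show "2 * a * (int i - int n) < 2 * a * (int j - int n)" if "i < j"
    using a that by simp
  show "even (2 * a * (int i - int n))" by simp
  show "window_walk a n i t x = (window_walk a n i (Suc t) (x + 1) + window_walk a n i (Suc t) (x - 1)) / 2"
    using sech_mean_martingale[of "window_poly a (int i - int n) n" t "of_int x"]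
    by (simp add: window_walk_def)
  assume i: "i < 2 * n + 1"
  then have "degree (window_poly a (int i - int n) n) < 2 * n + 1"
    by (intro degree_window_poly) auto
  then show "\<exists>q. degree q < 2 * n + 1 \<and> (\<forall>x. window_walk a n i t x = poly q (of_int x))"
    using sech_mean_poly[of "window_poly a (int i - int n) n" t] unfolding window_walk_def
    by (meson order.strict_trans1)
  assume j: "j < 2 * n + 1"
  have "window_walk a n i 0 (2 * a * (int j - int n)) = of_bool (int j - int n = int i - int n)"
    unfolding window_walk_def sech_mean_0 using j by (intro window_dual a) auto
  then show "window_walk a n i 0 (2 * a * (int j - int n)) = of_bool (i = j)" by simp
qed

text \<open>A walker moves by one site per step, so only starts within distance \<open>s\<close> of
  \<open>x\<close> contribute, and \<open>\<bar>j\<bar>\<close> is at most the modulus of its start.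
  The series in the kernel is therefore a finite sum.\<close>

lemma rw_prob_finite_support:
  assumes a: "a > 0" and that: "j \<notin> {- (\<bar>x\<bar> + int s)..\<bar>x\<bar> + int s}"
  shows "rw_prob s x (2 * a * j) = 0"
proof -
  have "\<bar>j\<bar> \<le> \<bar>2 * a * j\<bar>" using a by (simp add: abs_mult mult_le_cancel_right1)
  then have "\<bar>x - 2 * a * j\<bar> > int s" using that by auto
  then show ?thesis by (simp add: rw_prob_def)
qed

lemma summable_kernel:
  assumes "a > 0"
  shows "(\<lambda>j. of_real (rw_prob s x (2 * a * j)) * mart_fun a j t y) summable_on UNIV"
proof -
  have "(\<lambda>j. of_real (rw_prob s x (2 * a * j)) * mart_fun a j t y) summable_on {- (\<bar>x\<bar> + int s)..\<bar>x\<bar> + int s}"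
    by (rule summable_on_finite) simp
  then show ?thesis
    by (rule summable_on_cong_neutral[THEN iffD1, rotated -1]) (use rw_prob_finite_support[OF assms] in auto)
qed

definition st_kernel :: "int \<Rightarrow> nat \<times> int \<Rightarrow> nat \<times> int \<Rightarrow> complex" where
  "st_kernel a p q = corr_kernel a (fst p) (snd p) (fst q) (snd q)"

definition st_even :: "nat \<times> int \<Rightarrow> bool" where
  "st_even p \<longleftrightarrow> even (int (fst p) + snd p)"

text \<open>Once the window contains every index in \<open>B\<close>, the sum runs over the fixed
  finite set \<open>B\<close>, and only the martingale functions still depend on \<open>n\<close>.
  The points are taken even because \<open>corr_kernel\<close> is 0 elsewhere by definition, whereas
  \<open>walk_kernel\<close> need not vanish there.\<close>

lemma walk_kernel_tendsto:
  assumes a: "a \<ge> 2" and pq: "st_even p" "st_even q"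
  shows "(\<lambda>n. finite_walk.walk_kernel (2 * n + 1) (\<lambda>i. 2 * a * (int i - int n)) (window_walk a n) p q)
    \<longlonglongrightarrow> st_kernel a p q"
proof -
  obtain s x t y where p: "p = (s, x)" and q: "q = (t, y)" by (cases p, cases q)
  define B where "B = {- (\<bar>x\<bar> + int s)..\<bar>x\<bar> + int s}"
  define c :: complex where "c = (if s > t then of_real (rw_prob (s - t) x y) else 0)"
  have supp: "rw_prob s x (2 * a * j) = 0" if "j \<notin> B" for j
    using a that unfolding B_def by (intro rw_prob_finite_support) auto
  have K: "finite_walk.walk_kernel (2 * n + 1) (\<lambda>i. 2 * a * (int i - int n)) (window_walk a n) p q =
      (\<Sum>j\<in>B. of_real (rw_prob s x (2 * a * j)) * sech_mean (window_poly a j n) t (of_int y)) - c"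
    if n: "n \<ge> nat (\<bar>x\<bar> + int s)" for n
  proof -
    interpret finite_walk "2 * n + 1" "\<lambda>i. 2 * a * (int i - int n)" "window_walk a n"
      using a by (intro finite_walk_window) auto
    have "(\<Sum>i<2 * n + 1. of_real (rw_prob s x (2 * a * (int i - int n))) * window_walk a n i t y) =
      (\<Sum>j\<in>{- int n..int n}. of_real (rw_prob s x (2 * a * j)) * sech_mean (window_poly a j n) t (of_int y))"
      by (rule sum.reindex_bij_witness[of _ "\<lambda>j. nat (j + int n)" "\<lambda>i. int i - int n"])
        (auto simp: window_walk_def)
    also have "\<dots> = (\<Sum>j\<in>B. of_real (rw_prob s x (2 * a * j)) * sech_mean (window_poly a j n) t (of_int y))"
      by (rule sum.mono_neutral_right) (use n supp in \<open>auto simp: B_def\<close>)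
    finally show ?thesis
      unfolding walk_kernel_def p q c_def fst_conv snd_conv by (simp only:)
  qed
  have "(\<lambda>n. (\<Sum>j\<in>B. of_real (rw_prob s x (2 * a * j)) * sech_mean (window_poly a j n) t (of_int y)) - c)
    \<longlonglongrightarrow> (\<Sum>j\<in>B. of_real (rw_prob s x (2 * a * j)) * mart_fun a j t y) - c"
    by (intro tendsto_intros Phi_dominated(2) a)
  moreover have "(\<Sum>j\<in>B. of_real (rw_prob s x (2 * a * j)) * mart_fun a j t y) =
      (\<Sum>\<^sub>\<infinity>j. of_real (rw_prob s x (2 * a * j)) * mart_fun a j t y)"
  proof -
    have "(\<Sum>\<^sub>\<infinity>j. of_real (rw_prob s x (2 * a * j)) * mart_fun a j t y) =
        (\<Sum>\<^sub>\<infinity>j\<in>B. of_real (rw_prob s x (2 * a * j)) * mart_fun a j t y)"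
      by (rule infsum_cong_neutral) (use supp in auto)
    then show ?thesis by (simp add: B_def)
  qed
  moreover have "st_kernel a p q = (\<Sum>\<^sub>\<infinity>j. of_real (rw_prob s x (2 * a * j)) * mart_fun a j t y) - c"
    using pq by (simp add: st_kernel_def corr_kernel_def p q st_even_def c_def)
  ultimately have "(\<lambda>n. (\<Sum>j\<in>B. of_real (rw_prob s x (2 * a * j)) * sech_mean (window_poly a j n) t (of_int y)) - c)
    \<longlonglongrightarrow> st_kernel a p q" by simp
  then show ?thesis
    by (rule Lim_transform_eventually) (use eventually_ge_at_top[of "nat (\<bar>x\<bar> + int s)"] in eventually_elim, simp only: K)
qed

lemma set_det_row_zero:
  assumes "finite S" "p \<in> S" "\<And>q. q \<in> S \<Longrightarrow> A p q = 0"
  shows "set_det S A = 0"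
  unfolding set_det_def
proof (rule sum.neutral, safe)
  fix \<sigma> assume "\<sigma> permutes S"
  then have "A p (\<sigma> p) = 0" using assms by (simp add: permutes_in_image)
  then have "(\<Prod>i\<in>S. A i (\<sigma> i)) = 0" using assms by (intro prod_zero) auto
  then show "of_int (sign \<sigma>) * (\<Prod>i\<in>S. A i (\<sigma> i)) = 0" by simp
qed

lemma st_kernel_expansion_nonneg:
  assumes a: "a \<ge> 2" and F: "finite F" "\<And>p. p \<in> F \<Longrightarrow> fst p \<ge> 1" and y: "\<And>p. y p \<ge> 0"
  shows "(\<Sum>S\<in>Pow F. of_real (\<Prod>p\<in>S. y p - 1) * set_det S (st_kernel a)) \<in> \<real>\<^sub>\<ge>\<^sub>0"
proof -
  let ?E = "{p \<in> F. st_even p}"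
  \<comment> \<open>A point of odd parity gives a zero row, so subsets containing one drop out. On
    the even points every entry is a limit of entries for finite windows.\<close>
  have "(\<Sum>S\<in>Pow F. of_real (\<Prod>p\<in>S. y p - 1) * set_det S (st_kernel a)) =
      (\<Sum>S\<in>Pow ?E. of_real (\<Prod>p\<in>S. y p - 1) * set_det S (st_kernel a))"
  proof (rule sum.mono_neutral_right)
    show "\<forall>S\<in>Pow F - Pow ?E. of_real (\<Prod>p\<in>S. y p - 1) * set_det S (st_kernel a) = 0"
    proof
      fix S assume S: "S \<in> Pow F - Pow ?E"
      then obtain p where "p \<in> S" "\<not> st_even p" by auto
      then have "set_det S (st_kernel a) = 0"
        using S F(1) finite_subset
        by (intro set_det_row_zero[of _ p]) (auto simp: st_kernel_def corr_kernel_def st_even_def)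
      then show "of_real (\<Prod>p\<in>S. y p - 1) * set_det S (st_kernel a) = 0" by simp
    qed
  qed (use F in auto)
  moreover have "(\<Sum>S\<in>Pow ?E. of_real (\<Prod>p\<in>S. y p - 1) * set_det S (st_kernel a)) \<in> \<real>\<^sub>\<ge>\<^sub>0"
  proof (rule closed_sequentially[OF closed_nonneg_Reals_complex])
    let ?K = "\<lambda>n. finite_walk.walk_kernel (2 * n + 1) (\<lambda>i. 2 * a * (int i - int n)) (window_walk a n)"
    show "(\<Sum>S\<in>Pow ?E. of_real (\<Prod>p\<in>S. y p - 1) * set_det S (?K n)) \<in> \<real>\<^sub>\<ge>\<^sub>0" for n
    proof -
      interpret finite_walk "2 * n + 1" "\<lambda>i. 2 * a * (int i - int n)" "window_walk a n"
        using a by (intro finite_walk_window) auto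
      show ?thesis by (rule walk_kernel_expansion_nonneg) (use F y in auto)
    qed
    show "(\<lambda>n. \<Sum>S\<in>Pow ?E. of_real (\<Prod>p\<in>S. y p - 1) * set_det S (?K n)) \<longlonglongrightarrow>
        (\<Sum>S\<in>Pow ?E. of_real (\<Prod>p\<in>S. y p - 1) * set_det S (st_kernel a))"
      unfolding set_det_def
    proof (intro tendsto_sum tendsto_mult tendsto_const tendsto_prod)
      fix S \<sigma> p assume "S \<in> Pow ?E" "\<sigma> \<in> {\<sigma>. \<sigma> permutes S}" "p \<in> S"
      moreover from this have "\<sigma> p \<in> S" by (simp add: permutes_in_image)
      ultimately have "st_even p" "st_even (\<sigma> p)" by auto
      then show "(\<lambda>n. ?K n p (\<sigma> p)) \<longlonglongrightarrow> st_kernel a p (\<sigma> p)"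
        by (rule walk_kernel_tendsto[OF a])
    qed
  qed
  ultimately show ?thesis by simp
qed

section \<open>The integral formula\<close>

lemma csinc_integral:
  "csinc w = 1 / (2 * of_real pi) * integral {-pi..pi} (\<lambda>l. exp (\<i> * of_real l * w))"
proof (cases "w = 0")
  case False
  have "((\<lambda>l. exp (\<i> * of_real l * w)) has_integral
      (exp (\<i> * of_real pi * w) / (\<i> * w) - exp (\<i> * of_real (- pi) * w) / (\<i> * w))) {-pi..pi}"
  proof (rule fundamental_theorem_of_calculus)
    fix l :: real
    have "((\<lambda>z. exp (\<i> * z * w) / (\<i> * w)) has_field_derivative exp (\<i> * of_real l * w)) (at (of_real l))"
      using False by (auto intro!: derivative_eq_intros)
    then show "((\<lambda>l. exp (\<i> * of_real l * w) / (\<i> * w)) has_vector_derivative exp (\<i> * of_real l * w)) (at l within {-pi..pi})"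
      by (rule has_vector_derivative_real_field)
  qed simp
  then have eq: "integral {-pi..pi} (\<lambda>l. exp (\<i> * of_real l * w)) =
      (exp (\<i> * (of_real pi * w)) - exp (- (\<i> * (of_real pi * w)))) / (\<i> * w)"
    by (simp add: integral_unique diff_divide_distrib mult.assoc)
  show ?thesis unfolding eq using False by (simp add: csinc_def sin_exp_eq field_simps)
qed (simp add: csinc_def scaleR_conv_of_real)

text \<open>The Fourier integral of \<open>csinc\<close> is inserted under the mean and the
  integrals are exchanged. The inner mean is \<open>sech_walk_exp_martingale\<close> at frequency
  \<open>l / of_int (2 * a)\<close>, of modulus at most pi / 4, so the cosine in the denominator
  stays positive.\<close>

lemma mart_fun_integral:
  assumes a: "a \<ge> 2"
  shows "mart_fun a k t y = 1 / (2 * of_real pi) *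
    integral {-pi..pi} (\<lambda>l. exp (\<i> * of_real (l * (of_int y / of_int (2 * a) - of_int k)))
                              / of_real (cos (l / of_int (2 * a)) ^ t))"
proof -
  define w where "w \<zeta> = (of_int y + \<i> * of_real (sech_walk t \<zeta>)) / of_int (2 * a) - of_int k" for \<zeta> :: "nat \<Rightarrow> real"
  define f where "f \<zeta> l = indicator {-pi..pi} l *\<^sub>R exp (\<i> * of_real l * w \<zeta>)" for \<zeta> and l :: real
  define K where "K \<zeta> = exp ((pi + 1) / 4 * \<bar>sech_walk t \<zeta>\<bar>)" for \<zeta>
  let ?I = "\<lambda>l. exp (\<i> * of_real (l * (of_int y / of_int (2 * a) - of_int k))) / of_real (cos (l / of_int (2 * a)) ^ t) :: complex"
  interpret S: prob_space sech_space
    unfolding sech_space_def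
    by (intro prob_space_PiM prob_space_sech)
  interpret P: pair_sigma_finite sech_space lborel ..
  have [measurable]: "w \<in> borel_measurable sech_space"
    unfolding w_def[abs_def] by measurable
  have meas[measurable]: "case_prod f \<in> borel_measurable (sech_space \<Otimes>\<^sub>M lborel)"
    unfolding f_def by measurable
  have bound: "norm (f \<zeta> l) \<le> indicator {-pi..pi} l * K \<zeta>" for \<zeta> l
  proof (cases "l \<in> {-pi..pi}")
    case True
    have "norm (exp (\<i> * of_real l * w \<zeta>)) = exp (- l * (sech_walk t \<zeta> / of_int (2 * a)))"
    proof -
      have "w \<zeta> = of_real (of_int y / of_int (2 * a) - of_int k) + \<i> * of_real (sech_walk t \<zeta> / of_int (2 * a))"
        by (simp add: w_def add_divide_distrib)
      then show ?thesis by (simp add: norm_exp_eq_Re)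
    qed
    also have "\<dots> \<le> K \<zeta>"
      unfolding K_def exp_le_cancel_iff
    proof -
      have "- l * (sech_walk t \<zeta> / of_int (2 * a)) \<le> \<bar>l\<bar> * (\<bar>sech_walk t \<zeta>\<bar> / of_int (2 * a))"
        by (rule order.trans[OF abs_ge_self]) (use a in \<open>simp add: abs_mult\<close>)
      \<comment> \<open>The factor \<open>\<bar>l\<bar>\<close> is at most pi; rounding up to
        \<open>pi + 1\<close> lets the exponent of the window bound serve as majorant here as
        well.\<close>
      also have "\<dots> \<le> (pi + 1) * (\<bar>sech_walk t \<zeta>\<bar> / 4)"
        using True a by (intro mult_mono divide_left_mono) auto
      finally show "- l * (sech_walk t \<zeta> / of_int (2 * a)) \<le> (pi + 1) / 4 * \<bar>sech_walk t \<zeta>\<bar>" by simp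
    qed
    finally show ?thesis using True by (simp add: f_def)
  qed (simp add: f_def)
  have intl: "integrable lborel (\<lambda>l. indicator {-pi..pi} l * K \<zeta> :: real)" for \<zeta>
    by (intro integrable_mult_left) (auto intro!: integrable_real_indicator)
  have intf: "integrable lborel (f \<zeta>)" for \<zeta>
  proof (rule Bochner_Integration.integrable_bound[OF intl])
    show "f \<zeta> \<in> borel_measurable lborel" unfolding f_def[abs_def] by measurable
    show "AE l in lborel. norm (f \<zeta> l) \<le> norm (indicator {-pi..pi} l * K \<zeta>)"
      by (intro AE_I2 order.trans[OF bound]) simp
  qed
  have int: "integrable (sech_space \<Otimes>\<^sub>M lborel) (case_prod f)"
  proof (rule P.Fubini_integrable[OF meas])
    show "AE \<zeta> in sech_space. integrable lborel (\<lambda>l. case_prod f (\<zeta>, l))" using intf by simp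
    show "integrable sech_space (\<lambda>\<zeta>. \<integral>l. norm (case_prod f (\<zeta>, l)) \<partial>lborel)"
    proof (rule Bochner_Integration.integrable_bound)
      show "integrable sech_space (\<lambda>\<zeta>. 2 * pi * K \<zeta>)"
        unfolding K_def by (intro integrable_mult_right integrable_exp_abs_sech_walk window_exponent)
      show "AE \<zeta> in sech_space. norm (\<integral>l. norm (case_prod f (\<zeta>, l)) \<partial>lborel) \<le> norm (2 * pi * K \<zeta>)"
      proof (intro AE_I2)
        fix \<zeta>
        have "(\<integral>l. norm (f \<zeta> l) \<partial>lborel) \<le> (\<integral>l. indicator {-pi..pi} l * K \<zeta> \<partial>lborel)"
          by (intro integral_mono integrable_norm intf intl bound)
        also have "\<dots> = 2 * pi * K \<zeta>" by simp
        finally show "norm (\<integral>l. norm (case_prod f (\<zeta>, l)) \<partial>lborel) \<le> norm (2 * pi * K \<zeta>)"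
          by (simp add: K_def)
      qed
    qed measurable
  qed
  have inner: "(\<integral>l. f \<zeta> l \<partial>lborel) = integral {-pi..pi} (\<lambda>l. exp (\<i> * of_real l * w \<zeta>))" for \<zeta>
  proof -
    have "set_integrable lborel {-pi..pi} (\<lambda>l. exp (\<i> * of_real l * w \<zeta>))"
      by (intro borel_integrable_atLeastAtMost' continuous_intros)
    then show ?thesis
      using set_borel_integral_eq_integral(2) by (simp add: set_lebesgue_integral_def f_def)
  qed
  have outer: "(\<integral>\<zeta>. f \<zeta> l \<partial>sech_space) = indicator {-pi..pi} l *\<^sub>R ?I l" for l
  proof (cases "l \<in> {-pi..pi}")
    case True
    define m where "m = l / of_int (2 * a)"
    have "\<bar>m\<bar> = \<bar>l\<bar> / of_int (2 * a)" using a by (simp add: m_def)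
    also have "\<dots> \<le> pi / 4" using True a by (intro frac_le) auto
    finally have m: "\<bar>m\<bar> < pi / 2" using pi_gt_zero by linarith
    have e: "exp (\<i> * of_real l * w \<zeta>) =
        exp (- (\<i> * of_real (l * of_int k))) * exp (\<i> * of_real m * (of_int y + \<i> * of_real (sech_walk t \<zeta>)))" for \<zeta>
      using a by (simp add: w_def m_def exp_add[symmetric] field_simps)
    have "(\<integral>\<zeta>. f \<zeta> l \<partial>sech_space) = exp (- (\<i> * of_real (l * of_int k))) *
        (exp (\<i> * of_real m * of_int y) / of_real (cos m ^ t))"
      using True sech_walk_exp_martingale[OF m, of "of_int y" t]
      by (simp add: f_def e has_bochner_integral_iff)
    also have "\<dots> = ?I l"
      by (simp add: m_def exp_add[symmetric] algebra_simps)
    finally show ?thesis using True by simp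
  qed (simp add: f_def)
  have cont: "continuous_on {-pi..pi} ?I"
  proof -
    have "cos (l / of_int (2 * a)) > 0" if "l \<in> {-pi..pi}" for l
    proof -
      have "\<bar>l / of_int (2 * a)\<bar> = \<bar>l\<bar> / of_int (2 * a)" using a by simp
      also have "\<dots> \<le> pi / 4" using that a by (intro frac_le) auto
      finally show ?thesis using pi_gt_zero by (intro cos_gt_zero_pi) linarith+
    qed
    then show ?thesis
      using a by (intro continuous_intros) force+
  qed
  have "mart_fun a k t y = (\<integral>\<zeta>. csinc (w \<zeta>) \<partial>sech_space)"
    using a by (simp add: mart_fun_def Phi_eq_sinc w_def)
  also have "\<dots> = (\<integral>\<zeta>. 1 / (2 * of_real pi) * (\<integral>l. f \<zeta> l \<partial>lborel) \<partial>sech_space)"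
    by (simp add: inner csinc_integral)
  also have "\<dots> = 1 / (2 * of_real pi) * (\<integral>\<zeta>. (\<integral>l. f \<zeta> l \<partial>lborel) \<partial>sech_space)"
    by (rule integral_mult_right_zero)
  also have "(\<integral>\<zeta>. (\<integral>l. f \<zeta> l \<partial>lborel) \<partial>sech_space) = (\<integral>l. (\<integral>\<zeta>. f \<zeta> l \<partial>sech_space) \<partial>lborel)"
    by (rule P.Fubini_integral[OF int, symmetric])
  also have "\<dots> = (LINT l:{-pi..pi}|lborel. ?I l)"
    by (simp add: outer set_lebesgue_integral_def)
  also have "\<dots> = integral {-pi..pi} ?I"
    by (rule set_borel_integral_eq_integral(2)) (intro borel_integrable_atLeastAtMost' cont)
  finally show ?thesis .
qed

section \<open>Configurations and Fredholm expansions\<close>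

definition occ :: "nat \<times> int \<Rightarrow> (nat \<Rightarrow> int measure) \<Rightarrow> real" where
  "occ p \<Xi> = of_bool (emeasure (\<Xi> (fst p)) {snd p} = 1)"

abbreviation occ_mean :: "(nat \<Rightarrow> int measure) measure \<Rightarrow> (nat \<times> int) set \<Rightarrow> real" where
  "occ_mean P S \<equiv> (\<integral>\<Xi>. (\<Prod>p\<in>S. occ p \<Xi>) \<partial>P)"

lemma occ_01: "occ p \<Xi> = 0 \<or> occ p \<Xi> = 1" and occ_nonneg: "0 \<le> occ p \<Xi>" and occ_le_1: "occ p \<Xi> \<le> 1"
  by (auto simp: occ_def)

lemma sets_config_space:
  "sets config_space = sigma_sets configs (range (\<lambda>x. {\<mu> \<in> configs. emeasure \<mu> {x} = 1}))"
  and space_config_space: "space config_space = configs"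
proof -
  have "range (\<lambda>x. {\<mu> \<in> configs. emeasure \<mu> {x} = 1}) \<subseteq> Pow configs" by auto
  then show "sets config_space = sigma_sets configs (range (\<lambda>x. {\<mu> \<in> configs. emeasure \<mu> {x} = 1}))"
    and "space config_space = configs"
    unfolding config_space_def by (rule sets_measure_of, rule space_measure_of)
qed

lemma space_path_space: "space path_space = UNIV \<rightarrow>\<^sub>E configs"
  by (simp add: path_space_def space_PiM space_config_space)

lemma path_space_configs: "\<Xi> \<in> space path_space \<Longrightarrow> \<Xi> t \<in> configs"
  by (auto simp: space_path_space)

lemma occ_measurable [measurable]: "occ p \<in> borel_measurable path_space"
proof -
  have A: "{\<mu> \<in> configs. emeasure \<mu> {snd p} = 1} \<in> sets config_space"
    unfolding sets_config_space by (intro sigma_sets.Basic) auto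
  have "(\<lambda>\<Xi>. \<Xi> (fst p)) \<in> measurable path_space config_space"
    unfolding path_space_def by (rule measurable_component_singleton) simp
  from measurable_sets[OF this A]
  have "{\<Xi> \<in> space path_space. emeasure (\<Xi> (fst p)) {snd p} = 1} \<in> sets path_space"
    by (rule back_subst[of "\<lambda>X. X \<in> sets path_space"]) (auto simp: path_space_configs)
  then show ?thesis unfolding occ_def[abs_def] by measurable
qed

text \<open>On a countable discrete space the masses of singletons determine the measure. This
  reduces integrals over a configuration, and equality of configurations, to the occupation
  indicators.\<close>

lemma config_density:
  assumes "\<mu> \<in> configs"
  shows "\<mu> = density (count_space UNIV) (\<lambda>x. ennreal (of_bool (emeasure \<mu> {x} = 1)))"
proof (rule measure_eqI_countable[of _ UNIV])
  fix x :: int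
  have "emeasure (density (count_space UNIV) (\<lambda>x. ennreal (of_bool (emeasure \<mu> {x} = 1)))) {x} =
      (\<integral>\<^sup>+y. ennreal (of_bool (emeasure \<mu> {y} = 1)) * indicator {x} y \<partial>count_space UNIV)"
    by (rule emeasure_density) auto
  also have "\<dots> = ennreal (of_bool (emeasure \<mu> {x} = 1))"
    by (subst nn_integral_count_space'[of "{x}"]) auto
  also have "\<dots> = emeasure \<mu> {x}"
    using assms by (auto simp: configs_def)
  finally show "emeasure \<mu> {x} = emeasure (density (count_space UNIV) (\<lambda>x. ennreal (of_bool (emeasure \<mu> {x} = 1)))) {x}" ..
qed (use assms in \<open>auto simp: configs_def\<close>)

lemma integrable_config:
  fixes f :: "int \<Rightarrow> real"
  assumes "\<Xi> t \<in> configs"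
  shows "integrable (\<Xi> t) f \<longleftrightarrow> integrable (count_space UNIV) (\<lambda>x. occ (t, x) \<Xi> * f x)"
    and "(\<integral>x. f x \<partial>\<Xi> t) = (\<integral>x. occ (t, x) \<Xi> * f x \<partial>count_space UNIV)"
proof -
  have e: "\<Xi> t = density (count_space UNIV) (\<lambda>x. ennreal (occ (t, x) \<Xi>))"
    using config_density[OF assms] by (simp add: occ_def)
  show "integrable (\<Xi> t) f \<longleftrightarrow> integrable (count_space UNIV) (\<lambda>x. occ (t, x) \<Xi> * f x)"
    by (subst e, subst integrable_density) (auto simp: occ_nonneg)
  show "(\<integral>x. f x \<partial>\<Xi> t) = (\<integral>x. occ (t, x) \<Xi> * f x \<partial>count_space UNIV)"
    by (subst e, subst integral_density) (auto simp: occ_nonneg)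
qed

section \<open>Fredholm expansions as sums over finite sets of space-time points\<close>

lemma set_st_points:
  assumes "length xss = length ts"
  shows "set (st_points ts xss) = {(ts ! m, x) | m x. m < length ts \<and> x \<in> set (xss ! m)}"
  using assms unfolding st_points_def by (fastforce simp: set_zip)

lemma prod_st_points:
  assumes "length ts = length xss"
  shows "(\<Prod>m<length ts. \<Prod>x\<leftarrow>xss ! m. h (ts ! m) x) =
    (\<Prod>p\<leftarrow>st_points ts xss. h (fst p) (snd p) :: real)"
  using assms
proof (induction ts xss rule: list_induct2)
  case (Cons t ts xs xss)
  then show ?case
    by (simp add: st_points_def prod.lessThan_Suc_shift comp_def del: prod.lessThan_Suc)
qed (simp add: st_points_def)

lemma distinct_st_points:
  assumes "length ts = length xss" "distinct ts" "\<And>xs. xs \<in> set xss \<Longrightarrow> distinct xs"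
  shows "distinct (st_points ts xss)"
  using assms
proof (induction ts xss rule: list_induct2)
  case (Cons t ts xs xss)
  then have "distinct (st_points ts xss)" by simp
  moreover have "fst p \<in> set ts" if "p \<in> set (st_points ts xss)" for p
    using that Cons.hyps by (auto simp: set_st_points)
  moreover have "st_points (t # ts) (xs # xss) = map (Pair t) xs @ st_points ts xss"
    by (simp add: st_points_def)
  ultimately show ?case
    using Cons.prems by (force simp: distinct_map inj_on_def)
qed (simp add: st_points_def)

abbreviation st_subsets :: "nat set \<Rightarrow> (nat \<times> int) set set" where
  "st_subsets A \<equiv> {S. finite S \<and> fst ` S \<subseteq> A}"

abbreviation families :: "nat list \<Rightarrow> int list list set" where
  "families ts \<equiv> \<Union>ns\<in>{ns. length ns = length ts}. increasing_tuples ns"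

text \<open>Since the times are distinct, a finite set of space-time points is recovered from its
  sections at the single times, and each section has one increasing enumeration.\<close>

lemma bij_st_points:
  assumes ts: "distinct ts"
  shows "bij_betw (\<lambda>xss. set (st_points ts xss))
    (families ts) (st_subsets (set ts))"
proof (rule bij_betw_byWitness[where f' = "\<lambda>S. map (\<lambda>t. sorted_list_of_set {x. (t, x) \<in> S}) ts"])
  let ?g = "\<lambda>S. map (\<lambda>t. sorted_list_of_set {x. (t, x) \<in> S}) ts"
  let ?U = "families ts"
  have U: "xss \<in> ?U \<longleftrightarrow> length xss = length ts \<and> (\<forall>xs\<in>set xss. sorted_wrt (<) xs)" for xss :: "int list list"
    by (auto simp: increasing_tuples_def)
  show "\<forall>xss\<in>?U. ?g (set (st_points ts xss)) = xss"
  proof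
    fix xss assume "xss \<in> ?U"
    then have xss: "length xss = length ts" "\<And>xs. xs \<in> set xss \<Longrightarrow> sorted_wrt (<) xs"
      unfolding U by auto
    show "?g (set (st_points ts xss)) = xss"
    proof (rule nth_equalityI)
      fix m assume "m < length (?g (set (st_points ts xss)))"
      then have m: "m < length ts" by simp
      have "{x. (ts ! m, x) \<in> set (st_points ts xss)} = set (xss ! m)"
        using m ts by (auto simp: set_st_points xss(1) nth_eq_iff_index_eq)
      moreover have "sorted_list_of_set (set (xss ! m)) = xss ! m"
        using xss(2)[of "xss ! m"] m xss(1)
        by (intro sorted_list_of_set.idem_if_sorted_distinct) (auto simp: strict_sorted_iff)
      ultimately show "?g (set (st_points ts xss)) ! m = xss ! m"
        using m by simp
    qed (simp add: xss)
  qed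
  have fin: "finite {x. (t, x) \<in> S}" if "finite S" for t and S :: "(nat \<times> int) set"
    by (rule finite_subset[OF _ finite_imageI[OF that, of snd]]) force
  show "\<forall>S\<in>st_subsets (set ts). set (st_points ts (?g S)) = S"
  proof
    fix S :: "(nat \<times> int) set" assume "S \<in> st_subsets (set ts)"
    then have S: "finite S" "fst ` S \<subseteq> set ts" by auto
    show "set (st_points ts (?g S)) = S"
    proof (intro equalityI subrelI)
      fix t x assume tx: "(t, x) \<in> S"
      then have "t \<in> set ts" using S(2) by force
      then obtain m where "m < length ts" "ts ! m = t" by (auto simp: in_set_conv_nth)
      with tx show "(t, x) \<in> set (st_points ts (?g S))"
        by (auto simp: set_st_points fin[OF S(1)])
    qed (auto simp: set_st_points fin[OF S(1)])
  qed
  show "(\<lambda>xss. set (st_points ts xss)) ` ?U \<subseteq> st_subsets (set ts)"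
  proof (rule image_subsetI)
    fix xss assume "xss \<in> ?U"
    then have "length xss = length ts" unfolding U by blast
    then have "fst ` set (st_points ts xss) \<subseteq> set ts" by (auto simp: set_st_points)
    then show "set (st_points ts xss) \<in> st_subsets (set ts)" by blast
  qed
  show "?g ` st_subsets (set ts) \<subseteq> ?U"
  proof (rule image_subsetI)
    fix S
    show "?g S \<in> ?U"
      unfolding U by (auto simp: strict_sorted_iff)
  qed
qed

lemma fredholm_term_eq:
  assumes ts: "distinct ts" and xss: "xss \<in> (families ts)"
  shows "fredholm_term ts K h xss = of_real (\<Prod>p\<in>set (st_points ts xss). h (fst p) (snd p)) *
    set_det (set (st_points ts xss)) (\<lambda>p q. K (fst p) (snd p) (fst q) (snd q))"
proof -
  have l: "length ts = length xss" and s: "\<And>xs. xs \<in> set xss \<Longrightarrow> sorted_wrt (<) xs"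
    using xss by (auto simp: increasing_tuples_def)
  have d: "distinct (st_points ts xss)"
    by (rule distinct_st_points[OF l ts]) (use s in \<open>auto simp: strict_sorted_iff\<close>)
  show ?thesis
    unfolding fredholm_term_def kernel_det_distinct[OF d] prod_st_points[OF l]
    by (simp only: prod.distinct_set_conv_list[OF d])
qed

lemma fredholm_convergent_iff:
  assumes ts: "distinct ts"
    and R: "\<And>S. S \<in> st_subsets (set ts) \<Longrightarrow> set_det S (\<lambda>p q. K (fst p) (snd p) (fst q) (snd q)) = of_real (R S)"
  shows "fredholm_convergent ts K h \<longleftrightarrow>
    (\<lambda>S. (\<Prod>p\<in>S. h (fst p) (snd p)) * R S) summable_on st_subsets (set ts)"
proof -
  let ?g = "\<lambda>S. (\<Prod>p\<in>S. h (fst p) (snd p)) * R S"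
  have "fredholm_convergent ts K h \<longleftrightarrow> (\<lambda>xss. complex_of_real (?g (set (st_points ts xss)))) summable_on
      (families ts)"
    unfolding fredholm_convergent_def
    by (rule summable_on_cong) (simp add: fredholm_term_eq[OF ts] R[OF bij_betw_apply[OF bij_st_points[OF ts]]])
  also have "\<dots> \<longleftrightarrow> (\<lambda>S. complex_of_real (?g S)) summable_on st_subsets (set ts)"
    by (rule summable_on_reindex_bij_betw[OF bij_st_points[OF ts]])
  also have "\<dots> \<longleftrightarrow> ?g summable_on st_subsets (set ts)"
    by (rule summable_on_bounded_linear_iff[OF bounded_linear_of_real bounded_linear_Re Re_complex_of_real])
  finally show ?thesis .
qed

lemma fredholm_det_eq:
  assumes ts: "distinct ts"
    and R: "\<And>S. S \<in> st_subsets (set ts) \<Longrightarrow> set_det S (\<lambda>p q. K (fst p) (snd p) (fst q) (snd q)) = of_real (R S)"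
    and conv: "fredholm_convergent ts K h"
  shows "fredholm_det ts K h =
    of_real (\<Sum>\<^sub>\<infinity>S\<in>st_subsets (set ts). (\<Prod>p\<in>S. h (fst p) (snd p)) * R S)"
proof -
  let ?g = "\<lambda>S. (\<Prod>p\<in>S. h (fst p) (snd p)) * R S"
  let ?N = "{ns::nat list. length ns = length ts}"
  \<comment> \<open>The lengths \<open>ns\<close> can be read off from \<open>xss\<close>, so the
    iterated sum over lengths and tuples is a single sum over all families; absolute convergence
    permits the regrouping.\<close>
  have inj: "inj_on snd (Sigma ?N increasing_tuples)"
    by (auto simp: inj_on_def increasing_tuples_def)
  have img: "snd ` Sigma ?N increasing_tuples = (\<Union>ns\<in>?N. increasing_tuples ns)"
    by force
  have sum: "(\<lambda>(ns, xss). fredholm_term ts K h xss) summable_on Sigma ?N increasing_tuples"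
    using conv unfolding fredholm_convergent_def img[symmetric] summable_on_reindex[OF inj]
    by (simp add: comp_def case_prod_unfold)
  have "fredholm_det ts K h = (\<Sum>\<^sub>\<infinity>(ns, xss)\<in>Sigma ?N increasing_tuples. fredholm_term ts K h xss)"
    unfolding fredholm_det_def by (rule infsum_Sigma'_banach[OF sum])
  also have "\<dots> = (\<Sum>\<^sub>\<infinity>xss\<in>(\<Union>ns\<in>?N. increasing_tuples ns). fredholm_term ts K h xss)"
    unfolding img[symmetric] infsum_reindex[OF inj] by (simp add: comp_def case_prod_unfold)
  also have "\<dots> = (\<Sum>\<^sub>\<infinity>xss\<in>(\<Union>ns\<in>?N. increasing_tuples ns). complex_of_real (?g (set (st_points ts xss))))"
    by (rule infsum_cong) (simp add: fredholm_term_eq[OF ts] R[OF bij_betw_apply[OF bij_st_points[OF ts]]])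
  also have "\<dots> = (\<Sum>\<^sub>\<infinity>S\<in>st_subsets (set ts). complex_of_real (?g S))"
    by (rule infsum_reindex_bij_betw[OF bij_st_points[OF ts]])
  also have "\<dots> = of_real (\<Sum>\<^sub>\<infinity>S\<in>st_subsets (set ts). ?g S)"
  proof (rule infsumI)
    have "?g summable_on st_subsets (set ts)"
      using fredholm_convergent_iff[of ts K R h, OF ts] R conv by blast
    then show "((\<lambda>S. complex_of_real (?g S)) has_sum of_real (\<Sum>\<^sub>\<infinity>S\<in>st_subsets (set ts). ?g S)) (st_subsets (set ts))"
      by (simp only: has_sum_of_real_iff has_sum_infsum)
  qed
  finally show ?thesis .
qed

lemma sum_Pow_prod:
  fixes c :: "'i \<Rightarrow> real"
  assumes "finite F"
  shows "(\<Sum>S\<in>Pow F. \<Prod>p\<in>S. c p) = (\<Prod>p\<in>F. 1 + c p)"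
  using prod_add[OF assms, of c "\<lambda>_. 1"] by (simp add: add.commute)

text \<open>The first bound passes summability from \<open>f\<close> to \<open>exp f - 1\<close>.
  The second goes back: it recovers integrability of a bounded \<open>f\<close> from control of
  \<open>exp f - 1\<close> on the occupied sites.\<close>

lemma abs_exp_minus_one_le:
  fixes z b :: real
  assumes "\<bar>z\<bar> \<le> b"
  shows "\<bar>exp z - 1\<bar> \<le> exp b * \<bar>z\<bar>" and "\<bar>z\<bar> \<le> exp b * \<bar>exp z - 1\<bar>"
proof -
  have b: "b \<ge> 0" using assms by linarith
  have e: "exp x - 1 \<le> exp b * x" "x \<le> exp x - 1" "exp x \<le> exp b" if "0 \<le> x" "x \<le> b" for x
  proof -
    show "x \<le> exp x - 1" using exp_ge_add_one_self[of x] by linarith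
    show eb: "exp x \<le> exp b" using that by simp
    have "exp x - 1 = exp x * (1 - exp (- x))" by (simp add: algebra_simps flip: exp_add)
    also have "\<dots> \<le> exp b * x"
    proof (intro mult_mono eb)
      show "1 - exp (- x) \<le> x" using exp_ge_add_one_self[of "- x"] by linarith
    qed (use that in auto)
    finally show "exp x - 1 \<le> exp b * x" .
  qed
  have n: "1 - exp (- x) = exp (- x) * (exp x - 1)" for x :: real
    by (simp add: algebra_simps flip: exp_add)
  have "\<bar>exp z - 1\<bar> \<le> exp b * \<bar>z\<bar> \<and> \<bar>z\<bar> \<le> exp b * \<bar>exp z - 1\<bar>"
  proof (cases "z \<ge> 0")
    case True
    have "z \<le> 1 * (exp z - 1)" using e(2)[of z] True assms by simp
    also have "\<dots> \<le> exp b * (exp z - 1)" using True b by (intro mult_right_mono) auto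
    finally show ?thesis using e(1)[of z] True assms by simp
  next
    case False
    define x where "x = - z"
    have x: "0 \<le> x" "x \<le> b" using False assms by (auto simp: x_def)
    have "1 - exp (- x) \<le> 1 * x" using exp_ge_add_one_self[of "- x"] by linarith
    also have "\<dots> \<le> exp b * x" using x b by (intro mult_right_mono) auto
    finally have 1: "1 - exp (- x) \<le> exp b * x" .
    have "x \<le> exp x - 1" using e(2) x by simp
    also have "\<dots> = exp x * (1 - exp (- x))" by (simp add: algebra_simps flip: exp_add)
    also have "\<dots> \<le> exp b * (1 - exp (- x))" using e(3) x by (intro mult_right_mono) auto
    finally have 2: "x \<le> exp b * (1 - exp (- x))" .
    show ?thesis using 1 2 x by (simp add: x_def abs_if)
  qed
  then show "\<bar>exp z - 1\<bar> \<le> exp b * \<bar>z\<bar>" "\<bar>z\<bar> \<le> exp b * \<bar>exp z - 1\<bar>" by auto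
qed

text \<open>As \<open>R\<close> is at most 1, any finite part of the sum is bounded by a product of
  factors \<open>1 + \<bar>h p\<bar>\<close>, hence by the exponential of the sum of
  \<open>\<bar>h p\<bar>\<close>.\<close>

lemma summable_subset_expansion:
  assumes h: "(\<lambda>p. \<bar>h p\<bar>) summable_on X"
    and R: "\<And>S. finite S \<Longrightarrow> 0 \<le> R S \<and> R S \<le> (1 :: real)"
  shows "(\<lambda>S. (\<Prod>p\<in>S. h p) * R S) summable_on {S. finite S \<and> S \<subseteq> X}"
proof -
  let ?g = "\<lambda>S. (\<Prod>p\<in>S. h p) * R S"
  let ?C = "exp (\<Sum>\<^sub>\<infinity>p\<in>X. \<bar>h p\<bar>)"
  have "(\<lambda>S. norm (?g S)) summable_on {S. finite S \<and> S \<subseteq> X}"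
  proof (rule nonneg_bdd_above_summable_on)
    show "bdd_above (sum (\<lambda>S. norm (?g S)) ` {A. A \<subseteq> {S. finite S \<and> S \<subseteq> X} \<and> finite A})"
    proof (rule bdd_aboveI2)
      fix A assume A: "A \<in> {A. A \<subseteq> {S. finite S \<and> S \<subseteq> X} \<and> finite A}"
      define F where "F = \<Union>A"
      have F: "finite F" "F \<subseteq> X" "A \<subseteq> Pow F" using A by (auto simp: F_def)
      have "(\<Sum>S\<in>A. norm (?g S)) \<le> (\<Sum>S\<in>A. \<Prod>p\<in>S. \<bar>h p\<bar>)"
      proof (rule sum_mono)
        fix S assume "S \<in> A"
        then have "finite S" using A by auto
        then have "norm (?g S) \<le> (\<Prod>p\<in>S. \<bar>h p\<bar>) * 1"
          using R[of S] unfolding norm_mult by (intro mult_mono) (auto simp: abs_prod prod_nonneg)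
        then show "norm (?g S) \<le> (\<Prod>p\<in>S. \<bar>h p\<bar>)" by simp
      qed
      also have "\<dots> \<le> (\<Sum>S\<in>Pow F. \<Prod>p\<in>S. \<bar>h p\<bar>)"
        using F by (intro sum_mono2) (auto simp: prod_nonneg)
      also have "\<dots> = (\<Prod>p\<in>F. 1 + \<bar>h p\<bar>)" by (rule sum_Pow_prod[OF F(1)])
      also have "\<dots> \<le> (\<Prod>p\<in>F. exp \<bar>h p\<bar>)"
        by (intro prod_mono) auto
      also have "\<dots> = exp (\<Sum>p\<in>F. \<bar>h p\<bar>)" using F(1) by (simp add: exp_sum)
      also have "\<dots> \<le> ?C"
        using F h by (auto intro!: finite_sum_le_infsum)
      finally show "(\<Sum>S\<in>A. norm (?g S)) \<le> ?C" .
    qed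
  qed auto
  then show ?thesis by (rule abs_summable_summable)
qed

lemma fredholm_convergent_summable:
  assumes ts: "distinct ts"
    and R: "\<And>S. S \<in> st_subsets (set ts) \<Longrightarrow> set_det S (\<lambda>p q. K (fst p) (snd p) (fst q) (snd q)) = of_real (R S)"
    and R01: "\<And>S. S \<in> st_subsets (set ts) \<Longrightarrow> 0 \<le> R S \<and> R S \<le> (1 :: real)"
    and f: "\<And>t. t \<in> set ts \<Longrightarrow> f t summable_on UNIV"
  shows "fredholm_convergent ts K (\<lambda>t x. exp (f t x) - 1)"
proof -
  define h where "h p = exp (f (fst p) (snd p)) - 1" for p
  have abs: "(\<lambda>x. \<bar>f t x\<bar>) summable_on UNIV" if "t \<in> set ts" for t
    using summable_on_iff_abs_summable_on_real[THEN iffD1, OF f[OF that]] unfolding real_norm_def .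
  have ht: "(\<lambda>p. \<bar>h p\<bar>) summable_on {t} \<times> UNIV" if t: "t \<in> set ts" for t
  proof -
    define b where "b = (\<Sum>\<^sub>\<infinity>x. \<bar>f t x\<bar>)"
    have b: "\<bar>f t x\<bar> \<le> b" for x
      unfolding b_def using finite_sum_le_infsum[OF abs[OF t], of "{x}"] by simp
    have "(\<lambda>x. exp b * \<bar>f t x\<bar>) summable_on UNIV"
      by (intro summable_on_cmult_right abs t)
    then have "(\<lambda>x. \<bar>exp (f t x) - 1\<bar>) summable_on UNIV"
      by (rule summable_on_comparison_test) (use abs_exp_minus_one_le(1)[OF b] in auto)
    moreover have "bij_betw (Pair t) UNIV ({t} \<times> UNIV)"
      by (auto simp: bij_betw_def inj_on_def)
    ultimately show ?thesis
      by (subst summable_on_reindex_bij_betw[symmetric, of "Pair t" UNIV]) (auto simp: h_def)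
  qed
  have "(\<lambda>p. \<bar>h p\<bar>) summable_on (\<Union>t\<in>set ts. {t} \<times> UNIV)"
    by (rule summable_on_finite_union_disjoint) (use ht in auto)
  then have "(\<lambda>p. \<bar>h p\<bar>) summable_on set ts \<times> UNIV"
    by (rule back_subst) auto
  \<comment> \<open>\<open>R\<close> is bounded only on sets with times in \<open>set ts\<close>;
    extension by 0 supplies the bounds for all finite sets.\<close>
  then have "(\<lambda>S. (\<Prod>p\<in>S. h p) * (if S \<subseteq> set ts \<times> UNIV then R S else 0)) summable_on
      {S. finite S \<and> S \<subseteq> set ts \<times> UNIV}"
    by (rule summable_subset_expansion) (use R01 in force)
  moreover have X: "st_subsets (set ts) = {S. finite S \<and> S \<subseteq> set ts \<times> UNIV}" by force
  ultimately have "(\<lambda>S. (\<Prod>p\<in>S. h p) * (if S \<subseteq> set ts \<times> UNIV then R S else 0)) summable_on st_subsets (set ts)"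
    by simp
  moreover have "(\<lambda>S. (\<Prod>p\<in>S. h p) * (if S \<subseteq> set ts \<times> UNIV then R S else 0)) summable_on st_subsets (set ts) \<longleftrightarrow>
      (\<lambda>S. (\<Prod>p\<in>S. h p) * R S) summable_on st_subsets (set ts)"
    by (rule summable_on_cong) (use X in auto)
  ultimately show ?thesis
    using fredholm_convergent_iff[of ts K R "\<lambda>t x. exp (f t x) - 1", OF ts] R by (simp add: h_def)
qed

section \<open>Determinantal laws and their correlations\<close>

lemma space_eq_path_space:
  assumes "sets P = sets path_space"
  shows "space P = space path_space"
  by (rule sets_eq_imp_space_eq[OF assms])

lemma integrable_prod_occ:
  assumes P: "prob_space P" "sets P = sets path_space"
  shows "integrable P (\<lambda>\<Xi>. \<Prod>p\<in>S. occ p \<Xi>)"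
proof -
  interpret prob_space P by fact
  have [measurable]: "occ p \<in> borel_measurable P" for p
    using occ_measurable[of p] by (simp cong: measurable_cong_sets add: P(2))
  show ?thesis
  proof (rule integrable_const_bound[where B = 1])
    show "AE \<Xi> in P. norm (\<Prod>p\<in>S. occ p \<Xi>) \<le> 1"
      by (intro AE_I2) (simp add: prod_nonneg occ_nonneg prod_le_1 occ_le_1)
  qed measurable
qed

lemma integral_prod_one_plus_occ:
  fixes c :: "nat \<times> int \<Rightarrow> real"
  assumes P: "prob_space P" "sets P = sets path_space" and F: "finite F"
  shows "integrable P (\<lambda>\<Xi>. \<Prod>p\<in>F. 1 + c p * occ p \<Xi>)"
    and "(\<integral>\<Xi>. (\<Prod>p\<in>F. 1 + c p * occ p \<Xi>) \<partial>P) = (\<Sum>S\<in>Pow F. (\<Prod>p\<in>S. c p) * occ_mean P S)"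
proof -
  have e: "(\<Prod>p\<in>F. 1 + c p * occ p \<Xi>) = (\<Sum>S\<in>Pow F. (\<Prod>p\<in>S. c p) * (\<Prod>p\<in>S. occ p \<Xi>))" for \<Xi>
    by (subst sum_Pow_prod[OF F, symmetric]) (simp add: prod.distrib)
  have i: "integrable P (\<lambda>\<Xi>. (\<Prod>p\<in>S. c p) * (\<Prod>p\<in>S. occ p \<Xi>))" for S
    by (intro integrable_mult_right integrable_prod_occ P)
  show "integrable P (\<lambda>\<Xi>. \<Prod>p\<in>F. 1 + c p * occ p \<Xi>)"
    unfolding e by (intro Bochner_Integration.integrable_sum i)
  show "(\<integral>\<Xi>. (\<Prod>p\<in>F. 1 + c p * occ p \<Xi>) \<partial>P) = (\<Sum>S\<in>Pow F. (\<Prod>p\<in>S. c p) * occ_mean P S)"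
    unfolding e by (subst Bochner_Integration.integral_sum[OF i]) simp
qed

lemma st_box_exhausts:
  assumes "finite F" "fst ` F \<subseteq> A"
  shows "\<forall>\<^sub>F n in sequentially. F \<subseteq> A \<times> {- int n..int n}"
proof -
  define N where "N = Max (insert 0 ((\<lambda>p. nat \<bar>snd p\<bar>) ` F))"
  have "nat \<bar>snd p\<bar> \<le> N" if "p \<in> F" for p
    unfolding N_def using assms(1) that by (intro Max_ge) auto
  then have "\<bar>snd p\<bar> \<le> int N" if "p \<in> F" for p using that by (simp add: nat_le_iff)
  then have "F \<subseteq> A \<times> {- int n..int n}" if "n \<ge> N" for n
    using assms(2) that by (force simp: abs_le_iff)
  then show ?thesis unfolding eventually_sequentially by blast
qed

lemma integrable_count_space_bounded:
  fixes g :: "int \<Rightarrow> real"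
  assumes "\<And>n. (\<Sum>x\<in>{- int n..int n}. \<bar>g x\<bar>) \<le> C"
  shows "integrable (count_space UNIV) g"
    and "(\<lambda>n. \<Sum>x\<in>{- int n..int n}. g x) \<longlonglongrightarrow> (\<integral>x. g x \<partial>count_space UNIV)"
proof -
  have ex: "\<forall>\<^sub>F n in sequentially. F \<subseteq> {- int n..int n}" if "finite F" for F
    using st_box_exhausts[of "Pair 0 ` F" "{0}"] that by (auto simp: image_iff subset_iff elim!: eventually_mono)
  have abs: "(\<lambda>x. norm (g x)) summable_on UNIV"
  proof (rule nonneg_bdd_above_summable_on)
    show "bdd_above (sum (\<lambda>x. norm (g x)) ` {F. F \<subseteq> UNIV \<and> finite F})"
    proof (rule bdd_aboveI2)
      fix F :: "int set" assume "F \<in> {F. F \<subseteq> UNIV \<and> finite F}"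
      then obtain n where n: "F \<subseteq> {- int n..int n}"
        using ex[of F] by (auto simp: eventually_sequentially)
      have "(\<Sum>x\<in>F. norm (g x)) \<le> (\<Sum>x\<in>{- int n..int n}. \<bar>g x\<bar>)"
        using n by (simp add: sum_mono2)
      also have "\<dots> \<le> C" by (rule assms)
      finally show "(\<Sum>x\<in>F. norm (g x)) \<le> C" .
    qed
  qed auto
  then have ab: "Infinite_Set_Sum.abs_summable_on g UNIV"
    by (simp only: abs_summable_equivalent)
  then show "integrable (count_space UNIV) g" by (simp add: Infinite_Set_Sum.abs_summable_on_def)
  have "(\<integral>x. g x \<partial>count_space UNIV) = infsum g UNIV"
    using infsetsum_infsum[OF ab] by (simp add: infsetsum_def)
  moreover have "(g has_sum infsum g UNIV) UNIV"
    by (rule has_sum_infsum[OF abs_summable_summable[OF abs]])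
  moreover have "filterlim (\<lambda>n. {- int n..int n}) (finite_subsets_at_top UNIV) sequentially"
    using ex by (auto simp: filterlim_finite_subsets_at_top)
  ultimately show "(\<lambda>n. \<Sum>x\<in>{- int n..int n}. g x) \<longlonglongrightarrow> (\<integral>x. g x \<partial>count_space UNIV)"
    unfolding has_sum_def by (auto dest: filterlim_compose)
qed

lemma config_integral_measurable:
  fixes f :: "int \<Rightarrow> real"
  assumes P: "sets P = sets path_space"
  shows "(\<lambda>\<Xi>. \<integral>x. f x \<partial>\<Xi> t) \<in> borel_measurable P"
proof -
  interpret C: sigma_finite_measure "count_space (UNIV :: int set)"
    by (rule sigma_finite_measure_count_space_countable) auto
  have m: "occ p \<in> borel_measurable P" for p
    using occ_measurable[of p] by (simp cong: measurable_cong_sets add: P)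
  have "(\<lambda>(x, \<Xi>). occ (t, x) \<Xi> * f x) \<in> borel_measurable (count_space UNIV \<Otimes>\<^sub>M P)"
    by (rule measurable_pair_measure_countable1) (auto intro!: borel_measurable_times m)
  from measurable_compose[OF measurable_pair_swap' this]
  have "(\<lambda>(\<Xi>, x). occ (t, x) \<Xi> * f x) \<in> borel_measurable (P \<Otimes>\<^sub>M count_space UNIV)"
    by (simp add: case_prod_unfold)
  then have "(\<lambda>\<Xi>. \<integral>x. occ (t, x) \<Xi> * f x \<partial>count_space UNIV) \<in> borel_measurable P"
    by (rule C.borel_measurable_lebesgue_integral)
  then show ?thesis
    by (rule measurable_cong[THEN iffD1, rotated])
      (simp add: integrable_config(2) path_space_configs space_eq_path_space[OF P])
qed

text \<open>On a finite box the exponential is a product of factors \<open>1 + h p * occ p\<close>,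
  whose mean is a partial sum of the Fredholm expansion. The supremum of the products with
  \<open>\<bar>h p\<bar>\<close> is integrable and justifies the limit; its almost sure finiteness
  also bounds the sum of \<open>\<bar>f t x\<bar>\<close> over occupied sites, so that the integrals
  in the exponent exist.\<close>

theorem determinantal_law_of_correlation:
  assumes P: "prob_space P" "sets P = sets path_space"
    and R: "\<And>S. S \<in> st_subsets {1..} \<Longrightarrow> set_det S (\<lambda>p q. K (fst p) (snd p) (fst q) (snd q)) = of_real (R S)"
    and corr: "\<And>S. S \<in> st_subsets {1..} \<Longrightarrow> occ_mean P S = R S"
  shows "determinantal_law K P"
  unfolding determinantal_law_def
proof (intro allI impI)
  fix T ts f
  assume A: "observation_times T ts \<and> (\<forall>t\<in>set ts. bounded (range (f t))) \<and>
    fredholm_convergent ts K (\<lambda>t x. exp (f t x) - 1)"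
  interpret P: prob_space P by fact
  have m[measurable]: "occ p \<in> borel_measurable P" for p
    using occ_measurable[of p] by (simp cong: measurable_cong_sets add: P(2))
  have ts: "distinct ts" "set ts \<subseteq> {1..}"
    using A by (auto simp: observation_times_def strict_sorted_iff)
  have "\<exists>b. \<forall>t\<in>set ts. \<forall>x. \<bar>f t x\<bar> \<le> b"
  proof -
    have "bounded (\<Union>t\<in>set ts. range (f t))" using A by (intro bounded_UN) auto
    then show ?thesis by (auto simp: bounded_iff)
  qed
  then obtain b where b: "\<And>t x. t \<in> set ts \<Longrightarrow> \<bar>f t x\<bar> \<le> b" by blast
  have R': "set_det S (\<lambda>p q. K (fst p) (snd p) (fst q) (snd q)) = of_real (R S)"
    if "S \<in> st_subsets (set ts)" for S
    using that ts(2) by (intro R) blast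
  define h where "h p = exp (f (fst p) (snd p)) - 1" for p
  define G where "G S = (\<Prod>p\<in>S. h p) * R S" for S
  let ?FS = "st_subsets (set ts)"
  define Box where "Box n = set ts \<times> {- int n..int n}" for n
  have Box: "finite (Box n)" "Pow (Box n) \<subseteq> ?FS" "fst ` Box n \<subseteq> {1..}" for n
    using ts finite_subset[of _ "Box n"] by (auto simp: Box_def)
  have Box_mono: "Box n \<subseteq> Box n'" if "n \<le> n'" for n n' using that by (auto simp: Box_def)
  have corr': "occ_mean P S = R S" if "S \<in> Pow (Box n)" for S n
  proof (rule corr)
    have "S \<subseteq> Box n" using that by simp
    then have "finite S" and "fst ` S \<subseteq> fst ` Box n"
      using Box(1) by (auto intro: finite_subset)
    then show "S \<in> st_subsets {1..}" using Box(3)[of n] by blast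
  qed
  have R_nonneg: "R S \<ge> 0" if "S \<in> ?FS" for S
    using corr[of S] that ts Bochner_Integration.integral_nonneg[of P "\<lambda>\<Xi>. \<Prod>p\<in>S. occ p \<Xi>"]
    by (force simp: prod_nonneg occ_nonneg)
  have conv: "G summable_on ?FS"
    using A fredholm_convergent_iff[of ts K R "\<lambda>t x. exp (f t x) - 1", OF ts(1) R']
    by (simp add: G_def[abs_def] h_def)
  then have conv_abs: "(\<lambda>S. \<bar>G S\<bar>) summable_on ?FS"
    using summable_on_iff_abs_summable_on_real[of G ?FS] unfolding real_norm_def by blast
  define C where "C = (\<Sum>\<^sub>\<infinity>S\<in>?FS. \<bar>G S\<bar>)"
  \<comment> \<open>\<open>W\<close> carries \<open>\<bar>h p\<bar>\<close> in place of
    \<open>h p\<close>. It increases with the box and dominates \<open>Z\<close>, and because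
    \<open>R\<close> is nonnegative its mean is a partial sum of the absolute values
    \<open>\<bar>G S\<bar>\<close>.\<close>
  define W where "W n \<Xi> = (\<Prod>p\<in>Box n. 1 + \<bar>h p\<bar> * occ p \<Xi>)" for n \<Xi>
  define Z where "Z n \<Xi> = (\<Prod>p\<in>Box n. 1 + h p * occ p \<Xi>)" for n \<Xi>
  have W_int: "integrable P (W n)" for n
    unfolding W_def[abs_def] by (rule integral_prod_one_plus_occ(1)[OF P Box(1)])
  have W_pos: "W n \<Xi> \<ge> 0" for n \<Xi> unfolding W_def by (intro prod_nonneg) (simp add: occ_nonneg)
  have W_le: "(\<integral>\<Xi>. W n \<Xi> \<partial>P) \<le> C" for n
  proof -
    have "(\<integral>\<Xi>. W n \<Xi> \<partial>P) = (\<Sum>S\<in>Pow (Box n). (\<Prod>p\<in>S. \<bar>h p\<bar>) * R S)"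
      unfolding W_def[abs_def] integral_prod_one_plus_occ(2)[OF P Box(1)]
      by (intro sum.cong refl) (simp only: corr')
    also have "\<dots> = (\<Sum>S\<in>Pow (Box n). \<bar>G S\<bar>)"
    proof (intro sum.cong refl)
      fix S assume "S \<in> Pow (Box n)"
      then have "R S \<ge> 0" by (rule R_nonneg[OF subsetD[OF Box(2)]])
      then show "(\<Prod>p\<in>S. \<bar>h p\<bar>) * R S = \<bar>G S\<bar>" by (simp add: G_def abs_mult abs_prod)
    qed
    also have "\<dots> \<le> C"
      unfolding C_def using Box by (intro finite_sum_le_infsum conv_abs) auto
    finally show ?thesis .
  qed
  have W_mono: "W n \<Xi> \<le> W n' \<Xi>" if "n \<le> n'" for n n' \<Xi>
    unfolding W_def using Box(1) Box_mono[OF that]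
    by (intro prod_mono2) (auto simp: occ_nonneg)
  define V where "V \<Xi> = (SUP n. ennreal (W n \<Xi>))" for \<Xi>
  have W_meas[measurable]: "W n \<in> borel_measurable P" for n using W_int by auto
  have V_meas[measurable]: "V \<in> borel_measurable P" unfolding V_def[abs_def] by measurable
  have "(\<integral>\<^sup>+\<Xi>. V \<Xi> \<partial>P) = (SUP n. \<integral>\<^sup>+\<Xi>. ennreal (W n \<Xi>) \<partial>P)"
    unfolding V_def[abs_def]
    by (rule nn_integral_monotone_convergence_SUP) (auto simp: incseq_def le_fun_def W_mono ennreal_leI)
  also have "\<dots> \<le> ennreal C"
  proof (rule SUP_least)
    fix n
    have "(\<integral>\<^sup>+\<Xi>. ennreal (W n \<Xi>) \<partial>P) = ennreal (\<integral>\<Xi>. W n \<Xi> \<partial>P)"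
      by (rule nn_integral_eq_integral[OF W_int]) (simp add: W_pos)
    also have "\<dots> \<le> ennreal C" by (rule ennreal_leI[OF W_le])
    finally show "(\<integral>\<^sup>+\<Xi>. ennreal (W n \<Xi>) \<partial>P) \<le> ennreal C" .
  qed
  finally have V_int: "(\<integral>\<^sup>+\<Xi>. V \<Xi> \<partial>P) < \<infinity>" by (simp add: ennreal_less_top order.strict_trans1)
  then have V_fin: "AE \<Xi> in P. V \<Xi> \<noteq> \<infinity>"
    by (intro nn_integral_PInf_AE) auto
  define v where "v \<Xi> = enn2real (V \<Xi>)" for \<Xi>
  have Wv: "W n \<Xi> \<le> v \<Xi>" if "V \<Xi> \<noteq> \<infinity>" for n \<Xi>
  proof -
    have "ennreal (W n \<Xi>) \<le> V \<Xi>" unfolding V_def by (rule SUP_upper) simp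
    also have "V \<Xi> = ennreal (v \<Xi>)" using that by (simp add: v_def less_top)
    finally show ?thesis by (simp add: v_def)
  qed
  have v_int: "integrable P v"
  proof (rule integrableI_nonneg)
    have "(\<integral>\<^sup>+\<Xi>. ennreal (v \<Xi>) \<partial>P) \<le> (\<integral>\<^sup>+\<Xi>. V \<Xi> \<partial>P)"
      by (intro nn_integral_mono) (simp add: v_def ennreal_enn2real_if)
    then show "(\<integral>\<^sup>+\<Xi>. ennreal (v \<Xi>) \<partial>P) < \<infinity>" using V_int by (rule order.strict_trans1)
    show "v \<in> borel_measurable P" unfolding v_def[abs_def] by measurable
  qed (auto simp: v_def)
  have occ_sum: "(\<Sum>x\<in>{- int n..int n}. \<bar>occ (t, x) \<Xi> * f t x\<bar>) \<le> exp b * v \<Xi>"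
    if t: "t \<in> set ts" and V: "V \<Xi> \<noteq> \<infinity>" for t n \<Xi>
  proof -
    have sub: "Pair t ` {- int n..int n} \<subseteq> Box n" using t by (auto simp: Box_def)
    have "(\<Sum>x\<in>{- int n..int n}. \<bar>occ (t, x) \<Xi> * f t x\<bar>) \<le> (\<Sum>x\<in>{- int n..int n}. exp b * (\<bar>h (t, x)\<bar> * occ (t, x) \<Xi>))"
    proof (rule sum_mono)
      fix x
      have "\<bar>f t x\<bar> * occ (t, x) \<Xi> \<le> (exp b * \<bar>h (t, x)\<bar>) * occ (t, x) \<Xi>"
        using abs_exp_minus_one_le(2)[OF b[OF t]] by (intro mult_right_mono) (auto simp: h_def occ_nonneg)
      then show "\<bar>occ (t, x) \<Xi> * f t x\<bar> \<le> exp b * (\<bar>h (t, x)\<bar> * occ (t, x) \<Xi>)"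
        by (simp add: abs_mult occ_nonneg mult_ac)
    qed
    also have "\<dots> = exp b * (\<Sum>p\<in>Pair t ` {- int n..int n}. \<bar>h p\<bar> * occ p \<Xi>)"
      by (simp add: sum.reindex inj_on_def sum_distrib_left)
    also have "\<dots> \<le> exp b * (\<Sum>p\<in>Box n. \<bar>h p\<bar> * occ p \<Xi>)"
      using sub Box(1) by (intro mult_left_mono sum_mono2) (auto simp: occ_nonneg)
    \<comment> \<open>A product of factors \<open>1 + c p\<close> with \<open>c p \<ge> 0\<close>
      dominates its linear part, which turns control of \<open>W\<close> into control of a sum over
      occupied sites.\<close>
    also have "(\<Sum>p\<in>Box n. \<bar>h p\<bar> * occ p \<Xi>) \<le> W n \<Xi>"
    proof -
      have "1 + (\<Sum>p\<in>F. c p) \<le> (\<Prod>p\<in>F. 1 + c p)" if "finite F" "\<And>p. c p \<ge> (0 :: real)" for F :: "(nat \<times> int) set" and c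
        using that(1)
      proof (induction F rule: finite_induct)
        case (insert p F)
        have "1 \<le> (\<Prod>p\<in>F. 1 + c p)" using that(2) by (intro prod_ge_1) simp
        then have "c p * 1 \<le> c p * (\<Prod>p\<in>F. 1 + c p)" using that(2) by (intro mult_left_mono) auto
        then show ?case using insert by (simp add: distrib_right)
      qed simp
      from this[of "Box n" "\<lambda>p. \<bar>h p\<bar> * occ p \<Xi>"] show ?thesis
        using Box(1) by (simp add: W_def occ_nonneg)
    qed
    also have "W n \<Xi> \<le> v \<Xi>" by (rule Wv[OF V])
    finally show ?thesis by simp
  qed
  let ?E = "\<lambda>\<Xi>. exp (\<Sum>t\<leftarrow>ts. \<integral>x. f t x \<partial>\<Xi> t)"
  have E_eq: "?E = (\<lambda>\<Xi>. exp (\<Sum>t\<in>set ts. \<integral>x. f t x \<partial>\<Xi> t))"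
    by (simp add: sum_list_distinct_conv_sum_set ts(1))
  have E_meas: "?E \<in> borel_measurable P"
    unfolding E_eq by (intro borel_measurable_exp[THEN measurable_compose[rotated]] borel_measurable_sum
      config_integral_measurable P(2))
  have Z_int: "integrable P (Z n)" for n
    unfolding Z_def[abs_def] by (rule integral_prod_one_plus_occ(1)[OF P Box(1)])
  have good: "AE \<Xi> in P. (\<forall>t\<in>set ts. integrable (\<Xi> t) (f t)) \<and> (\<lambda>n. Z n \<Xi>) \<longlonglongrightarrow> ?E \<Xi>"
    using V_fin AE_space
  proof eventually_elim
    fix \<Xi> assume V: "V \<Xi> \<noteq> \<infinity>" and sp: "\<Xi> \<in> space P"
    have cfg: "\<Xi> t \<in> configs" for t
      using sp space_eq_path_space[OF P(2)] path_space_configs by simp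
    have Zexp: "Z n \<Xi> = exp (\<Sum>t\<in>set ts. \<Sum>x\<in>{- int n..int n}. occ (t, x) \<Xi> * f t x)" for n
    proof -
      have "Z n \<Xi> = (\<Prod>p\<in>Box n. exp (occ p \<Xi> * f (fst p) (snd p)))"
        unfolding Z_def
      proof (intro prod.cong refl)
        fix p show "1 + h p * occ p \<Xi> = exp (occ p \<Xi> * f (fst p) (snd p))"
          using occ_01[of p \<Xi>] by (auto simp: h_def)
      qed
      also have "\<dots> = exp (\<Sum>p\<in>Box n. occ p \<Xi> * f (fst p) (snd p))"
        using Box(1) by (simp add: exp_sum)
      also have "(\<Sum>p\<in>Box n. occ p \<Xi> * f (fst p) (snd p)) = (\<Sum>t\<in>set ts. \<Sum>x\<in>{- int n..int n}. occ (t, x) \<Xi> * f t x)"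
        unfolding Box_def sum.cartesian_product by (simp add: case_prod_unfold)
      finally show ?thesis .
    qed
    have "(\<lambda>n. Z n \<Xi>) \<longlonglongrightarrow> exp (\<Sum>t\<in>set ts. \<integral>x. f t x \<partial>\<Xi> t)"
      unfolding Zexp integrable_config(2)[of \<Xi>, OF cfg]
      by (intro tendsto_exp tendsto_sum integrable_count_space_bounded(2)[OF occ_sum] V)
    moreover have "integrable (\<Xi> t) (f t)" if "t \<in> set ts" for t
      unfolding integrable_config(1)[of \<Xi>, OF cfg]
      by (rule integrable_count_space_bounded(1)[OF occ_sum[OF that V]])
    ultimately show "(\<forall>t\<in>set ts. integrable (\<Xi> t) (f t)) \<and> (\<lambda>n. Z n \<Xi>) \<longlonglongrightarrow> ?E \<Xi>"
      by (simp add: sum_list_distinct_conv_sum_set ts(1))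
  qed
  have dom: "AE \<Xi> in P. norm (Z n \<Xi>) \<le> v \<Xi>" for n
    using V_fin
  proof eventually_elim
    fix \<Xi> assume V: "V \<Xi> \<noteq> \<infinity>"
    have "norm (Z n \<Xi>) \<le> W n \<Xi>"
      unfolding Z_def W_def prod_norm[symmetric]
    proof (intro prod_mono conjI norm_ge_zero)
      fix p show "norm (1 + h p * occ p \<Xi>) \<le> 1 + \<bar>h p\<bar> * occ p \<Xi>"
        by (rule order.trans[OF norm_triangle_ineq]) (simp add: abs_mult occ_nonneg)
    qed
    also have "\<dots> \<le> v \<Xi>" by (rule Wv[OF V])
    finally show "norm (Z n \<Xi>) \<le> v \<Xi>" .
  qed
  have lim: "AE \<Xi> in P. (\<lambda>n. Z n \<Xi>) \<longlonglongrightarrow> ?E \<Xi>" using good by eventually_elim simp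
  have E_int: "integrable P ?E"
    by (rule integrable_dominated_convergence[OF E_meas borel_measurable_integrable[OF Z_int] v_int lim dom])
  have "(\<lambda>n. \<integral>\<Xi>. Z n \<Xi> \<partial>P) \<longlonglongrightarrow> (\<integral>\<Xi>. ?E \<Xi> \<partial>P)"
    by (rule integral_dominated_convergence[OF E_meas borel_measurable_integrable[OF Z_int] v_int lim dom])
  moreover have "(\<integral>\<Xi>. Z n \<Xi> \<partial>P) = sum G (Pow (Box n))" for n
    unfolding Z_def[abs_def] integral_prod_one_plus_occ(2)[OF P Box(1)] G_def
    by (intro sum.cong refl) (simp only: corr')
  moreover have "(\<lambda>n. sum G (Pow (Box n))) \<longlonglongrightarrow> infsum G ?FS"
  proof -
    have "filterlim (\<lambda>n. Pow (Box n)) (finite_subsets_at_top ?FS) sequentially"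
      unfolding filterlim_finite_subsets_at_top
    proof (intro allI impI)
      fix \<A> assume \<A>: "finite \<A> \<and> \<A> \<subseteq> ?FS"
      have "\<forall>\<^sub>F n in sequentially. \<Union>\<A> \<subseteq> Box n"
        unfolding Box_def by (rule st_box_exhausts) (use \<A> in auto)
      then show "\<forall>\<^sub>F n in sequentially. finite (Pow (Box n)) \<and> \<A> \<subseteq> Pow (Box n) \<and> Pow (Box n) \<subseteq> ?FS"
        by eventually_elim (use Box in auto)
    qed
    then show ?thesis
      using has_sum_infsum[OF conv] unfolding has_sum_def by (rule filterlim_compose[rotated])
  qed
  ultimately have "(\<integral>\<Xi>. ?E \<Xi> \<partial>P) = infsum G ?FS" using LIMSEQ_unique by auto
  moreover have "fredholm_det ts K (\<lambda>t x. exp (f t x) - 1) = of_real (infsum G ?FS)"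
    using A fredholm_det_eq[of ts K R "\<lambda>t x. exp (f t x) - 1", OF ts(1) R']
    by (simp add: G_def[abs_def] h_def)
  moreover have "AE \<Xi> in P. \<forall>t\<in>set ts. integrable (\<Xi> t) (f t)" using good by eventually_elim simp
  ultimately show "(AE \<Xi> in P. \<forall>t\<in>set ts. integrable (\<Xi> t) (f t)) \<and> integrable P ?E \<and>
      complex_of_real (\<integral>\<Xi>. ?E \<Xi> \<partial>P) = fredholm_det ts K (\<lambda>t x. exp (f t x) - 1)"
    using E_int by simp
qed

section \<open>Cylinder events and uniqueness of the law\<close>

definition cylinder :: "(nat \<times> int) set \<Rightarrow> (nat \<Rightarrow> int measure) set" where
  "cylinder S = {\<Xi> \<in> space path_space. \<forall>p\<in>S. occ p \<Xi> = 1}"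

lemma cylinder_measurable: "finite S \<Longrightarrow> cylinder S \<in> sets path_space"
  unfolding cylinder_def by measurable

lemma measure_cylinder:
  assumes P: "prob_space P" "sets P = sets path_space" and S: "finite S"
  shows "measure P (cylinder S) = occ_mean P S"
proof -
  have sp: "space P = space path_space" by (rule space_eq_path_space[OF P(2)])
  have "occ_mean P S = (\<integral>\<Xi>. indicator (cylinder S) \<Xi> \<partial>P)"
  proof (rule Bochner_Integration.integral_cong[OF refl])
    fix \<Xi> assume \<Xi>: "\<Xi> \<in> space P"
    show "(\<Prod>p\<in>S. occ p \<Xi>) = indicator (cylinder S) \<Xi>"
    proof (cases "\<forall>p\<in>S. occ p \<Xi> = 1")
      case True
      then show ?thesis using \<Xi> sp by (simp add: cylinder_def)
    next
      case False
      then obtain p where "p \<in> S" "occ p \<Xi> = 0" using occ_01 by blast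
      then show ?thesis using S False by (auto simp: cylinder_def intro: prod_zero)
    qed
  qed
  also have "\<dots> = measure P (cylinder S \<inter> space P)" by simp
  also have "cylinder S \<inter> space P = cylinder S" using sp by (auto simp: cylinder_def)
  finally show ?thesis ..
qed

lemma sets_path_space_cylinder:
  "sets path_space = sigma_sets (space path_space) (cylinder ` {S. finite S})"
proof -
  let ?E = "cylinder ` {S. finite S}" and ?\<Omega> = "space path_space"
  have E: "?E \<subseteq> Pow ?\<Omega>" by (auto simp: cylinder_def)
  have sp: "space (sigma ?\<Omega> ?E) = ?\<Omega>" and st: "sets (sigma ?\<Omega> ?E) = sigma_sets ?\<Omega> ?E"
    using E by (auto simp: space_measure_of sets_measure_of)
  have "(\<lambda>\<Xi> t. \<Xi> t) \<in> measurable (sigma ?\<Omega> ?E) path_space"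
    unfolding path_space_def
  proof (rule measurable_PiM_single')
    fix t
    show "(\<lambda>\<Xi>. \<Xi> t) \<in> measurable (sigma (space (PiM UNIV (\<lambda>_. config_space))) ?E) config_space"
      unfolding path_space_def[symmetric]
      unfolding config_space_def
    proof (rule measurable_measure_of)
      fix y assume "y \<in> range (\<lambda>x. {\<mu> \<in> configs. emeasure \<mu> {x} = 1})"
      then obtain x where y: "y = {\<mu> \<in> configs. emeasure \<mu> {x} = 1}" by blast
      have "(\<lambda>\<Xi>. \<Xi> t) -` y \<inter> ?\<Omega> = cylinder {(t, x)}"
        by (auto simp: y cylinder_def occ_def path_space_configs)
      then show "(\<lambda>\<Xi>. \<Xi> t) -` y \<inter> space (sigma ?\<Omega> ?E) \<in> sets (sigma ?\<Omega> ?E)"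
        unfolding sp st by (auto intro: sigma_sets.Basic)
    qed (auto simp: sp path_space_configs)
  next
    show "(\<lambda>\<Xi> t. \<Xi> t) \<in> space (sigma (space (PiM UNIV (\<lambda>_. config_space))) ?E) \<rightarrow> (\<Pi>\<^sub>E i\<in>UNIV. space config_space)"
      unfolding path_space_def[symmetric] sp by (auto simp: space_path_space space_config_space)
  qed
  then have "A \<in> sigma_sets ?\<Omega> ?E" if "A \<in> sets path_space" for A
  proof -
    assume m: "(\<lambda>\<Xi> t. \<Xi> t) \<in> measurable (sigma ?\<Omega> ?E) path_space"
    have "(\<lambda>\<Xi> t. \<Xi> t) -` A \<inter> space (sigma ?\<Omega> ?E) \<in> sets (sigma ?\<Omega> ?E)"
      by (rule measurable_sets[OF m that])
    moreover have "(\<lambda>\<Xi> t. \<Xi> t) -` A \<inter> space (sigma ?\<Omega> ?E) = A"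
      using sets.sets_into_space[OF that] unfolding sp by auto
    ultimately show ?thesis by (simp only: st)
  qed
  moreover have "sigma_sets ?\<Omega> ?E \<subseteq> sets path_space"
    by (rule sets.sigma_sets_subset) (auto intro: cylinder_measurable)
  ultimately show ?thesis by blast
qed

lemma law_eqI:
  assumes P: "prob_space P" "sets P = sets path_space"
    and P': "prob_space P'" "sets P' = sets path_space"
    and eq: "\<And>S. finite S \<Longrightarrow> occ_mean P S = occ_mean P' S"
  shows "P = P'"
proof (rule measure_eqI_generator_eq[where \<Omega> = "space path_space" and E = "cylinder ` {S. finite S}" and A = "\<lambda>_. cylinder {}"])
  interpret P: prob_space P by fact
  interpret P': prob_space P' by fact
  show "Int_stable (cylinder ` {S. finite S})"
  proof (rule Int_stableI_image)
    fix S S' :: "(nat \<times> int) set" assume "S \<in> {S. finite S}" "S' \<in> {S. finite S}"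
    then show "\<exists>k\<in>{S. finite S}. cylinder S \<inter> cylinder S' = cylinder k"
      by (intro bexI[of _ "S \<union> S'"]) (auto simp: cylinder_def)
  qed
  fix X assume "X \<in> cylinder ` {S. finite S}"
  then obtain S where "X = cylinder S" "finite S" by blast
  then show "emeasure P X = emeasure P' X"
    by (simp add: P.emeasure_eq_measure P'.emeasure_eq_measure measure_cylinder P P' eq)
next
  interpret P: prob_space P by fact
  show "emeasure P (cylinder {}) \<noteq> \<infinity>" by simp
qed (use P P' sets_path_space_cylinder in \<open>auto simp: cylinder_def\<close>)

text \<open>The generating functions constrain positive times only, while time 0 is fixed by the
  initial configuration. Because the latter is deterministic, its points factor out and the two
  sources of information combine.\<close>

lemma integral_prod_occ_law:
  assumes P: "is_law_from \<xi> P" and S: "finite S"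
  shows "occ_mean P S =
    (\<Prod>p\<in>{p \<in> S. fst p = 0}. of_bool (emeasure \<xi> {snd p} = 1)) * occ_mean P {p \<in> S. fst p \<noteq> 0}"
proof -
  have ps: "prob_space P" "sets P = sets path_space" and AE: "AE \<Xi> in P. \<Xi> 0 = \<xi>"
    using P by (auto simp: is_law_from_def)
  have m: "occ p \<in> borel_measurable P" for p
    using occ_measurable[of p] by (simp cong: measurable_cong_sets add: ps(2))
  let ?c = "\<Prod>p\<in>{p \<in> S. fst p = 0}. of_bool (emeasure \<xi> {snd p} = 1) :: real"
  have "occ_mean P S = (\<integral>\<Xi>. ?c * (\<Prod>p\<in>{p \<in> S. fst p \<noteq> 0}. occ p \<Xi>) \<partial>P)"
  proof (rule integral_cong_AE)
    show "AE \<Xi> in P. (\<Prod>p\<in>S. occ p \<Xi>) = ?c * (\<Prod>p\<in>{p \<in> S. fst p \<noteq> 0}. occ p \<Xi>)"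
      using AE
    proof eventually_elim
      fix \<Xi> :: "nat \<Rightarrow> int measure" assume \<Xi>: "\<Xi> 0 = \<xi>"
      have "(\<Prod>p\<in>S. occ p \<Xi>) = (\<Prod>p\<in>{p \<in> S. fst p = 0} \<union> {p \<in> S. fst p \<noteq> 0}. occ p \<Xi>)"
        by (rule prod.cong) auto
      also have "\<dots> = (\<Prod>p\<in>{p \<in> S. fst p = 0}. occ p \<Xi>) * (\<Prod>p\<in>{p \<in> S. fst p \<noteq> 0}. occ p \<Xi>)"
        using S by (intro prod.union_disjoint) auto
      also have "(\<Prod>p\<in>{p \<in> S. fst p = 0}. occ p \<Xi>) = ?c"
        by (rule prod.cong) (auto simp: occ_def \<Xi>)
      finally show "(\<Prod>p\<in>S. occ p \<Xi>) = ?c * (\<Prod>p\<in>{p \<in> S. fst p \<noteq> 0}. occ p \<Xi>)" .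
    qed
  qed (intro borel_measurable_prod borel_measurable_times borel_measurable_const m)+
  then show ?thesis by simp
qed

text \<open>Testing with an \<open>f\<close> for which \<open>exp f - 1\<close> is the indicator of
  \<open>S\<close> makes both sides sums over all subsets of \<open>S\<close>. Induction on
  \<open>S\<close> cancels the proper subsets and leaves the term of \<open>S\<close>
  itself.\<close>

lemma correlation_of_determinantal_law:
  assumes P: "prob_space P" "sets P = sets path_space"
    and R: "\<And>S. S \<in> st_subsets {1..} \<Longrightarrow> set_det S (\<lambda>p q. K (fst p) (snd p) (fst q) (snd q)) = of_real (R S)"
    and R01: "\<And>S. S \<in> st_subsets {1..} \<Longrightarrow> 0 \<le> R S \<and> R S \<le> (1 :: real)"
    and law: "determinantal_law K P"
    and S: "finite S" "fst ` S \<subseteq> {1..}"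
  shows "occ_mean P S = R S"
  using S
proof (induction S rule: finite_psubset_induct)
  case (psubset S)
  \<comment> \<open>The time 1 is inserted because an admissible sequence of times is nonempty, also
    when \<open>S\<close> is empty.\<close>
  define A where "A = insert 1 (fst ` S)"
  have A: "finite A" using psubset.hyps by (simp add: A_def)
  define ts where "ts = sorted_list_of_set A"
  define T where "T = Max (set ts)"
  \<comment> \<open>The value \<open>ln 2\<close> makes \<open>exp f - 1\<close> equal to 1 on
    \<open>S\<close> and 0 elsewhere, so the Fredholm expansion terminates.\<close>
  define f where "f t x = (if (t, x) \<in> S then ln 2 else 0 :: real)" for t x
  let ?h = "\<lambda>S'. \<Prod>p\<in>S'. exp (f (fst p) (snd p)) - 1"
  have ts: "set ts = insert 1 (fst ` S)" "distinct ts" "sorted_wrt (<) ts"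
    using A by (simp_all add: ts_def strict_sorted_iff) (simp add: A_def)
  have obs: "observation_times T ts"
  proof -
    have "t \<le> T" if "t \<in> set ts" for t unfolding T_def using that by (intro Max_ge) auto
    moreover have "1 \<le> t" if "t \<in> set ts" for t using that ts(1) psubset.prems by force
    moreover have "ts \<noteq> []" using ts(1) by force
    ultimately show ?thesis using ts(3) by (auto simp: observation_times_def)
  qed
  have sec: "finite {x. (t, x) \<in> S}" for t
    by (rule finite_subset[OF _ finite_imageI[OF psubset.hyps, of snd]]) force
  have fS: "f t summable_on UNIV" for t
  proof -
    have "f t summable_on {x. (t, x) \<in> S}" using sec by (rule summable_on_finite)
    then show ?thesis
      by (rule summable_on_cong_neutral[THEN iffD1, rotated -1]) (auto simp: f_def)
  qed
  have bdd: "bounded (range (f t))" for t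
    by (rule finite_imp_bounded, rule finite_subset[of _ "{ln 2, 0}"]) (auto simp: f_def)
  have "set ts \<subseteq> {1..}" using ts(1) psubset.prems by force
  then have mem: "S' \<in> st_subsets {1..}" if "S' \<in> st_subsets (set ts)" for S' using that by blast
  have conv: "fredholm_convergent ts K (\<lambda>t x. exp (f t x) - 1)"
    by (rule fredholm_convergent_summable[OF ts(2) R[OF mem] R01[OF mem] fS])
  have "complex_of_real (\<integral>\<Xi>. exp (\<Sum>t\<leftarrow>ts. \<integral>x. f t x \<partial>\<Xi> t) \<partial>P) = fredholm_det ts K (\<lambda>t x. exp (f t x) - 1)"
    using law obs bdd conv unfolding determinantal_law_def by blast
  also have "\<dots> = of_real (\<Sum>\<^sub>\<infinity>S'\<in>st_subsets (set ts). ?h S' * R S')"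
    by (rule fredholm_det_eq[OF ts(2) R[OF mem] conv])
  also have "(\<Sum>\<^sub>\<infinity>S'\<in>st_subsets (set ts). ?h S' * R S') = (\<Sum>\<^sub>\<infinity>S'\<in>Pow S. R S')"
  proof (rule infsum_cong_neutral)
    fix S' assume S': "S' \<in> st_subsets (set ts) - Pow S"
    then obtain p where "p \<in> S'" "p \<notin> S" by auto
    then have "?h S' = 0"
      using S' by (intro prod_zero bexI[of _ p]) (auto simp: f_def)
    then show "?h S' * R S' = 0" by simp
  next
    fix S' assume "S' \<in> st_subsets (set ts) \<inter> Pow S"
    then have "?h S' = 1"
      by (intro prod.neutral) (auto simp: f_def)
    then show "?h S' * R S' = R S'" by simp
  next
    fix S' assume S': "S' \<in> Pow S - st_subsets (set ts)"
    then have "S' \<in> st_subsets (set ts)"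
      using ts(1) psubset.hyps by (auto intro: finite_subset)
    then show "R S' = 0" using S' by blast
  qed
  also have "\<dots> = (\<Sum>S'\<in>Pow S. R S')" using psubset.hyps by simp
  also have "(\<integral>\<Xi>. exp (\<Sum>t\<leftarrow>ts. \<integral>x. f t x \<partial>\<Xi> t) \<partial>P) = (\<integral>\<Xi>. (\<Prod>p\<in>S. 1 + 1 * occ p \<Xi>) \<partial>P)"
  proof (rule Bochner_Integration.integral_cong[OF refl])
    fix \<Xi> assume "\<Xi> \<in> space P"
    then have cfg: "\<Xi> t \<in> configs" for t
      using space_eq_path_space[OF P(2)] path_space_configs by simp
    have "(\<integral>x. f t x \<partial>\<Xi> t) = (\<Sum>x\<in>{x. (t, x) \<in> S}. occ (t, x) \<Xi> * ln 2)" for t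
    proof -
      have "(\<integral>x. f t x \<partial>\<Xi> t) = (\<integral>x. occ (t, x) \<Xi> * f t x \<partial>count_space UNIV)"
        by (rule integrable_config(2)[of \<Xi>, OF cfg])
      also have "\<dots> = (\<Sum>x\<in>{x \<in> UNIV. occ (t, x) \<Xi> * f t x \<noteq> 0}. occ (t, x) \<Xi> * f t x)"
        by (rule lebesgue_integral_count_space_finite_support)
          (rule finite_subset[OF _ sec[of t]], auto simp: f_def split: if_splits)
      also have "\<dots> = (\<Sum>x\<in>{x. (t, x) \<in> S}. occ (t, x) \<Xi> * f t x)"
        by (rule sum.mono_neutral_left[OF sec]) (auto simp: f_def split: if_splits)
      also have "\<dots> = (\<Sum>x\<in>{x. (t, x) \<in> S}. occ (t, x) \<Xi> * ln 2)"
        by (rule sum.cong) (auto simp: f_def)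
      finally show ?thesis .
    qed
    then have "(\<Sum>t\<leftarrow>ts. \<integral>x. f t x \<partial>\<Xi> t) = (\<Sum>t\<in>set ts. \<Sum>x\<in>{x. (t, x) \<in> S}. occ (t, x) \<Xi> * ln 2)"
      by (simp add: sum_list_distinct_conv_sum_set ts(2))
    also have "\<dots> = (\<Sum>(t, x)\<in>Sigma (set ts) (\<lambda>t. {x. (t, x) \<in> S}). occ (t, x) \<Xi> * ln 2)"
      by (rule sum.Sigma) (use sec in auto)
    also have "Sigma (set ts) (\<lambda>t. {x. (t, x) \<in> S}) = S" using ts(1) by force
    finally have "exp (\<Sum>t\<leftarrow>ts. \<integral>x. f t x \<partial>\<Xi> t) = (\<Prod>p\<in>S. exp (occ p \<Xi> * ln 2))"
      using psubset.hyps by (simp add: exp_sum case_prod_unfold)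
    also have "\<dots> = (\<Prod>p\<in>S. 1 + 1 * occ p \<Xi>)"
      using occ_01 by (intro prod.cong refl) (metis (full_types) exp_ln exp_zero mult_1 mult_zero_left
        one_add_one add_0_right zero_less_numeral)
    finally show "exp (\<Sum>t\<leftarrow>ts. \<integral>x. f t x \<partial>\<Xi> t) = (\<Prod>p\<in>S. 1 + 1 * occ p \<Xi>)" .
  qed
  also have "\<dots> = (\<Sum>S'\<in>Pow S. \<integral>\<Xi>. (\<Prod>p\<in>S'. occ p \<Xi>) \<partial>P)"
    unfolding integral_prod_one_plus_occ(2)[OF P psubset.hyps] by simp
  finally have eq: "(\<Sum>S'\<in>Pow S. \<integral>\<Xi>. (\<Prod>p\<in>S'. occ p \<Xi>) \<partial>P) = (\<Sum>S'\<in>Pow S. R S')"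
    by (simp only: of_real_eq_iff)
  have "(\<Sum>S'\<in>Pow S - {S}. \<integral>\<Xi>. (\<Prod>p\<in>S'. occ p \<Xi>) \<partial>P) = (\<Sum>S'\<in>Pow S - {S}. R S')"
    by (intro sum.cong refl psubset.IH) (use psubset.prems in auto)
  then show ?case
    using eq psubset.hyps sum.remove[of "Pow S" S "\<lambda>S'. \<integral>\<Xi>. (\<Prod>p\<in>S'. occ p \<Xi>) \<partial>P"]
      sum.remove[of "Pow S" S R] by simp
qed

theorem determinantal_law_unique:
  assumes P: "is_law_from \<xi> P" "determinantal_law K P" and P': "is_law_from \<xi> P'" "determinantal_law K P'"
    and R: "\<And>S. S \<in> st_subsets {1..} \<Longrightarrow> set_det S (\<lambda>p q. K (fst p) (snd p) (fst q) (snd q)) = of_real (R S)"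
    and R01: "\<And>S. S \<in> st_subsets {1..} \<Longrightarrow> 0 \<le> R S \<and> R S \<le> (1 :: real)"
  shows "P = P'"
proof -
  have ps: "prob_space P" "sets P = sets path_space" "prob_space P'" "sets P' = sets path_space"
    using P P' by (auto simp: is_law_from_def)
  show ?thesis
  proof (rule law_eqI[OF ps])
    fix S :: "(nat \<times> int) set" assume S: "finite S"
    let ?S = "{p \<in> S. fst p \<noteq> 0}"
    have S': "finite ?S" "fst ` ?S \<subseteq> {1..}" using S by auto
    show "occ_mean P S = occ_mean P' S"
    proof -
      have "occ_mean P ?S = R ?S" "occ_mean P' ?S = R ?S"
        by (rule correlation_of_determinantal_law[OF ps(1,2) R R01 P(2) S'],
            assumption, assumption, rule correlation_of_determinantal_law[OF ps(3,4) R R01 P'(2) S'])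
      then show ?thesis
        unfolding integral_prod_occ_law[OF P(1) S] integral_prod_occ_law[OF P'(1) S] by simp
    qed
  qed
qed

section \<open>Existence of the law\<close>

text \<open>\<open>excl R F S\<close> is the probability that the occupied points in \<open>F\<close> are exactly those of \<open>S\<close>,
  written by inclusion-exclusion in terms of the correlations \<open>R\<close>.\<close>

definition excl :: "('i set \<Rightarrow> real) \<Rightarrow> 'i set \<Rightarrow> 'i set \<Rightarrow> real" where
  "excl R F S = (\<Sum>S' | S \<subseteq> S' \<and> S' \<subseteq> F. (-1) ^ card (S' - S) * R S')"

lemma finite_interval_sets: "finite F \<Longrightarrow> finite {S'. S \<subseteq> S' \<and> S' \<subseteq> F}"
  by (rule finite_subset[of _ "Pow F"]) auto

lemma excl_self: "excl R F F = R F"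
proof -
  have "{S'. F \<subseteq> S' \<and> S' \<subseteq> F} = {F}" by auto
  then show ?thesis by (simp add: excl_def)
qed

text \<open>The point \<open>p\<close> is either empty or occupied. In the first sum, the sets
  containing \<open>p\<close> carry one extra sign and cancel against the second sum.\<close>

lemma excl_insert:
  assumes F: "finite F" "p \<notin> F" "S \<subseteq> F"
  shows "excl R (insert p F) S + excl R (insert p F) (insert p S) = excl R F S"
proof -
  let ?I = "{S'. S \<subseteq> S' \<and> S' \<subseteq> F}"
  have inj: "inj_on (insert p) ?I" using F(2) by (auto simp: inj_on_def)
  have fin: "finite ?I" by (rule finite_interval_sets[OF F(1)])
  have np: "p \<notin> S'" "p \<notin> S" "finite S'" if "S' \<in> ?I" for S'
    using that F by (auto intro: finite_subset)
  have split: "{S'. S \<subseteq> S' \<and> S' \<subseteq> insert p F} = ?I \<union> insert p ` ?I"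
  proof (intro equalityI subsetI)
    fix S' assume S': "S' \<in> {S'. S \<subseteq> S' \<and> S' \<subseteq> insert p F}"
    show "S' \<in> ?I \<union> insert p ` ?I"
    proof (cases "p \<in> S'")
      case True
      then have "S' = insert p (S' - {p})" "S' - {p} \<in> ?I" using S' F by auto
      then show ?thesis by blast
    qed (use S' in auto)
  qed auto
  have ins: "{S'. insert p S \<subseteq> S' \<and> S' \<subseteq> insert p F} = insert p ` ?I"
  proof (intro equalityI subsetI)
    fix S' assume S': "S' \<in> {S'. insert p S \<subseteq> S' \<and> S' \<subseteq> insert p F}"
    then have "S' = insert p (S' - {p})" "S' - {p} \<in> ?I" using F by auto
    then show "S' \<in> insert p ` ?I" by blast
  qed auto
  have disj: "?I \<inter> insert p ` ?I = {}" using F(2) by auto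
  have "excl R (insert p F) S = excl R F S + (\<Sum>S'\<in>?I. (-1) ^ card (insert p S' - S) * R (insert p S'))"
    unfolding excl_def split
    by (subst sum.union_disjoint[OF fin finite_imageI[OF fin] disj]) (simp add: sum.reindex[OF inj] comp_def)
  also have "(\<Sum>S'\<in>?I. (-1) ^ card (insert p S' - S) * R (insert p S')) =
      - (\<Sum>S'\<in>?I. (-1) ^ card (S' - S) * R (insert p S'))"
    unfolding sum_negf[symmetric]
  proof (intro sum.cong refl)
    fix S' assume "S' \<in> ?I"
    note n = np[OF this]
    have "insert p S' - S = insert p (S' - S)" using n by auto
    then have "card (insert p S' - S) = Suc (card (S' - S))" using n by simp
    then show "(-1) ^ card (insert p S' - S) * R (insert p S') = - ((-1) ^ card (S' - S) * R (insert p S'))" by simp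
  qed
  also have "(\<Sum>S'\<in>?I. (-1) ^ card (S' - S) * R (insert p S')) = excl R (insert p F) (insert p S)"
    unfolding excl_def ins sum.reindex[OF inj] comp_def
  proof (intro sum.cong refl)
    fix S' assume "S' \<in> ?I"
    note n = np[OF this]
    have "insert p S' - insert p S = S' - S" using n by auto
    then show "(-1) ^ card (S' - S) * R (insert p S') = (-1) ^ card (insert p S' - insert p S) * R (insert p S')" by simp
  qed
  finally show ?thesis by simp
qed

lemma sum_excl: "finite F \<Longrightarrow> (\<Sum>S\<in>Pow F. excl R F S) = R {}"
proof (induction F rule: finite_induct)
  case empty
  then show ?case using excl_self[of R "{}"] by simp
next
  case (insert p F)
  have inj: "inj_on (insert p) (Pow F)" using insert by (auto simp: inj_on_def)
  have "(\<Sum>S\<in>Pow (insert p F). excl R (insert p F) S) =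
      (\<Sum>S\<in>Pow F. excl R (insert p F) S) + (\<Sum>S\<in>insert p ` Pow F. excl R (insert p F) S)"
    unfolding Pow_insert using insert by (intro sum.union_disjoint) auto
  also have "\<dots> = (\<Sum>S\<in>Pow F. excl R (insert p F) S + excl R (insert p F) (insert p S))"
    by (simp add: sum.reindex[OF inj] sum.distrib)
  also have "\<dots> = (\<Sum>S\<in>Pow F. excl R F S)"
    using insert by (intro sum.cong refl excl_insert) auto
  finally show ?case using insert by simp
qed

text \<open>Weights \<open>y\<close> on \<open>S\<close> and \<open>0\<close> on \<open>F - S\<close> give a nonnegative polynomial in \<open>y\<close> whose coefficient
  of the top power is \<open>excl R F S\<close>.\<close>

lemma excl_nonneg:
  assumes F: "finite F" and S: "S \<subseteq> F"
    and pos: "\<And>y. (\<And>p. y p \<ge> 0) \<Longrightarrow> (\<Sum>S\<in>Pow F. (\<Prod>p\<in>S. y p - 1) * R S) \<ge> (0 :: real)"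
  shows "excl R F S \<ge> 0"
proof -
  have fS: "finite S" using F S by (rule finite_subset[rotated])
  let ?W = "\<lambda>y p. (if p \<in> S then y else 0) - 1 :: real"
  \<comment> \<open>\<open>?G\<close> is a summand divided by \<open>y ^ card S\<close>. As
    \<open>y\<close> grows it tends to \<open>?H\<close>, where \<open>0 ^ 0 = 1\<close> retains
    exactly the sets that contain \<open>S\<close>.\<close>
  let ?G = "\<lambda>y S'. ((y - 1) / y) ^ card (S' \<inter> S) * (1 / y) ^ (card S - card (S' \<inter> S)) * ((-1) ^ card (S' - S) * R S')"
  let ?H = "\<lambda>S'. 1 ^ card (S' \<inter> S) * 0 ^ (card S - card (S' \<inter> S)) * ((-1) ^ card (S' - S) * R S')"
  define g where "g y = (\<Sum>S'\<in>Pow F. ?G y S')" for y :: real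
  have g: "g y \<ge> 0" if "y > 0" for y
  proof -
    have "0 \<le> (\<Sum>S'\<in>Pow F. prod (?W y) S' * R S')"
      by (rule pos) (use that in auto)
    also have "\<dots> = (\<Sum>S'\<in>Pow F. y ^ card S * ?G y S')"
    proof (intro sum.cong refl)
      fix S' assume "S' \<in> Pow F"
      then have fS': "finite S'" using F by (auto intro: finite_subset)
      have "prod (?W y) S' = prod (?W y) (S' \<inter> S \<union> (S' - S))"
        by (rule prod.cong) auto
      also have "\<dots> = prod (?W y) (S' \<inter> S) * prod (?W y) (S' - S)"
        using fS' by (intro prod.union_disjoint) auto
      also have "prod (?W y) (S' \<inter> S) = (y - 1) ^ card (S' \<inter> S)" by simp
      also have "prod (?W y) (S' - S) = (-1) ^ card (S' - S)" by simp
      also have "(y - 1) ^ card (S' \<inter> S) = y ^ card S * (((y - 1) / y) ^ card (S' \<inter> S) * (1 / y) ^ (card S - card (S' \<inter> S)))"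
      proof -
        have "card (S' \<inter> S) \<le> card S" using fS by (intro card_mono) auto
        then have "y ^ card S = y ^ card (S' \<inter> S) * y ^ (card S - card (S' \<inter> S))"
          by (simp flip: power_add)
        then show ?thesis using that by (simp add: power_divide)
      qed
      finally show "prod (?W y) S' * R S' =
        y ^ card S * ?G y S'"
        by (simp add: mult_ac)
    qed
    also have "\<dots> = y ^ card S * g y" by (simp add: g_def sum_distrib_left)
    finally show ?thesis using that by (metis mult_pos_neg not_le zero_less_power)
  qed
  have l1: "((\<lambda>y::real. (y - 1) / y) \<longlongrightarrow> 1) at_top" by (real_asymp)
  have l2: "((\<lambda>y::real. 1 / y) \<longlongrightarrow> 0) at_top" by (real_asymp)
  have "(g \<longlongrightarrow> (\<Sum>S'\<in>Pow F. ?H S')) at_top"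
    unfolding g_def[abs_def] by (intro tendsto_sum tendsto_mult tendsto_power l1 l2 tendsto_const)
  also have "(\<Sum>S'\<in>Pow F. ?H S') = excl R F S"
    unfolding excl_def
  proof (rule sum.mono_neutral_cong_right)
    show "\<forall>S'\<in>Pow F - {S'. S \<subseteq> S' \<and> S' \<subseteq> F}. ?H S' = 0"
    proof
      fix S' assume "S' \<in> Pow F - {S'. S \<subseteq> S' \<and> S' \<subseteq> F}"
      then have "S' \<inter> S \<subset> S" by auto
      then have "card (S' \<inter> S) < card S" by (rule psubset_card_mono[OF fS])
      then show "?H S' = 0"
        by (simp add: power_0_left)
    qed
    fix S' assume "S' \<in> {S'. S \<subseteq> S' \<and> S' \<subseteq> F}"
    then have "S' \<inter> S = S" by auto
    then show "?H S' = (-1) ^ card (S' - S) * R S'"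
      by simp
  qed (use F in auto)
  finally have lim: "(g \<longlongrightarrow> excl R F S) at_top" .
  show ?thesis
    by (rule tendsto_lowerbound[OF lim eventually_mono[OF eventually_gt_at_top[of 0] g]]) auto
qed

text \<open>If \<open>R\<close> consists of the means of products of occupation numbers, the sum in
  \<open>R_pos\<close> is the mean of the product of the weights \<open>y p\<close> over the
  occupied points of \<open>F\<close>. Normalisation and positivity of these generating functions
  are all that the construction of a law uses.\<close>

locale correlations =
  fixes R :: "(nat \<times> int) set \<Rightarrow> real"
  assumes R_empty: "R {} = 1"
    and R_pos: "\<And>F y. F \<in> st_subsets {1..} \<Longrightarrow> (\<And>p. y p \<ge> 0) \<Longrightarrow> (\<Sum>S\<in>Pow F. (\<Prod>p\<in>S. y p - 1) * R S) \<ge> 0"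
begin

abbreviation sites :: "(nat \<times> int) set" where "sites \<equiv> {1..} \<times> UNIV"

lemma st_subsets_sites: "F \<in> st_subsets {1..} \<longleftrightarrow> finite F \<and> F \<subseteq> sites"
  by force

section \<open>Laws on finite sets of points and their Kolmogorov extension\<close>

definition occ_pmf :: "(nat \<times> int) set \<Rightarrow> (nat \<times> int) set pmf" where
  "occ_pmf F = embed_pmf (\<lambda>S. if S \<subseteq> F then excl R F S else 0)"

lemma pmf_occ_pmf:
  assumes F: "finite F" "F \<subseteq> sites"
  shows "pmf (occ_pmf F) S = (if S \<subseteq> F then excl R F S else 0)"
  unfolding occ_pmf_def
proof (rule pmf_embed_pmf)
  have nn: "excl R F S \<ge> 0" if "S \<subseteq> F" for S
    using F that st_subsets_sites by (intro excl_nonneg R_pos) auto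
  then show "0 \<le> (if S \<subseteq> F then excl R F S else 0)" for S by simp
  have "(\<integral>\<^sup>+S. ennreal (if S \<subseteq> F then excl R F S else 0) \<partial>count_space UNIV) =
      (\<Sum>S\<in>Pow F. ennreal (if S \<subseteq> F then excl R F S else 0))"
    using F(1) by (intro nn_integral_count_space') auto
  also have "\<dots> = (\<Sum>S\<in>Pow F. ennreal (excl R F S))" by (intro sum.cong) auto
  also have "\<dots> = ennreal (\<Sum>S\<in>Pow F. excl R F S)" using nn by (intro sum_ennreal) auto
  also have "\<dots> = 1" by (simp add: sum_excl[OF F(1)] R_empty)
  finally show "(\<integral>\<^sup>+S. ennreal (if S \<subseteq> F then excl R F S else 0) \<partial>count_space UNIV) = 1" .
qed

text \<open>A subset of \<open>F\<close> arises from two subsets of \<open>insert p F\<close>,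
  without and with \<open>p\<close>, and \<open>excl_insert\<close> adds their weights: Kolmogorov
  consistency for one removed point.\<close>

lemma map_occ_pmf_insert:
  assumes F: "finite F" "insert p F \<subseteq> sites" and p: "p \<notin> F"
  shows "map_pmf (\<lambda>S. S \<inter> F) (occ_pmf (insert p F)) = occ_pmf F"
proof (rule pmf_eqI)
  fix S
  have pI: "pmf (occ_pmf (insert p F)) S' = (if S' \<subseteq> insert p F then excl R (insert p F) S' else 0)" for S'
    using F by (intro pmf_occ_pmf) auto
  have pF: "pmf (occ_pmf F) S = (if S \<subseteq> F then excl R F S else 0)"
    using F by (intro pmf_occ_pmf) auto
  show "pmf (map_pmf (\<lambda>S. S \<inter> F) (occ_pmf (insert p F))) S = pmf (occ_pmf F) S"
  proof (cases "S \<subseteq> F")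
    case True
    have "pmf (map_pmf (\<lambda>S. S \<inter> F) (occ_pmf (insert p F))) S =
        measure (measure_pmf (occ_pmf (insert p F))) ((\<lambda>S. S \<inter> F) -` {S})"
      by (rule pmf_map)
    also have "\<dots> = measure (measure_pmf (occ_pmf (insert p F))) {S, insert p S}"
    proof (rule measure_prob_cong_0)
      fix S' assume "S' \<in> (\<lambda>S. S \<inter> F) -` {S} - {S, insert p S}"
      then have "\<not> S' \<subseteq> insert p F" by auto
      then show "pmf (occ_pmf (insert p F)) S' = 0" by (simp add: pI)
    qed (use True p in auto)
    also have "\<dots> = pmf (occ_pmf (insert p F)) S + pmf (occ_pmf (insert p F)) (insert p S)"
    proof -
      have "S \<noteq> insert p S" using True p by auto
      then show ?thesis by (subst measure_measure_pmf_finite) auto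
    qed
    also have "\<dots> = excl R F S"
      using True p F by (simp add: pI excl_insert subset_insertI2 insert_mono)
    finally show ?thesis using True by (simp add: pF)
  next
    case False
    then have "(\<lambda>S. S \<inter> F) -` {S} = {}" by auto
    then show ?thesis using False by (simp add: pmf_map pF)
  qed
qed

lemma map_occ_pmf:
  assumes "finite H" "H \<subseteq> sites" "J \<subseteq> H"
  shows "map_pmf (\<lambda>S. S \<inter> J) (occ_pmf H) = occ_pmf J"
proof -
  have fin: "finite J" "finite (H - J)" using assms by (auto intro: finite_subset)
  have "J \<union> D \<subseteq> sites \<Longrightarrow> J \<inter> D = {} \<Longrightarrow> map_pmf (\<lambda>S. S \<inter> J) (occ_pmf (J \<union> D)) = occ_pmf J" if "finite D" for D
    using that
  proof (induction D rule: finite_induct)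
    case empty
    have "S \<inter> J = S" if "S \<in> set_pmf (occ_pmf J)" for S
    proof -
      have "S \<subseteq> J" using that empty fin(1) pmf_occ_pmf[of J S] by (auto simp: set_pmf_iff split: if_splits)
      then show ?thesis by auto
    qed
    then have "map_pmf (\<lambda>S. S \<inter> J) (occ_pmf J) = map_pmf id (occ_pmf J)"
      by (intro map_pmf_cong) auto
    then show ?case by simp
  next
    case (insert p D)
    have "map_pmf (\<lambda>S. S \<inter> J) (occ_pmf (insert p (J \<union> D))) =
        map_pmf (\<lambda>S. S \<inter> J) (map_pmf (\<lambda>S. S \<inter> (J \<union> D)) (occ_pmf (insert p (J \<union> D))))"
      unfolding map_pmf_comp by (intro map_pmf_cong refl) auto
    also have "map_pmf (\<lambda>S. S \<inter> (J \<union> D)) (occ_pmf (insert p (J \<union> D))) = occ_pmf (J \<union> D)"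
      using insert fin by (intro map_occ_pmf_insert) auto
    finally show ?case using insert by simp
  qed
  from this[OF fin(2)] assms show ?thesis by (simp add: Un_absorb1)
qed

text \<open>Occupied sets are coded by real functions with values 0 and 1, because the projective
  limit is taken over products of Borel spaces of a Polish type.\<close>

definition occ_fun :: "(nat \<times> int) set \<Rightarrow> (nat \<times> int) set \<Rightarrow> nat \<times> int \<Rightarrow> real" where
  "occ_fun J S = (\<lambda>p\<in>J. of_bool (p \<in> S))"

definition occ_distr :: "(nat \<times> int) set \<Rightarrow> (nat \<times> int \<Rightarrow> real) measure" where
  "occ_distr J = distr (measure_pmf (occ_pmf J)) (PiM J (\<lambda>_. borel)) (occ_fun J)"

lemma occ_fun_measurable: "occ_fun J \<in> measurable (measure_pmf M) (PiM J (\<lambda>_. borel))"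
  by (auto simp: occ_fun_def space_PiM)

lemma polish_projective_occ: "polish_projective sites occ_distr"
proof (intro polish_projective.intro projective_family.intro)
  fix J H :: "(nat \<times> int) set" assume JH: "J \<subseteq> H" "finite H" "H \<subseteq> sites"
  have r: "(\<lambda>f. restrict f J) \<in> measurable (PiM H (\<lambda>_. borel)) (PiM J (\<lambda>_. borel :: real measure))"
    using JH by (intro measurable_restrict_subset)
  have "occ_distr J = distr (distr (measure_pmf (occ_pmf H)) (count_space UNIV) (\<lambda>S. S \<inter> J)) (PiM J (\<lambda>_. borel)) (occ_fun J)"
    unfolding occ_distr_def map_pmf_rep_eq[symmetric] using map_occ_pmf[OF JH(2,3,1)] by simp
  also have "\<dots> = distr (measure_pmf (occ_pmf H)) (PiM J (\<lambda>_. borel)) (occ_fun J \<circ> (\<lambda>S. S \<inter> J))"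
    by (rule distr_distr) (auto simp: occ_fun_def space_PiM)
  also have "occ_fun J \<circ> (\<lambda>S. S \<inter> J) = (\<lambda>f. restrict f J) \<circ> occ_fun H"
    using JH(1) by (auto simp: occ_fun_def fun_eq_iff restrict_def)
  also have "distr (measure_pmf (occ_pmf H)) (PiM J (\<lambda>_. borel)) ((\<lambda>f. restrict f J) \<circ> occ_fun H) =
      distr (occ_distr H) (PiM J (\<lambda>_. borel)) (\<lambda>f. restrict f J)"
    unfolding occ_distr_def by (rule distr_distr[OF r occ_fun_measurable, symmetric])
  finally show "occ_distr J = distr (occ_distr H) (PiM J (\<lambda>_. borel)) (\<lambda>f. restrict f J)" .
next
  fix J :: "(nat \<times> int) set"
  show "prob_space (occ_distr J)"
    unfolding occ_distr_def by (rule prob_space.prob_space_distr[OF measure_pmf.prob_space_axioms occ_fun_measurable])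
qed

text \<open>Time 0 is set to \<open>\<xi>\<close> by hand. Any value other than 1 is read as an
  empty site, so every \<open>\<omega>\<close> yields configurations and no null set has to be
  removed.\<close>

definition path_of :: "int measure \<Rightarrow> (nat \<times> int \<Rightarrow> real) \<Rightarrow> nat \<Rightarrow> int measure" where
  "path_of \<xi> \<omega> t = (if t = 0 then \<xi> else density (count_space UNIV) (\<lambda>x. ennreal (of_bool (\<omega> (t, x) = 1))))"

lemma emeasure_path_of: "t \<noteq> 0 \<Longrightarrow> emeasure (path_of \<xi> \<omega> t) {x} = of_bool (\<omega> (t, x) = 1)"
proof -
  assume "t \<noteq> 0"
  then have "emeasure (path_of \<xi> \<omega> t) {x} =
      (\<integral>\<^sup>+y. ennreal (of_bool (\<omega> (t, y) = 1)) * indicator {x} y \<partial>count_space UNIV)"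
    by (simp add: path_of_def emeasure_density)
  also have "\<dots> = ennreal (of_bool (\<omega> (t, x) = 1))"
    by (subst nn_integral_count_space'[of "{x}"]) auto
  finally show ?thesis by auto
qed

lemma path_of_configs: "\<xi> \<in> configs \<Longrightarrow> path_of \<xi> \<omega> t \<in> configs"
  by (cases "t = 0") (auto simp: configs_def emeasure_path_of, auto simp: path_of_def)

lemma path_of_measurable:
  assumes xi: "\<xi> \<in> configs"
  shows "path_of \<xi> \<in> measurable (PiM sites (\<lambda>_. borel)) path_space"
  unfolding path_space_def
proof (rule measurable_PiM_single')
  fix t
  show "(\<lambda>\<omega>. path_of \<xi> \<omega> t) \<in> measurable (PiM sites (\<lambda>_. borel)) config_space"
    unfolding config_space_def
  proof (rule measurable_measure_of)
    fix y assume "y \<in> range (\<lambda>x. {\<mu> \<in> configs. emeasure \<mu> {x} = 1})"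
    then obtain x where y: "y = {\<mu> \<in> configs. emeasure \<mu> {x} = 1}" by blast
    let ?B = "PiM sites (\<lambda>_. borel :: real measure)"
    show "(\<lambda>\<omega>. path_of \<xi> \<omega> t) -` y \<inter> space ?B \<in> sets ?B"
    proof (cases "t = 0")
      case True
      then have "(\<lambda>\<omega>. path_of \<xi> \<omega> t) -` y \<inter> space ?B = (if \<xi> \<in> y then space ?B else {})"
        by (auto simp: path_of_def)
      then show ?thesis by simp
    next
      case False
      then have "(t, x) \<in> sites" by auto
      then have "(\<lambda>\<omega>. \<omega> (t, x)) \<in> borel_measurable ?B" by (rule measurable_component_singleton)
      then have "(\<lambda>\<omega>. \<omega> (t, x)) -` {1} \<inter> space ?B \<in> sets ?B"
        by (rule measurable_sets) simp
      moreover have "(\<lambda>\<omega>. path_of \<xi> \<omega> t) -` y \<inter> space ?B = (\<lambda>\<omega>. \<omega> (t, x)) -` {1} \<inter> space ?B"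
        using False by (auto simp: y path_of_configs[OF xi] emeasure_path_of split: if_splits)
      ultimately show ?thesis by simp
    qed
  qed (auto simp: path_of_configs[OF xi])
qed (auto simp: path_of_configs[OF xi] space_config_space)

theorem law_exists:
  assumes xi: "\<xi> \<in> configs"
  shows "\<exists>P. is_law_from \<xi> P \<and> (\<forall>S\<in>st_subsets {1..}. occ_mean P S = R S)"
proof -
  interpret L: polish_projective sites occ_distr by (rule polish_projective_occ)
  define P where "P = distr L.lim path_space (path_of \<xi>)"
  have sl: "sets L.lim = sets (PiM sites (\<lambda>_. borel))" by (rule L.sets_lim)
  have m: "path_of \<xi> \<in> measurable L.lim path_space"
    using path_of_measurable[OF xi] unfolding measurable_cong_sets[OF sl refl] .
  have ps: "prob_space P" unfolding P_def by (rule L.P.prob_space_distr[OF m])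
  have sP: "sets P = sets path_space" by (simp add: P_def)
  \<comment> \<open>The event \<open>\<Xi> 0 = \<xi>\<close> is measurable because it amounts to
    countably many conditions on single sites.\<close>
  have meas: "{\<Xi> \<in> space path_space. \<forall>x. occ (0, x) \<Xi> = of_bool (emeasure \<xi> {x} = 1)} \<in> sets path_space"
    by measurable
  have eq: "{\<Xi> \<in> space path_space. \<forall>x. occ (0, x) \<Xi> = of_bool (emeasure \<xi> {x} = 1)} =
      {\<Xi> \<in> space path_space. \<Xi> 0 = \<xi>}"
  proof (intro Collect_cong conj_cong refl iffI)
    fix \<Xi> assume \<Xi>: "\<Xi> \<in> space path_space" and o: "\<forall>x. occ (0, x) \<Xi> = of_bool (emeasure \<xi> {x} = 1)"
    have "(emeasure (\<Xi> 0) {x} = 1) = (emeasure \<xi> {x} = 1)" for x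
      using o[rule_format, of x] unfolding occ_def of_bool_eq_iff by simp
    then show "\<Xi> 0 = \<xi>"
      using config_density[OF path_space_configs[OF \<Xi>, of 0]] config_density[OF xi] by simp
  qed (auto simp: occ_def)
  have "AE \<Xi> in P. \<Xi> 0 = \<xi>"
    unfolding P_def using meas m by (subst AE_distr_iff) (auto simp: eq path_of_def)
  then have law: "is_law_from \<xi> P" using ps sP by (simp add: is_law_from_def)
  have "occ_mean P S = R S" if S: "S \<in> st_subsets {1..}" for S
  proof -
    have fin: "finite S" "S \<subseteq> sites" using S st_subsets_sites by auto
    let ?X = "{x \<in> space (PiM S (\<lambda>_. borel)). \<forall>p\<in>S. x p = (1 :: real)}"
    have X: "?X \<in> sets (PiM S (\<lambda>_. borel))" using fin by measurable
    have nz: "fst p \<noteq> 0" if "p \<in> S" for p using fin(2) that by auto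
    have mo: "occ p \<in> borel_measurable path_space" for p by simp
    have sp: "space L.lim = space (PiM sites (\<lambda>_. borel))" by (rule sets_eq_imp_space_eq[OF sl])
    have "occ_mean P S = (\<integral>\<omega>. (\<Prod>p\<in>S. occ p (path_of \<xi> \<omega>)) \<partial>L.lim)"
      unfolding P_def by (rule integral_distr[OF m]) measurable
    also have "\<dots> = (\<integral>\<omega>. indicator (prod_emb sites (\<lambda>_. borel) S ?X) \<omega> \<partial>L.lim)"
    proof (rule Bochner_Integration.integral_cong[OF refl])
      fix \<omega> assume w: "\<omega> \<in> space L.lim"
      have "(\<Prod>p\<in>S. occ p (path_of \<xi> \<omega>)) = (\<Prod>p\<in>S. of_bool (\<omega> p = 1))"
        by (intro prod.cong refl) (auto simp: occ_def emeasure_path_of nz)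
      also have "\<dots> = of_bool (\<forall>p\<in>S. \<omega> p = 1)"
        using fin(1) by (induction S rule: finite_induct) auto
      also have "\<dots> = indicator (prod_emb sites (\<lambda>_. borel) S ?X) \<omega>"
        using w[unfolded sp] fin(2) by (auto simp: prod_emb_def space_PiM indicator_def)
      finally show "(\<Prod>p\<in>S. occ p (path_of \<xi> \<omega>)) = indicator (prod_emb sites (\<lambda>_. borel) S ?X) \<omega>" .
    qed
    also have "\<dots> = measure L.lim (prod_emb sites (\<lambda>_. borel) S ?X)"
    proof -
      have "prod_emb sites (\<lambda>_. borel) S ?X \<inter> space L.lim = prod_emb sites (\<lambda>_. borel) S ?X"
        unfolding sp by (auto simp: prod_emb_def space_PiM)
      then show ?thesis by simp
    qed
    also have "\<dots> = measure (occ_distr S) ?X"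
      by (rule L.measure_lim_emb[OF fin(2,1) X])
    also have "\<dots> = measure (measure_pmf (occ_pmf S)) (occ_fun S -` ?X \<inter> space (measure_pmf (occ_pmf S)))"
      unfolding occ_distr_def by (rule measure_distr[OF occ_fun_measurable X])
    also have "\<dots> = measure (measure_pmf (occ_pmf S)) {S}"
    proof (rule measure_prob_cong_0)
      fix S' assume "S' \<in> occ_fun S -` ?X \<inter> space (measure_pmf (occ_pmf S)) - {S}"
      then have "S \<subseteq> S'" "S' \<noteq> S" by (auto simp: occ_fun_def split: if_splits)
      then show "pmf (occ_pmf S) S' = 0" by (auto simp: pmf_occ_pmf[OF fin])
    qed (auto simp: occ_fun_def space_PiM)
    also have "\<dots> = R S"
      by (simp add: measure_measure_pmf_finite pmf_occ_pmf[OF fin] excl_self)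
    finally show ?thesis .
  qed
  then show ?thesis using law by blast
qed

end

section \<open>The noncolliding walk from the equidistant configuration\<close>

definition st_correlation :: "int \<Rightarrow> (nat \<times> int) set \<Rightarrow> real" where
  "st_correlation a S = Re (set_det S (st_kernel a))"

text \<open>With all weights equal to 2 the expansion is the plain sum of the minors over all
  subsets, which is nonnegative and hence real. Induction removes the minors of the proper
  subsets.\<close>

lemma set_det_st_kernel_real:
  assumes a: "a \<ge> 2" and S: "S \<in> st_subsets {1..}"
  shows "set_det S (st_kernel a) = of_real (st_correlation a S)"
proof -
  have "finite S \<Longrightarrow> fst ` S \<subseteq> {1..} \<Longrightarrow> set_det S (st_kernel a) \<in> \<real>" for S
  proof (induction S rule: finite_psubset_induct)
    case (psubset S)
    have "(\<Sum>S'\<in>Pow S. of_real (\<Prod>p\<in>S'. 2 - 1) * set_det S' (st_kernel a)) \<in> \<real>\<^sub>\<ge>\<^sub>0"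
      by (rule st_kernel_expansion_nonneg[OF a psubset.hyps]) (use psubset.prems in auto)
    then have "(\<Sum>S'\<in>Pow S. set_det S' (st_kernel a)) \<in> \<real>" by auto
    moreover have "(\<Sum>S'\<in>Pow S - {S}. set_det S' (st_kernel a)) \<in> \<real>"
      by (intro sum_in_Reals psubset.IH) (use psubset.prems in auto)
    moreover have "set_det S (st_kernel a) =
        (\<Sum>S'\<in>Pow S. set_det S' (st_kernel a)) - (\<Sum>S'\<in>Pow S - {S}. set_det S' (st_kernel a))"
      using psubset.hyps by (subst sum.remove[of _ S]) auto
    ultimately show ?case by (simp only: Reals_diff)
  qed
  then show ?thesis using S by (simp add: st_correlation_def)
qed

lemma correlations_st:
  assumes a: "a \<ge> 2"
  shows "correlations (st_correlation a)"
proof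
  show "st_correlation a {} = 1" by (simp add: st_correlation_def set_det_def)
  fix F :: "(nat \<times> int) set" and y :: "nat \<times> int \<Rightarrow> real"
  assume F: "F \<in> st_subsets {1..}" and y: "\<And>p. y p \<ge> 0"
  have "(\<Sum>S\<in>Pow F. of_real (\<Prod>p\<in>S. y p - 1) * set_det S (st_kernel a)) \<in> \<real>\<^sub>\<ge>\<^sub>0"
    by (rule st_kernel_expansion_nonneg[OF a]) (use F y in auto)
  then have "0 \<le> Re (\<Sum>S\<in>Pow F. of_real (\<Prod>p\<in>S. y p - 1) * set_det S (st_kernel a))"
    by (simp only: complex_nonneg_Reals_iff)
  then show "0 \<le> (\<Sum>S\<in>Pow F. (\<Prod>p\<in>S. y p - 1) * st_correlation a S)"
    by (simp add: st_correlation_def del: of_real_prod)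
qed

lemma equidistant_config_configs:
  assumes "a > 0"
  shows "equidistant_config a \<in> configs"
proof -
  have "emeasure (equidistant_config a) {x} \<in> {0, 1}" for x
  proof -
    have e: "emeasure (equidistant_config a) {x} = emeasure (count_space UNIV) ((\<lambda>k. 2 * a * k) -` {x})"
      unfolding equidistant_config_def by (subst emeasure_distr) auto
    show ?thesis
    proof (cases "(\<lambda>k. 2 * a * k) -` {x} = {}")
      case False
      then obtain k where "(\<lambda>k. 2 * a * k) -` {x} = {k}" using assms by fastforce
      then show ?thesis by (simp add: e)
    qed (simp add: e)
  qed
  then show ?thesis by (auto simp: configs_def equidistant_config_def)
qed

text \<open>\<open>Lim\<close>, the Bochner integral and the infinite sum are total functions, so
  being well-defined is stated by separate claims of convergence, integrability and summability. The
  claim on convergent expansions shows that \<open>determinantal_law\<close> prescribes the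
  generating function at least for all summable \<open>f\<close>, in particular for all
  \<open>f\<close> of finite support.\<close>

theorem proposition4p1:
  fixes a :: int
  assumes "a \<ge> 2"
  shows "(\<forall>k z. ((\<lambda>L. Phi_partial a k L z) \<longlongrightarrow> Phi a k z) at_top \<and>
            Phi a k z = (if z = of_int (2 * a * k) then 1
              else sin (of_real pi * (z / of_int (2 * a) - of_int k)) /
                   (of_real pi * (z / of_int (2 * a) - of_int k))))
       \<and> (\<forall>k t y. integrable sech_space
              (\<lambda>\<zeta>. Phi a k (of_int y + \<i> * of_real (sech_walk t \<zeta>))) \<and>
            mart_fun a k t y = 1 / (2 * of_real pi) *
              integral {-pi..pi} (\<lambda>l. exp (\<i> * of_real (l * (of_int y / of_int (2 * a) - of_int k)))
                                        / of_real (cos (l / of_int (2 * a)) ^ t)))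
       \<and> (\<forall>s x t y. (\<lambda>j. of_real (rw_prob s x (2 * a * j)) * mart_fun a j t y) summable_on UNIV)
       \<and> (\<forall>T ts f. observation_times T ts \<and> (\<forall>t\<in>set ts. f t summable_on UNIV) \<longrightarrow>
            fredholm_convergent ts (corr_kernel a) (\<lambda>t x. exp (f t x) - 1))
       \<and> (\<exists>!P. is_law_from (equidistant_config a) P \<and> determinantal_law (corr_kernel a) P)"
proof -
  have a: "a > 0" using assms by simp
  interpret correlations "st_correlation a" by (rule correlations_st[OF assms])
  obtain P where P: "is_law_from (equidistant_config a) P"
    and corr: "\<And>S. S \<in> st_subsets {1..} \<Longrightarrow> occ_mean P S = st_correlation a S"
    using law_exists[OF equidistant_config_configs[OF a]] by blast
  have ps: "prob_space P" "sets P = sets path_space" using P by (auto simp: is_law_from_def)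
  have R: "set_det S (\<lambda>p q. corr_kernel a (fst p) (snd p) (fst q) (snd q)) = of_real (st_correlation a S)"
    if "S \<in> st_subsets {1..}" for S
    using set_det_st_kernel_real[OF assms that] by (simp only: st_kernel_def[abs_def])
  \<comment> \<open>The constructed law identifies the determinants with means of products of
    indicators. This yields the bounds on which convergence for summable \<open>f\<close> and
    uniqueness rely.\<close>
  have R01: "0 \<le> st_correlation a S \<and> st_correlation a S \<le> 1" if "S \<in> st_subsets {1..}" for S
  proof -
    interpret prob_space P by fact
    have "0 \<le> occ_mean P S"
      by (intro Bochner_Integration.integral_nonneg prod_nonneg ballI occ_nonneg)
    moreover have "occ_mean P S \<le> 1"
      by (rule integral_le_const[OF integrable_prod_occ[OF ps]])
        (intro AE_I2 prod_le_1 conjI occ_nonneg occ_le_1)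
    ultimately show ?thesis by (simp only: corr[OF that])
  qed
  have Phi_lim: "((\<lambda>L. Phi_partial a k L z) \<longlongrightarrow> Phi a k z) at_top" for k z
    using Phi_partial_tendsto[OF a] by (simp only: Phi_eq_sinc[OF a])
  have Phi_sin: "Phi a k z = (if z = of_int (2 * a * k) then 1
      else sin (of_real pi * (z / of_int (2 * a) - of_int k)) / (of_real pi * (z / of_int (2 * a) - of_int k)))" for k z
  proof -
    have "z / of_int (2 * a) - of_int k = 0 \<longleftrightarrow> z = of_int (2 * a * k)"
      using a by (simp add: field_simps)
    then show ?thesis unfolding Phi_eq_sinc[OF a] csinc_def by (simp only:)
  qed
  have conv: "fredholm_convergent ts (corr_kernel a) (\<lambda>t x. exp (f t x) - 1)"
    if "observation_times T ts" "\<forall>t\<in>set ts. f t summable_on UNIV" for T ts f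
  proof -
    have ts: "distinct ts" "set ts \<subseteq> {1..}"
      using that(1) by (auto simp: observation_times_def strict_sorted_iff)
    then have mem: "S \<in> st_subsets {1..}" if "S \<in> st_subsets (set ts)" for S using that by blast
    show ?thesis
      by (rule fredholm_convergent_summable[OF ts(1) R[OF mem] R01[OF mem]]) (use that(2) in auto)
  qed
  have law: "determinantal_law (corr_kernel a) P"
    by (rule determinantal_law_of_correlation[OF ps R corr])
  have unique: "\<exists>!P. is_law_from (equidistant_config a) P \<and> determinantal_law (corr_kernel a) P"
  proof (rule ex1I[of _ P])
    fix P' assume "is_law_from (equidistant_config a) P' \<and> determinantal_law (corr_kernel a) P'"
    then show "P' = P" using determinantal_law_unique[OF _ _ P law R R01] by blast
  qed (use P law in blast)
  show ?thesis
    by (intro conjI allI impI Phi_lim Phi_sin Phi_dominated(1)[OF assms] mart_fun_integral[OF assms]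
        summable_kernel[OF a] conv unique) (auto)
qed

end
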